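(* Suppose $\mathcal{C}$ is a quasi-Frobenius abelian category with enough projectives and functorially enough injectives. Then $\mathcal{C}$ admits the structure of a Waldhausen category in which the cofibrations are the monomorphisms and the weak equivalences are the stable equivalences. Furthermore, this Waldhausen category satisfies the saturation and extension axioms, and it admits a cylinder functor satisfying the cylinder axiom.
   Context: An abelian category $\mathcal{C}$ is quasi-Frobenius if its projective objects are exactly its injective objects. $\mathcal{C}$ has functorially enough injectives if there exist a functor $I:\mathcal{C}\to\mathcal{C}$ and a natural transformation $\eta:\mathrm{id}_{\mathcal{C}}\to I$ such that, for all objects $X$, $I(X)$ is injective and $\eta(X):X\to I(X)$ is a monomorphism, and such that if $f:X\to Y$ is a monomorphism then so is $I(f)$. For maps $f,g:M\to N$ write $f\simeq g$ if $f-g$ factors through a projective object. A map $f:M\to N$ is a stable equivalence if there is $h:N\to M$ with $f\circ h\simeq\mathrm{id}_N$ and $h\circ f\simeq \mathrm{id}_M$. **Waldhausen categories.** A Waldhausen category is a pointed category (zero object $\mathrm{pt}$) with finite pushouts, with a specified class of cofibrations and a specified class of weak equivalences, both closed under composition, such that: (Cof 1) isomorphisms are cofibrations; (Cof 2) $\mathrm{pt}\to X$ is a cofibration for every object $X$; (Cof 3) if $X\to Y$ is a morphism and $X\to Z$ a cofibration, then $Y\to Y\coprod_X Z$ is a cofibration; (Weq 1) isomorphisms are weak equivalences; (Weq 2) given a commutative diagram with rows $Y\leftarrow X\to Z$ and $Y'\leftarrow X'\to Z'$ and vertical maps from the first row to the second, with $X\to Y$ and $X'\to Y'$ cofibrations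 and all three vertical maps weak equivalences, the induced map $Y\coprod_X Z\to Y'\coprod_{X'}Z'$ is a weak equivalence. Saturation axiom: if $f,g$ are composable and two of $f,g,g\circ f$ are weak equivalences, so is the third. Extension axiom: given a map of cofiber sequences from $X\to Y\to Y/X$ to $X'\to Y'\to Y'/X'$ such that $X\to X'$ and $Y/X\to Y'/X'$ are weak equivalences, $Y\to Y'$ is a weak equivalence. **Cylinder functors.** A cylinder functor on a Waldhausen category is a functor from the category of arrows $f:X\to Y$ to the category of diagrams consisting of an object $T(f)$ and maps $j_1:X\to T(f)$, $j_2:Y\to T(f)$, $p:T(f)\to Y$ with $p\circ j_1=f$ and $p\circ j_2=\mathrm{id}_Y$, such that: (Cyl 1) given a commutative square from $f':X'\to Y'$ to $f:X\to Y$ whose vertical maps $X'\to X$, $Y'\to Y$ are weak equivalences, the map $T(f')\to T(f)$ is a weak equivalence; and if the vertical maps are cofibrations, then $T(f')\to T(f)$ and $X\coprod_{X'}T(f')\coprod_{Y'}Y\to T(f)$ are cofibrations; (Cyl 2) $T(\mathrm{pt}\to Y)=Y$, with $p$ and $j_2$ the identity of $Y$; (Cyl 3) $j_1\coprod j_2:X\coprod Y\to T(f)$ is a cofibration. It satisfies the cylinder axiom if for every map $f$ the map $p$ is a weak equivalence. *)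

theory Defs
  imports "HOL-Algebra.Group"
begin

section \<open>Categories, functors and natural transformations\<close>

record ('o, 'm) category =
  Obj :: "'o set"
  Mor :: "'m set"
  Dom :: "'m \<Rightarrow> 'o"
  Cod :: "'m \<Rightarrow> 'o"
  Ident :: "'o \<Rightarrow> 'm"
  Comp :: "'m \<Rightarrow> 'm \<Rightarrow> 'm" (infixl "\<cdot>\<index>" 70)

definition Hom :: "('o, 'm, 'x) category_scheme \<Rightarrow> 'o \<Rightarrow> 'o \<Rightarrow> 'm set" where
  "Hom C X Y = {f \<in> Mor C. Dom C f = X \<and> Cod C f = Y}"

locale category =
  fixes C :: "('o, 'm, 'x) category_scheme" (structure)
  assumes dom_obj: "f \<in> Mor C \<Longrightarrow> Dom C f \<in> Obj C"
    and cod_obj: "f \<in> Mor C \<Longrightarrow> Cod C f \<in> Obj C"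
    and id_hom: "X \<in> Obj C \<Longrightarrow> Ident C X \<in> Hom C X X"
    and comp_hom: "\<lbrakk>f \<in> Hom C X Y; g \<in> Hom C Y Z\<rbrakk> \<Longrightarrow> g \<cdot> f \<in> Hom C X Z"
    and comp_assoc: "\<lbrakk>f \<in> Hom C W X; g \<in> Hom C X Y; h \<in> Hom C Y Z\<rbrakk>
          \<Longrightarrow> (h \<cdot> g) \<cdot> f = h \<cdot> (g \<cdot> f)"
    and comp_id_right: "f \<in> Hom C X Y \<Longrightarrow> f \<cdot> Ident C X = f"
    and comp_id_left: "f \<in> Hom C X Y \<Longrightarrow> Ident C Y \<cdot> f = f"

record ('o, 'm, 'p, 'n) functor_data =
  OMap :: "'o \<Rightarrow> 'p"
  MMap :: "'m \<Rightarrow> 'n"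

locale cat_functor = dom: category C + cod: category D
  for C :: "('o, 'm, 'x) category_scheme" (structure)
    and D :: "('p, 'n, 'y) category_scheme" (structure) +
  fixes F :: "('o, 'm, 'p, 'n) functor_data"
  assumes map_obj: "X \<in> Obj C \<Longrightarrow> OMap F X \<in> Obj D"
    and map_hom: "f \<in> Hom C X Y \<Longrightarrow> MMap F f \<in> Hom D (OMap F X) (OMap F Y)"
    and map_id: "X \<in> Obj C \<Longrightarrow> MMap F (Ident C X) = Ident D (OMap F X)"
    and map_comp: "\<lbrakk>f \<in> Hom C X Y; g \<in> Hom C Y Z\<rbrakk>
          \<Longrightarrow> MMap F (g \<cdot>\<^bsub>C\<^esub> f) = MMap F g \<cdot>\<^bsub>D\<^esub> MMap F f"

definition id_functor :: "('o, 'm, 'o, 'm) functor_data" where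
  "id_functor = \<lparr>OMap = \<lambda>X. X, MMap = \<lambda>f. f\<rparr>"

locale natural_transformation = source: cat_functor C D F + target: cat_functor C D G
  for C :: "('o, 'm, 'x) category_scheme" (structure)
    and D :: "('p, 'n, 'y) category_scheme" (structure)
    and F :: "('o, 'm, 'p, 'n) functor_data" and G :: "('o, 'm, 'p, 'n) functor_data" +
  fixes \<eta> :: "'o \<Rightarrow> 'n"
  assumes component: "X \<in> Obj C \<Longrightarrow> \<eta> X \<in> Hom D (OMap F X) (OMap G X)"
    and naturality: "f \<in> Hom C X Y \<Longrightarrow> \<eta> Y \<cdot>\<^bsub>D\<^esub> MMap F f = MMap G f \<cdot>\<^bsub>D\<^esub> \<eta> X"

definition isomorphism :: "('o, 'm, 'x) category_scheme \<Rightarrow> 'm \<Rightarrow> bool" where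
  "isomorphism C f \<longleftrightarrow> f \<in> Mor C \<and>
    (\<exists>g \<in> Hom C (Cod C f) (Dom C f).
      g \<cdot>\<^bsub>C\<^esub> f = Ident C (Dom C f) \<and> f \<cdot>\<^bsub>C\<^esub> g = Ident C (Cod C f))"

definition monomorphism :: "('o, 'm, 'x) category_scheme \<Rightarrow> 'm \<Rightarrow> bool" where
  "monomorphism C f \<longleftrightarrow> f \<in> Mor C \<and>
    (\<forall>W. \<forall>g \<in> Hom C W (Dom C f). \<forall>h \<in> Hom C W (Dom C f).
      f \<cdot>\<^bsub>C\<^esub> g = f \<cdot>\<^bsub>C\<^esub> h \<longrightarrow> g = h)"

definition epimorphism :: "('o, 'm, 'x) category_scheme \<Rightarrow> 'm \<Rightarrow> bool" where
  "epimorphism C f \<longleftrightarrow> f \<in> Mor C \<and>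
    (\<forall>W. \<forall>g \<in> Hom C (Cod C f) W. \<forall>h \<in> Hom C (Cod C f) W.
      g \<cdot>\<^bsub>C\<^esub> f = h \<cdot>\<^bsub>C\<^esub> f \<longrightarrow> g = h)"

definition zero_object :: "('o, 'm, 'x) category_scheme \<Rightarrow> 'o \<Rightarrow> bool" where
  "zero_object C Z \<longleftrightarrow> Z \<in> Obj C \<and>
    (\<forall>X \<in> Obj C. (\<exists>!f. f \<in> Hom C X Z) \<and> (\<exists>!f. f \<in> Hom C Z X))"

text \<open>\<open>coproduct C i j\<close>: the maps \<open>i: X \<rightarrow> P\<close> and \<open>j: Y \<rightarrow> P\<close> exhibit \<open>P\<close> as a coproduct of \<open>X\<close> and \<open>Y\<close>.\<close>

definition coproduct :: "('o, 'm, 'x) category_scheme \<Rightarrow> 'm \<Rightarrow> 'm \<Rightarrow> bool" where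
  "coproduct C i j \<longleftrightarrow> i \<in> Mor C \<and> j \<in> Mor C \<and> Cod C i = Cod C j \<and>
    (\<forall>W. \<forall>a \<in> Hom C (Dom C i) W. \<forall>b \<in> Hom C (Dom C j) W.
      \<exists>!w. w \<in> Hom C (Cod C i) W \<and> w \<cdot>\<^bsub>C\<^esub> i = a \<and> w \<cdot>\<^bsub>C\<^esub> j = b)"

text \<open>\<open>pushout C f g i j\<close>: the maps \<open>i: Y \<rightarrow> P\<close> and \<open>j: Z \<rightarrow> P\<close> exhibit \<open>P\<close> as a pushout of
  \<open>f: X \<rightarrow> Y\<close> and \<open>g: X \<rightarrow> Z\<close>.\<close>

definition pushout :: "('o, 'm, 'x) category_scheme \<Rightarrow> 'm \<Rightarrow> 'm \<Rightarrow> 'm \<Rightarrow> 'm \<Rightarrow> bool" where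
  "pushout C f g i j \<longleftrightarrow> f \<in> Mor C \<and> g \<in> Mor C \<and> i \<in> Mor C \<and> j \<in> Mor C \<and>
    Dom C f = Dom C g \<and> Dom C i = Cod C f \<and> Dom C j = Cod C g \<and> Cod C i = Cod C j \<and>
    i \<cdot>\<^bsub>C\<^esub> f = j \<cdot>\<^bsub>C\<^esub> g \<and>
    (\<forall>W. \<forall>a \<in> Hom C (Cod C f) W. \<forall>b \<in> Hom C (Cod C g) W. a \<cdot>\<^bsub>C\<^esub> f = b \<cdot>\<^bsub>C\<^esub> g \<longrightarrow>
      (\<exists>!w. w \<in> Hom C (Cod C i) W \<and> w \<cdot>\<^bsub>C\<^esub> i = a \<and> w \<cdot>\<^bsub>C\<^esub> j = b))"

section \<open>Abelian categories\<close>

record ('o, 'm) preadditive = "('o, 'm) category" +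
  Add :: "'m \<Rightarrow> 'm \<Rightarrow> 'm"
  Zero :: "'o \<Rightarrow> 'o \<Rightarrow> 'm"

text \<open>The groups of HOL-Algebra are written multiplicatively, so \<open>f \<otimes> inv g\<close> in \<open>hom_group C X Y\<close>
  is the difference of the morphisms \<open>f\<close> and \<open>g\<close>.\<close>

definition hom_group :: "('o, 'm, 'x) preadditive_scheme \<Rightarrow> 'o \<Rightarrow> 'o \<Rightarrow> 'm monoid" where
  "hom_group C X Y = \<lparr>carrier = Hom C X Y, mult = Add C, one = Zero C X Y\<rparr>"

locale preadditive_category = category C
  for C :: "('o, 'm, 'x) preadditive_scheme" (structure) +
  assumes hom_comm_group: "\<lbrakk>X \<in> Obj C; Y \<in> Obj C\<rbrakk> \<Longrightarrow> comm_group (hom_group C X Y)"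
    and comp_add_right: "\<lbrakk>f \<in> Hom C X Y; g \<in> Hom C X Y; h \<in> Hom C Y Z\<rbrakk>
          \<Longrightarrow> h \<cdot> Add C f g = Add C (h \<cdot> f) (h \<cdot> g)"
    and comp_add_left: "\<lbrakk>f \<in> Hom C X Y; g \<in> Hom C Y Z; h \<in> Hom C Y Z\<rbrakk>
          \<Longrightarrow> Add C g h \<cdot> f = Add C (g \<cdot> f) (h \<cdot> f)"

definition kernel :: "('o, 'm, 'x) preadditive_scheme \<Rightarrow> 'm \<Rightarrow> 'm \<Rightarrow> bool" where
  "kernel C f k \<longleftrightarrow> f \<in> Mor C \<and> k \<in> Mor C \<and> Cod C k = Dom C f \<and>
    f \<cdot>\<^bsub>C\<^esub> k = Zero C (Dom C k) (Cod C f) \<and>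
    (\<forall>W. \<forall>h \<in> Hom C W (Dom C f). f \<cdot>\<^bsub>C\<^esub> h = Zero C W (Cod C f) \<longrightarrow>
      (\<exists>!u. u \<in> Hom C W (Dom C k) \<and> k \<cdot>\<^bsub>C\<^esub> u = h))"

definition cokernel :: "('o, 'm, 'x) preadditive_scheme \<Rightarrow> 'm \<Rightarrow> 'm \<Rightarrow> bool" where
  "cokernel C f c \<longleftrightarrow> f \<in> Mor C \<and> c \<in> Mor C \<and> Dom C c = Cod C f \<and>
    c \<cdot>\<^bsub>C\<^esub> f = Zero C (Dom C f) (Cod C c) \<and>
    (\<forall>W. \<forall>h \<in> Hom C (Cod C f) W. h \<cdot>\<^bsub>C\<^esub> f = Zero C (Dom C f) W \<longrightarrow>
      (\<exists>!u. u \<in> Hom C (Cod C c) W \<and> u \<cdot>\<^bsub>C\<^esub> c = h))"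

locale abelian_category = preadditive_category C
  for C :: "('o, 'm, 'x) preadditive_scheme" (structure) +
  assumes ex_zero_object: "\<exists>Z. zero_object C Z"
    and ex_biproduct: "\<lbrakk>X \<in> Obj C; Y \<in> Obj C\<rbrakk> \<Longrightarrow>
          \<exists>B \<in> Obj C. \<exists>i \<in> Hom C X B. \<exists>j \<in> Hom C Y B. \<exists>p \<in> Hom C B X. \<exists>q \<in> Hom C B Y.
            p \<cdot> i = Ident C X \<and> q \<cdot> j = Ident C Y \<and> q \<cdot> i = Zero C X Y \<and> p \<cdot> j = Zero C Y X \<and>
            Add C (i \<cdot> p) (j \<cdot> q) = Ident C B"
    and ex_kernel: "f \<in> Mor C \<Longrightarrow> \<exists>k. kernel C f k"
    and ex_cokernel: "f \<in> Mor C \<Longrightarrow> \<exists>c. cokernel C f c"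
    and mono_is_kernel: "monomorphism C f \<Longrightarrow> \<exists>g. kernel C g f"
    and epi_is_cokernel: "epimorphism C f \<Longrightarrow> \<exists>g. cokernel C g f"

definition projective :: "('o, 'm, 'x) category_scheme \<Rightarrow> 'o \<Rightarrow> bool" where
  "projective C P \<longleftrightarrow> P \<in> Obj C \<and>
    (\<forall>e. epimorphism C e \<longrightarrow>
      (\<forall>f \<in> Hom C P (Cod C e). \<exists>g \<in> Hom C P (Dom C e). e \<cdot>\<^bsub>C\<^esub> g = f))"

definition injective :: "('o, 'm, 'x) category_scheme \<Rightarrow> 'o \<Rightarrow> bool" where
  "injective C J \<longleftrightarrow> J \<in> Obj C \<and>
    (\<forall>m. monomorphism C m \<longrightarrow>
      (\<forall>f \<in> Hom C (Dom C m) J. \<exists>g \<in> Hom C (Cod C m) J. g \<cdot>\<^bsub>C\<^esub> m = f))"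

locale quasi_frobenius_category = abelian_category C
  for C :: "('o, 'm, 'x) preadditive_scheme" (structure) +
  assumes projective_iff_injective: "X \<in> Obj C \<Longrightarrow> projective C X \<longleftrightarrow> injective C X"

definition enough_projectives :: "('o, 'm, 'x) category_scheme \<Rightarrow> bool" where
  "enough_projectives C \<longleftrightarrow>
    (\<forall>X \<in> Obj C. \<exists>P. projective C P \<and> (\<exists>e \<in> Hom C P X. epimorphism C e))"

definition functorially_enough_injectives :: "('o, 'm, 'x) category_scheme \<Rightarrow> bool" where
  "functorially_enough_injectives C \<longleftrightarrow>
    (\<exists>I \<eta>. natural_transformation C C id_functor I \<eta> \<and>
      (\<forall>X \<in> Obj C. injective C (OMap I X) \<and> monomorphism C (\<eta> X)) \<and>
      (\<forall>f. monomorphism C f \<longrightarrow> monomorphism C (MMap I f)))"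

definition stably_equal :: "('o, 'm, 'x) preadditive_scheme \<Rightarrow> 'm \<Rightarrow> 'm \<Rightarrow> bool" where
  "stably_equal C f g \<longleftrightarrow>
    (\<exists>M N. f \<in> Hom C M N \<and> g \<in> Hom C M N \<and>
      (\<exists>P. projective C P \<and> (\<exists>a \<in> Hom C M P. \<exists>b \<in> Hom C P N.
        f \<otimes>\<^bsub>hom_group C M N\<^esub> inv\<^bsub>hom_group C M N\<^esub> g = b \<cdot>\<^bsub>C\<^esub> a)))"

definition stable_equivalence :: "('o, 'm, 'x) preadditive_scheme \<Rightarrow> 'm \<Rightarrow> bool" where
  "stable_equivalence C f \<longleftrightarrow> f \<in> Mor C \<and>
    (\<exists>h \<in> Hom C (Cod C f) (Dom C f).
      stably_equal C (f \<cdot>\<^bsub>C\<^esub> h) (Ident C (Cod C f)) \<and> stably_equal C (h \<cdot>\<^bsub>C\<^esub> f) (Ident C (Dom C f)))"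

section \<open>Waldhausen categories\<close>

text \<open>Pushouts and the maps they induce are not chosen: an axiom about a pushout is required of
  every pushout square, and an axiom about the induced map is required of every map satisfying the
  equations that determine it. Finite pushouts are iterated binary ones.\<close>

locale waldhausen_category = category C
  for C :: "('o, 'm, 'x) category_scheme" (structure) +
  fixes pt :: 'o and cof :: "'m set" and weq :: "'m set"
  assumes zero_pt: "zero_object C pt"
    and ex_pushout: "\<lbrakk>f \<in> Hom C X Y; g \<in> Hom C X Z\<rbrakk> \<Longrightarrow> \<exists>i j. pushout C f g i j"
    and cof_mor: "cof \<subseteq> Mor C"
    and weq_mor: "weq \<subseteq> Mor C"
    and cof_comp: "\<lbrakk>f \<in> cof; g \<in> cof; Cod C f = Dom C g\<rbrakk> \<Longrightarrow> g \<cdot> f \<in> cof"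
    and weq_comp: "\<lbrakk>f \<in> weq; g \<in> weq; Cod C f = Dom C g\<rbrakk> \<Longrightarrow> g \<cdot> f \<in> weq"
    and Cof1: "isomorphism C f \<Longrightarrow> f \<in> cof"
    and Cof2: "\<lbrakk>X \<in> Obj C; f \<in> Hom C pt X\<rbrakk> \<Longrightarrow> f \<in> cof"
    and Cof3: "\<lbrakk>pushout C f g i j; g \<in> cof\<rbrakk> \<Longrightarrow> i \<in> cof"
    and Weq1: "isomorphism C f \<Longrightarrow> f \<in> weq"
    and Weq2: "\<lbrakk>pushout C f g i j; pushout C f' g' i' j'; f \<in> cof; f' \<in> cof;
          x \<in> Hom C (Dom C f) (Dom C f'); x \<in> weq;
          y \<in> Hom C (Cod C f) (Cod C f'); y \<in> weq;
          z \<in> Hom C (Cod C g) (Cod C g'); z \<in> weq;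
          y \<cdot> f = f' \<cdot> x; z \<cdot> g = g' \<cdot> x;
          w \<in> Hom C (Cod C i) (Cod C i'); w \<cdot> i = i' \<cdot> y; w \<cdot> j = j' \<cdot> z\<rbrakk>
          \<Longrightarrow> w \<in> weq"

definition saturation_axiom :: "('o, 'm, 'x) category_scheme \<Rightarrow> 'm set \<Rightarrow> bool" where
  "saturation_axiom C weq \<longleftrightarrow>
    (\<forall>f \<in> Mor C. \<forall>g \<in> Mor C. Cod C f = Dom C g \<longrightarrow>
      (f \<in> weq \<and> g \<in> weq \<longrightarrow> g \<cdot>\<^bsub>C\<^esub> f \<in> weq) \<and>
      (f \<in> weq \<and> g \<cdot>\<^bsub>C\<^esub> f \<in> weq \<longrightarrow> g \<in> weq) \<and>
      (g \<in> weq \<and> g \<cdot>\<^bsub>C\<^esub> f \<in> weq \<longrightarrow> f \<in> weq))"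

text \<open>\<open>X \<rightarrow> Y \<rightarrow> Y/X\<close>, where \<open>Y/X\<close> is the pushout of \<open>Y \<leftarrow> X \<rightarrow> pt\<close>.\<close>

definition cofiber_sequence ::
  "('o, 'm, 'x) category_scheme \<Rightarrow> 'o \<Rightarrow> 'm set \<Rightarrow> 'm \<Rightarrow> 'm \<Rightarrow> bool" where
  "cofiber_sequence C pt cof i q \<longleftrightarrow> i \<in> cof \<and>
    (\<exists>t z. t \<in> Hom C (Dom C i) pt \<and> pushout C i t q z)"

definition extension_axiom ::
  "('o, 'm, 'x) category_scheme \<Rightarrow> 'o \<Rightarrow> 'm set \<Rightarrow> 'm set \<Rightarrow> bool" where
  "extension_axiom C pt cof weq \<longleftrightarrow>
    (\<forall>i q i' q' x y z.
      cofiber_sequence C pt cof i q \<and> cofiber_sequence C pt cof i' q' \<and>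
      x \<in> Hom C (Dom C i) (Dom C i') \<and> y \<in> Hom C (Cod C i) (Cod C i') \<and>
      z \<in> Hom C (Cod C q) (Cod C q') \<and>
      y \<cdot>\<^bsub>C\<^esub> i = i' \<cdot>\<^bsub>C\<^esub> x \<and> z \<cdot>\<^bsub>C\<^esub> q = q' \<cdot>\<^bsub>C\<^esub> y \<and> x \<in> weq \<and> z \<in> weq
      \<longrightarrow> y \<in> weq)"

section \<open>Cylinder functors\<close>

text \<open>\<open>Square f' f u v\<close> is the morphism \<open>f' \<rightarrow> f\<close> of the arrow category given by \<open>u\<close> on domains
  and \<open>v\<close> on codomains.\<close>

datatype 'm square = Square (sq_src: 'm) (sq_tgt: 'm) (sq_dom: 'm) (sq_cod: 'm)

definition arrow_category :: "('o, 'm, 'x) category_scheme \<Rightarrow> ('m, 'm square) category" where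
  "arrow_category C =
    \<lparr>Obj = Mor C,
     Mor = {Square f' f u v |f' f u v.
       f' \<in> Mor C \<and> f \<in> Mor C \<and> u \<in> Hom C (Dom C f') (Dom C f) \<and>
       v \<in> Hom C (Cod C f') (Cod C f) \<and> v \<cdot>\<^bsub>C\<^esub> f' = f \<cdot>\<^bsub>C\<^esub> u},
     Dom = sq_src,
     Cod = sq_tgt,
     Ident = (\<lambda>f. Square f f (Ident C (Dom C f)) (Ident C (Cod C f))),
     Comp = (\<lambda>s r. Square (sq_src r) (sq_tgt s)
       (sq_dom s \<cdot>\<^bsub>C\<^esub> sq_dom r) (sq_cod s \<cdot>\<^bsub>C\<^esub> sq_cod r))\<rparr>"

lemma (in category) arrow_category_category: "category (arrow_category C)"
proof -
  have id: "Ident C X \<in> Mor C \<and> Dom C (Ident C X) = X \<and> Cod C (Ident C X) = X"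
    if "X \<in> Obj C" for X
    using id_hom[OF that] by (simp add: Hom_def)
  have comp: "g \<cdot> f \<in> Mor C \<and> Dom C (g \<cdot> f) = Dom C f \<and> Cod C (g \<cdot> f) = Cod C g"
    if "f \<in> Mor C" "g \<in> Mor C" "Dom C g = Cod C f" for f g
    using comp_hom[of f "Dom C f" "Cod C f" g "Cod C g"] that by (simp add: Hom_def)
  have assoc: "(h \<cdot> g) \<cdot> f = h \<cdot> (g \<cdot> f)"
    if "f \<in> Mor C" "g \<in> Mor C" "h \<in> Mor C" "Dom C g = Cod C f" "Dom C h = Cod C g" for f g h
    using comp_assoc[of f "Dom C f" "Cod C f" g "Cod C g" h "Cod C h"] that by (simp add: Hom_def)
  have unit: "f \<in> Mor C \<Longrightarrow> Dom C f = X \<Longrightarrow> f \<cdot> Ident C X = f"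
    "f \<in> Mor C \<Longrightarrow> Cod C f = Y \<Longrightarrow> Ident C Y \<cdot> f = f" for f X Y
    using comp_id_right comp_id_left by (auto simp: Hom_def)
  have paste: "(v' \<cdot> v) \<cdot> f = h \<cdot> (u' \<cdot> u)"
    if "f \<in> Mor C" "g \<in> Mor C" "h \<in> Mor C" "u \<in> Mor C" "v \<in> Mor C" "u' \<in> Mor C" "v' \<in> Mor C"
      "Dom C u = Dom C f" "Cod C u = Dom C g" "Dom C u' = Dom C g" "Cod C u' = Dom C h"
      "Dom C v = Cod C f" "Cod C v = Cod C g" "Dom C v' = Cod C g" "Cod C v' = Cod C h"
      "v \<cdot> f = g \<cdot> u" "v' \<cdot> g = h \<cdot> u'" for f g h u v u' v'
  proof -
    have "(v' \<cdot> v) \<cdot> f = v' \<cdot> (g \<cdot> u)" using that assoc[of f v v'] by simp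
    also have "\<dots> = (h \<cdot> u') \<cdot> u" using that assoc[of u g v'] by simp
    also have "\<dots> = h \<cdot> (u' \<cdot> u)" using that assoc[of u u' h] by simp
    finally show ?thesis .
  qed
  show ?thesis
  proof (unfold_locales, goal_cases)
    case (4 f X Y g Z)
    then show ?case
      by (clarsimp simp: arrow_category_def Hom_def comp) (rule paste; assumption)
  qed (auto simp: arrow_category_def Hom_def dom_obj cod_obj id comp unit assoc)
qed

definition source_functor :: "('o, 'm, 'x) category_scheme \<Rightarrow> ('m, 'm square, 'o, 'm) functor_data" where
  "source_functor C = \<lparr>OMap = Dom C, MMap = sq_dom\<rparr>"

definition target_functor :: "('o, 'm, 'x) category_scheme \<Rightarrow> ('m, 'm square, 'o, 'm) functor_data" where
  "target_functor C = \<lparr>OMap = Cod C, MMap = sq_cod\<rparr>"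

text \<open>A functor sending \<open>f: X \<rightarrow> Y\<close> to a diagram of maps \<open>j\<^sub>1: X \<rightarrow> T(f)\<close>, \<open>j\<^sub>2: Y \<rightarrow> T(f)\<close>,
  \<open>p: T(f) \<rightarrow> Y\<close>, and a square \<open>f' \<rightarrow> f\<close> to a map of diagrams that is the given one on \<open>X'\<close> and \<open>Y'\<close>,
  amounts to a functor \<open>T\<close> to \<open>C\<close> with \<open>j\<^sub>1\<close>, \<open>j\<^sub>2\<close>, \<open>p\<close> natural.

  In \<open>Cyl1_cof\<close>, \<open>Q\<close> with \<open>a\<close>, \<open>b\<close> is the pushout of \<open>X \<leftarrow> X' \<rightarrow> T(f')\<close>, and \<open>R\<close> with \<open>c\<close>, \<open>d\<close> is
  the pushout of \<open>Q \<leftarrow> Y' \<rightarrow> Y\<close>.\<close>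

locale cylinder_functor = waldhausen_category C pt cof weq
  for C :: "('o, 'm, 'x) category_scheme" (structure)
    and pt :: 'o and cof :: "'m set" and weq :: "'m set" +
  fixes T :: "('m, 'm square, 'o, 'm) functor_data" and j1 j2 p :: "'m \<Rightarrow> 'm"
  assumes functor_T: "cat_functor (arrow_category C) C T"
    and natural_j1: "natural_transformation (arrow_category C) C (source_functor C) T j1"
    and natural_j2: "natural_transformation (arrow_category C) C (target_functor C) T j2"
    and natural_p: "natural_transformation (arrow_category C) C T (target_functor C) p"
    and p_j1: "f \<in> Mor C \<Longrightarrow> p f \<cdot> j1 f = f"
    and p_j2: "f \<in> Mor C \<Longrightarrow> p f \<cdot> j2 f = Ident C (Cod C f)"
    and Cyl1_weq: "\<lbrakk>Square f' f u v \<in> Mor (arrow_category C); u \<in> weq; v \<in> weq\<rbrakk>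
          \<Longrightarrow> MMap T (Square f' f u v) \<in> weq"
    and Cyl1_cof_T: "\<lbrakk>Square f' f u v \<in> Mor (arrow_category C); u \<in> cof; v \<in> cof\<rbrakk>
          \<Longrightarrow> MMap T (Square f' f u v) \<in> cof"
    and Cyl1_cof: "\<lbrakk>Square f' f u v \<in> Mor (arrow_category C); u \<in> cof; v \<in> cof;
          pushout C u (j1 f') a b; pushout C (b \<cdot> j2 f') v c d;
          a \<in> Hom C (Dom C f) Q; c \<in> Hom C Q R; w \<in> Hom C R (OMap T f);
          w \<cdot> (c \<cdot> a) = j1 f; w \<cdot> (c \<cdot> b) = MMap T (Square f' f u v); w \<cdot> d = j2 f\<rbrakk>
          \<Longrightarrow> w \<in> cof"
    and Cyl2: "\<lbrakk>Y \<in> Obj C; f \<in> Hom C pt Y\<rbrakk>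
          \<Longrightarrow> OMap T f = Y \<and> p f = Ident C Y \<and> j2 f = Ident C Y"
    and Cyl3: "\<lbrakk>f \<in> Hom C X Y; i \<in> Hom C X S; k \<in> Hom C Y S; coproduct C i k;
          w \<in> Hom C S (OMap T f); w \<cdot> i = j1 f; w \<cdot> k = j2 f\<rbrakk>
          \<Longrightarrow> w \<in> cof"

definition cylinder_axiom :: "('o, 'm, 'x) category_scheme \<Rightarrow> 'm set \<Rightarrow> ('m \<Rightarrow> 'm) \<Rightarrow> bool" where
  "cylinder_axiom C weq p \<longleftrightarrow> (\<forall>f \<in> Mor C. p f \<in> weq)"

end

theory Submission
  imports Defs
begin

text \<open>
  Call a map null if it factors through a projective object. Null maps form an ideal, stable equality
  is congruence modulo this ideal, and a stable equivalence is a map that is invertible modulo it.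
  Closure under composition and saturation are therefore formal. The other axioms about stable
  equivalences rest on one fact: if \<open>(x, y, z)\<close> is a map of short exact sequences and \<open>y\<close> and one of
  \<open>x\<close>, \<open>z\<close> are stable equivalences, then so is the remaining one (\<open>weq_exact_right\<close>,
  \<open>weq_exact_left\<close>).

  To see this, take stable inverses of the two given maps. They are compatible with the sequences only
  up to a map through a projective object \<open>P\<close>. As \<open>P\<close> is both projective and injective, this error can
  be extended along the monomorphism, or lifted along the epimorphism, and subtracted; then the two
  inverses are part of a map of sequences in the opposite direction. Both composites are endomorphisms
  of a short exact sequence that are stably the identity in two places. In the third place such an
  endomorphism is \<open>1 + n\<close> with \<open>n\<close> not necessarily null; but \<open>n \<cdot> n\<close> is null, so \<open>1 - n\<close> is a stable
  inverse (\<open>weq_exact_endo_right\<close>, \<open>weq_exact_endo_left\<close>).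

  A pushout \<open>P\<close> of a monomorphism \<open>X \<rightarrow> Y\<close> along \<open>X \<rightarrow> Z\<close> is a short exact sequence
  \<open>X \<rightarrow> Y \<oplus> Z \<rightarrow> P\<close>. So for a map of such pushout squares that is a stable equivalence on \<open>Y\<close> and \<open>Z\<close>,
  the map on \<open>X\<close> is a stable equivalence if and only if the map on \<open>P\<close> is one (\<open>pushout_weq\<close>). One
  direction is (Weq 2). Both directions together give the extension axiom: embed \<open>Y\<close> into an injective
  object \<open>J\<close>. The pushout \<open>W\<close> of \<open>J \<leftarrow> Y \<rightarrow> Y/X\<close> is also the pushout of \<open>J \<leftarrow> X \<rightarrow> pt\<close>. Every map
  between injective objects is a stable equivalence, so the second square shows that \<open>W \<rightarrow> W'\<close> is a
  stable equivalence, and then the first square shows it for \<open>Y \<rightarrow> Y'\<close>.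

  The cylinder of \<open>f: X \<rightarrow> Y\<close> is \<open>Y \<oplus> I(X)\<close> with \<open>j\<^sub>1 = (f, \<eta>)\<close>, \<open>j\<^sub>2\<close> the inclusion of \<open>Y\<close> and \<open>p\<close> the
  projection to \<open>Y\<close>; since \<open>I(X)\<close> is projective, \<open>p\<close> is a stable equivalence. (Cyl 2) asks for
  \<open>I(pt) = 0\<close>, which fails for a functor with a constant injective summand, but holds once \<open>I(X)\<close> is
  replaced by the kernel of \<open>I(X) \<rightarrow> I(pt)\<close> (\<open>obtain_reduced_injective_functor\<close>). The second half of
  (Cyl 1) amounts to \<open>X \<squnion>\<^bsub>X'\<^esub> I(X') \<rightarrow> I(X)\<close> being a monomorphism for every monomorphism \<open>X' \<rightarrow> X\<close>.
  This follows from the new \<open>I\<close> mapping zero maps to zero maps (\<open>mono_pushout_unit\<close>).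
\<close>

section \<open>Monomorphisms and pushouts\<close>

text \<open>
  As a rewrite rule, this reduces the typing of a composite to equations between domains and codomains,
  which the simplifier decides.
\<close>
lemma in_Hom_iff [simp]: "f \<in> Hom C X Y \<longleftrightarrow> f \<in> Mor C \<and> Dom C f = X \<and> Cod C f = Y"
  by (simp add: Hom_def)

context category
begin

lemma comp_mor [simp]: "\<lbrakk>f \<in> Mor C; g \<in> Mor C; Dom C g = Cod C f\<rbrakk> \<Longrightarrow> g \<cdot> f \<in> Mor C"
  and dom_comp [simp]: "\<lbrakk>f \<in> Mor C; g \<in> Mor C; Dom C g = Cod C f\<rbrakk> \<Longrightarrow> Dom C (g \<cdot> f) = Dom C f"
  and cod_comp [simp]: "\<lbrakk>f \<in> Mor C; g \<in> Mor C; Dom C g = Cod C f\<rbrakk> \<Longrightarrow> Cod C (g \<cdot> f) = Cod C g"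
  using comp_hom[of f "Dom C f" "Cod C f" g "Cod C g"] by simp_all

lemma comp_assoc' [simp]:
  "\<lbrakk>f \<in> Mor C; g \<in> Mor C; h \<in> Mor C; Dom C g = Cod C f; Dom C h = Cod C g\<rbrakk>
    \<Longrightarrow> (h \<cdot> g) \<cdot> f = h \<cdot> (g \<cdot> f)"
  using comp_assoc[of f "Dom C f" "Cod C f" g "Cod C g" h "Cod C h"] by simp

lemma id_mor [simp]: "X \<in> Obj C \<Longrightarrow> Ident C X \<in> Mor C"
  and dom_id [simp]: "X \<in> Obj C \<Longrightarrow> Dom C (Ident C X) = X"
  and cod_id [simp]: "X \<in> Obj C \<Longrightarrow> Cod C (Ident C X) = X"
  using id_hom[of X] by simp_all

lemma comp_id_right' [simp]: "\<lbrakk>f \<in> Mor C; Dom C f = X\<rbrakk> \<Longrightarrow> f \<cdot> Ident C X = f"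
  and comp_id_left' [simp]: "\<lbrakk>f \<in> Mor C; Cod C f = Y\<rbrakk> \<Longrightarrow> Ident C Y \<cdot> f = f"
  using comp_id_right[of f "Dom C f" "Cod C f"] comp_id_left[of f "Dom C f" "Cod C f"] by simp_all

declare dom_obj [simp] cod_obj [simp]

lemma hom_obj: "f \<in> Hom C X Y \<Longrightarrow> X \<in> Obj C \<and> Y \<in> Obj C"
  by auto

text \<open>
  Composites are kept associated to the right, so an equation for \<open>h \<cdot> g\<close> is needed in this form to
  rewrite inside a longer composite.
\<close>
lemma comp_assoc_rewrite:
  assumes "h \<cdot> g = k" "f \<in> Mor C" "g \<in> Mor C" "h \<in> Mor C" "Dom C g = Cod C f" "Dom C h = Cod C g"
  shows "h \<cdot> (g \<cdot> f) = k \<cdot> f"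
  using assms comp_assoc' by metis

lemma mono_cancel:
  "\<lbrakk>monomorphism C f; g \<in> Hom C W (Dom C f); h \<in> Hom C W (Dom C f); f \<cdot> g = f \<cdot> h\<rbrakk> \<Longrightarrow> g = h"
  unfolding monomorphism_def by blast

lemma epi_cancel:
  "\<lbrakk>epimorphism C f; g \<in> Hom C (Cod C f) W; h \<in> Hom C (Cod C f) W; g \<cdot> f = h \<cdot> f\<rbrakk> \<Longrightarrow> g = h"
  unfolding epimorphism_def by blast

lemma mono_mor: "monomorphism C f \<Longrightarrow> f \<in> Mor C"
  by (simp add: monomorphism_def)

lemma epi_mor: "epimorphism C f \<Longrightarrow> f \<in> Mor C"
  by (simp add: epimorphism_def)

lemma mono_comp:
  assumes "monomorphism C f" "monomorphism C g" "Cod C f = Dom C g"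
  shows "monomorphism C (g \<cdot> f)"
proof -
  have t: "f \<in> Mor C" "g \<in> Mor C" using assms by (auto simp: mono_mor)
  have "a = b" if a: "a \<in> Hom C W (Dom C f)" and b: "b \<in> Hom C W (Dom C f)"
    and e: "g \<cdot> f \<cdot> a = g \<cdot> f \<cdot> b" for W a b
  proof (rule mono_cancel[OF assms(1) a b])
    show "f \<cdot> a = f \<cdot> b"
      by (rule mono_cancel[OF assms(2), of _ W]) (use t a b e assms(3) in auto)
  qed
  then show ?thesis using t assms(3) unfolding monomorphism_def by simp
qed

lemma iso_mono:
  assumes "isomorphism C f" shows "monomorphism C f"
proof -
  from assms obtain g where f: "f \<in> Mor C" and g: "g \<in> Hom C (Cod C f) (Dom C f)"
    and gf: "g \<cdot> f = Ident C (Dom C f)"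
    unfolding isomorphism_def by blast
  have "a = b" if a: "a \<in> Hom C W (Dom C f)" and b: "b \<in> Hom C W (Dom C f)"
    and e: "f \<cdot> a = f \<cdot> b" for W a b
  proof -
    have "g \<cdot> f \<cdot> a = g \<cdot> f \<cdot> b" using f g a b e by simp
    then show ?thesis using a b gf by simp
  qed
  then show ?thesis using f unfolding monomorphism_def by blast
qed

lemma pushout_sym: "pushout C f g i j \<Longrightarrow> pushout C g f j i"
  unfolding pushout_def by (metis (no_types, lifting))

lemma pushout_hom:
  assumes "pushout C f g i j"
  shows "f \<in> Mor C" "g \<in> Mor C" "i \<in> Mor C" "j \<in> Mor C" "Dom C g = Dom C f" "Dom C i = Cod C f"
    "Dom C j = Cod C g" "Cod C j = Cod C i" "j \<cdot> g = i \<cdot> f"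
  using assms unfolding pushout_def by auto

lemma pushout_ex:
  assumes "pushout C f g i j" "a \<in> Hom C (Cod C f) W" "b \<in> Hom C (Cod C g) W" "a \<cdot> f = b \<cdot> g"
  obtains w where "w \<in> Hom C (Cod C i) W" "w \<cdot> i = a" "w \<cdot> j = b"
  using assms unfolding pushout_def by blast

lemma pushout_eq:
  assumes po: "pushout C f g i j" and w: "w \<in> Hom C (Cod C i) W" and w': "w' \<in> Hom C (Cod C i) W"
    and e: "w \<cdot> i = w' \<cdot> i" "w \<cdot> j = w' \<cdot> j"
  shows "w = w'"
proof -
  note t = pushout_hom[OF po]
  have "\<exists>!v. v \<in> Hom C (Cod C i) W \<and> v \<cdot> i = w \<cdot> i \<and> v \<cdot> j = w \<cdot> j"
  proof -
    have "w \<cdot> i \<in> Hom C (Cod C f) W" "w \<cdot> j \<in> Hom C (Cod C g) W" "w \<cdot> i \<cdot> f = w \<cdot> j \<cdot> g"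
      using t w by simp_all
    then show ?thesis using po unfolding pushout_def by blast
  qed
  then show ?thesis using w w' e by metis
qed

lemma pushoutI:
  assumes t: "f \<in> Hom C X Y" "g \<in> Hom C X Z" "i \<in> Hom C Y P" "j \<in> Hom C Z P" "i \<cdot> f = j \<cdot> g"
    and ex: "\<And>W a b. \<lbrakk>a \<in> Hom C Y W; b \<in> Hom C Z W; a \<cdot> f = b \<cdot> g\<rbrakk>
      \<Longrightarrow> \<exists>w \<in> Hom C P W. w \<cdot> i = a \<and> w \<cdot> j = b"
    and eq: "\<And>W w w'. \<lbrakk>w \<in> Hom C P W; w' \<in> Hom C P W; w \<cdot> i = w' \<cdot> i; w \<cdot> j = w' \<cdot> j\<rbrakk> \<Longrightarrow> w = w'"
  shows "pushout C f g i j"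
proof -
  have "\<exists>!w. w \<in> Hom C (Cod C i) W \<and> w \<cdot> i = a \<and> w \<cdot> j = b"
    if ab: "a \<in> Hom C (Cod C f) W" "b \<in> Hom C (Cod C g) W" "a \<cdot> f = b \<cdot> g" for W a b
  proof -
    have P: "Cod C i = P" and "Cod C f = Y" "Cod C g = Z" using t by auto
    then obtain w where w: "w \<in> Hom C P W" "w \<cdot> i = a" "w \<cdot> j = b"
      using ex[of a W b] ab by auto
    show ?thesis unfolding P
    proof (rule ex1I[of _ w])
      fix w' assume "w' \<in> Hom C P W \<and> w' \<cdot> i = a \<and> w' \<cdot> j = b"
      then show "w' = w" using eq[of w' W w] w by simp
    qed (use w in blast)
  qed
  moreover have "f \<in> Mor C" "g \<in> Mor C" "i \<in> Mor C" "j \<in> Mor C" "Dom C f = Dom C g"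
    "Dom C i = Cod C f" "Dom C j = Cod C g" "Cod C i = Cod C j"
    using t by auto
  ultimately show ?thesis using t(5) unfolding pushout_def by blast
qed

lemma pushout_paste:
  assumes p1: "pushout C i t q e" and p2: "pushout C h q c d"
  shows "pushout C (h \<cdot> i) t c (d \<cdot> e)"
proof -
  note t1 = pushout_hom[OF p1] and t2 = pushout_hom[OF p2]
  have dq: "d \<cdot> (q \<cdot> i) = c \<cdot> (h \<cdot> i)"
    using comp_assoc_rewrite[OF t2(9), of i] t1 t2 by simp
  show ?thesis
  proof (rule pushoutI)
    show "h \<cdot> i \<in> Hom C (Dom C i) (Cod C h)" "t \<in> Hom C (Dom C i) (Cod C t)"
      "c \<in> Hom C (Cod C h) (Cod C c)" "d \<cdot> e \<in> Hom C (Cod C t) (Cod C c)"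
      using t1 t2 by simp_all
    show "c \<cdot> (h \<cdot> i) = d \<cdot> e \<cdot> t" using t1 t2 dq by simp
  next
    fix W a b
    assume a: "a \<in> Hom C (Cod C h) W" and b: "b \<in> Hom C (Cod C t) W" and ab: "a \<cdot> (h \<cdot> i) = b \<cdot> t"
    obtain v where v: "v \<in> Hom C (Cod C q) W" "v \<cdot> q = a \<cdot> h" "v \<cdot> e = b"
    proof (rule pushout_ex[OF p1, of "a \<cdot> h" W b])
      show "a \<cdot> h \<cdot> i = b \<cdot> t" using t1 t2 a ab by simp
    qed (use t1 t2 a b in simp_all)
    obtain w where w: "w \<in> Hom C (Cod C c) W" "w \<cdot> c = a" "w \<cdot> d = v"
    proof (rule pushout_ex[OF p2, of a W v])
      show "a \<cdot> h = v \<cdot> q" using v by simp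
    qed (use t1 t2 a v in simp_all)
    have "w \<cdot> (d \<cdot> e) = b"
      using comp_assoc_rewrite[OF w(3), of e] v(3) w(1) t1 t2 by simp
    with w show "\<exists>w \<in> Hom C (Cod C c) W. w \<cdot> c = a \<and> w \<cdot> (d \<cdot> e) = b" by blast
  next
    fix W w w'
    assume w: "w \<in> Hom C (Cod C c) W" and w': "w' \<in> Hom C (Cod C c) W"
      and e: "w \<cdot> c = w' \<cdot> c" "w \<cdot> (d \<cdot> e) = w' \<cdot> (d \<cdot> e)"
    show "w = w'"
    proof (rule pushout_eq[OF p2 w w' e(1)])
      show "w \<cdot> d = w' \<cdot> d"
      proof (rule pushout_eq[OF p1, of _ W])
        have "w \<cdot> d \<cdot> q = w \<cdot> c \<cdot> h" "w' \<cdot> d \<cdot> q = w' \<cdot> c \<cdot> h"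
          using w w' t1 t2 by simp_all
        then show "w \<cdot> d \<cdot> q = w' \<cdot> d \<cdot> q" using e by simp
        show "w \<cdot> d \<cdot> e = w' \<cdot> d \<cdot> e" using e w w' t1 t2 by simp
      qed (use t1 t2 w w' in simp_all)
    qed
  qed
qed

lemma zero_object_from: "\<lbrakk>zero_object C Z; f \<in> Hom C Z X; g \<in> Hom C Z X\<rbrakk> \<Longrightarrow> f = g"
  unfolding zero_object_def by (metis hom_obj)

lemma zero_object_to: "\<lbrakk>zero_object C Z; f \<in> Hom C X Z; g \<in> Hom C X Z\<rbrakk> \<Longrightarrow> f = g"
  unfolding zero_object_def by (metis hom_obj)

end

section \<open>Calculus in preadditive categories\<close>

definition neg :: "('o, 'm, 'x) preadditive_scheme \<Rightarrow> 'm \<Rightarrow> 'm" where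
  "neg C f = inv\<^bsub>hom_group C (Dom C f) (Cod C f)\<^esub> f"

context preadditive_category
begin

abbreviation add :: "'m \<Rightarrow> 'm \<Rightarrow> 'm" (infixl "\<oplus>" 65) where
  "f \<oplus> g \<equiv> Add C f g"

abbreviation minus :: "'m \<Rightarrow> 'm" ("\<ominus> _" [69] 69) where
  "\<ominus> f \<equiv> neg C f"

abbreviation zero :: "'o \<Rightarrow> 'o \<Rightarrow> 'm" ("\<zero>") where
  "\<zero> X Y \<equiv> Zero C X Y"

lemma hom_group_simps [simp]: "carrier (hom_group C X Y) = Hom C X Y"
  "mult (hom_group C X Y) = Add C" "one (hom_group C X Y) = \<zero> X Y"
  by (simp_all add: hom_group_def)

lemma zero_mor [simp]: "\<lbrakk>X \<in> Obj C; Y \<in> Obj C\<rbrakk> \<Longrightarrow> \<zero> X Y \<in> Mor C"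
  and dom_zero [simp]: "\<lbrakk>X \<in> Obj C; Y \<in> Obj C\<rbrakk> \<Longrightarrow> Dom C (\<zero> X Y) = X"
  and cod_zero [simp]: "\<lbrakk>X \<in> Obj C; Y \<in> Obj C\<rbrakk> \<Longrightarrow> Cod C (\<zero> X Y) = Y"
  using monoid.one_closed[of "hom_group C X Y"] hom_comm_group[of X Y]
  by (simp_all add: comm_group_def group_def)

context
  fixes f g
  assumes par: "f \<in> Mor C" "g \<in> Mor C" "Dom C f = Dom C g" "Cod C f = Cod C g"
begin

interpretation G: comm_group "hom_group C (Dom C g) (Cod C g)"
  using par by (simp add: hom_comm_group)

lemma add_mor [simp]: "f \<oplus> g \<in> Mor C"
  and dom_add [simp]: "Dom C (f \<oplus> g) = Dom C g"
  and cod_add [simp]: "Cod C (f \<oplus> g) = Cod C g"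
  using G.m_closed[of f g] par by simp_all

lemma add_comm: "f \<oplus> g = g \<oplus> f"
  using G.m_comm[of f g] par by simp

lemma add_assoc:
  assumes "h \<in> Mor C" "Dom C h = Dom C g" "Cod C h = Cod C g"
  shows "f \<oplus> g \<oplus> h = f \<oplus> (g \<oplus> h)"
  using G.m_assoc[of f g h] par assms by simp

lemma neg_add: "\<ominus> (f \<oplus> g) = \<ominus> f \<oplus> \<ominus> g"
proof -
  have "f \<oplus> g \<in> Hom C (Dom C g) (Cod C g)" using G.m_closed[of f g] par by simp
  then show ?thesis
    using G.inv_mult[of f g] par by (simp add: neg_def)
qed

end

context
  fixes f
  assumes f: "f \<in> Mor C"
begin

interpretation G: comm_group "hom_group C (Dom C f) (Cod C f)"
  using f by (simp add: hom_comm_group)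

lemma neg_mor [simp]: "\<ominus> f \<in> Mor C"
  and dom_neg [simp]: "Dom C (\<ominus> f) = Dom C f"
  and cod_neg [simp]: "Cod C (\<ominus> f) = Cod C f"
  using G.inv_closed[of f] f by (simp_all add: neg_def)

lemma add_zero_right: "f \<oplus> \<zero> (Dom C f) (Cod C f) = f"
  and add_zero_left: "\<zero> (Dom C f) (Cod C f) \<oplus> f = f"
  using G.r_one[of f] G.l_one[of f] f by simp_all

lemma add_neg: "f \<oplus> \<ominus> f = \<zero> (Dom C f) (Cod C f)"
  and neg_add_self: "\<ominus> f \<oplus> f = \<zero> (Dom C f) (Cod C f)"
  using G.r_inv[of f] G.l_inv[of f] f by (simp_all add: neg_def)

lemma add_idem_zero: "f \<oplus> f = f \<Longrightarrow> f = \<zero> (Dom C f) (Cod C f)"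
  using G.r_cancel_one[of f f] f by simp

lemma neg_neg [simp]: "\<ominus> (\<ominus> f) = f"
proof -
  have "\<ominus> f \<in> Hom C (Dom C f) (Cod C f)" using G.inv_closed[of f] f by (simp add: neg_def)
  then show ?thesis using G.inv_inv[of f] f by (simp add: neg_def)
qed

end

lemma zero_add [simp]: "\<lbrakk>f \<in> Mor C; Dom C f = X; Cod C f = Y\<rbrakk> \<Longrightarrow> \<zero> X Y \<oplus> f = f"
  and add_zero [simp]: "\<lbrakk>f \<in> Mor C; Dom C f = X; Cod C f = Y\<rbrakk> \<Longrightarrow> f \<oplus> \<zero> X Y = f"
  by (metis add_zero_left, metis add_zero_right)

lemma neg_zero [simp]: "\<lbrakk>X \<in> Obj C; Y \<in> Obj C\<rbrakk> \<Longrightarrow> \<ominus> (\<zero> X Y) = \<zero> X Y"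
  using add_neg[of "\<zero> X Y"] by simp

lemma add_left_comm:
  "\<lbrakk>f \<in> Mor C; g \<in> Mor C; h \<in> Mor C; Dom C f = Dom C h; Cod C f = Cod C h;
    Dom C g = Dom C h; Cod C g = Cod C h\<rbrakk> \<Longrightarrow> f \<oplus> (g \<oplus> h) = g \<oplus> (f \<oplus> h)"
  by (metis add_assoc add_comm)

lemma add_neg_cancel [simp]:
  assumes "f \<in> Mor C" "g \<in> Mor C" "Dom C g = Dom C f" "Cod C g = Cod C f"
  shows "f \<oplus> (\<ominus> f \<oplus> g) = g" "\<ominus> f \<oplus> (f \<oplus> g) = g"
    "g \<oplus> f \<oplus> \<ominus> f = g" "g \<oplus> \<ominus> f \<oplus> f = g"
proof -
  note t = assms
  have "f \<oplus> \<ominus> f \<oplus> g = g" "\<ominus> f \<oplus> f \<oplus> g = g" "g \<oplus> (f \<oplus> \<ominus> f) = g" "g \<oplus> (\<ominus> f \<oplus> f) = g"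
    using t by (simp_all add: add_neg neg_add_self)
  then show "f \<oplus> (\<ominus> f \<oplus> g) = g" "\<ominus> f \<oplus> (f \<oplus> g) = g"
    "g \<oplus> f \<oplus> \<ominus> f = g" "g \<oplus> \<ominus> f \<oplus> f = g"
    using t by (simp_all add: add_assoc)
qed

lemma comp_distrib_left [simp]:
  "\<lbrakk>f \<in> Mor C; g \<in> Mor C; h \<in> Mor C; Dom C f = Dom C g; Cod C f = Cod C g; Dom C h = Cod C g\<rbrakk>
    \<Longrightarrow> h \<cdot> (f \<oplus> g) = h \<cdot> f \<oplus> h \<cdot> g"
  by (rule comp_add_right) auto

lemma comp_distrib_right [simp]:
  "\<lbrakk>f \<in> Mor C; g \<in> Mor C; h \<in> Mor C; Dom C g = Dom C h; Cod C g = Cod C h; Dom C h = Cod C f\<rbrakk>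
    \<Longrightarrow> (g \<oplus> h) \<cdot> f = g \<cdot> f \<oplus> h \<cdot> f"
  by (rule comp_add_left) auto

lemma comp_zero [simp]:
  assumes "f \<in> Mor C" "Dom C f = Y" "X \<in> Obj C"
  shows "f \<cdot> \<zero> X Y = \<zero> X (Cod C f)"
proof -
  have Y: "Y \<in> Obj C" using assms by auto
  have "f \<cdot> \<zero> X Y \<oplus> f \<cdot> \<zero> X Y = f \<cdot> (\<zero> X Y \<oplus> \<zero> X Y)"
    using assms Y by (subst comp_distrib_left) simp_all
  also have "\<dots> = f \<cdot> \<zero> X Y" using assms Y by simp
  finally show ?thesis using add_idem_zero[of "f \<cdot> \<zero> X Y"] assms Y by simp
qed

lemma zero_comp [simp]:
  assumes "f \<in> Mor C" "Cod C f = Y" "Z \<in> Obj C"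
  shows "\<zero> Y Z \<cdot> f = \<zero> (Dom C f) Z"
proof -
  have Y: "Y \<in> Obj C" using assms by auto
  have "\<zero> Y Z \<cdot> f \<oplus> \<zero> Y Z \<cdot> f = (\<zero> Y Z \<oplus> \<zero> Y Z) \<cdot> f"
    using assms Y by (subst comp_distrib_right) simp_all
  also have "\<dots> = \<zero> Y Z \<cdot> f" using assms Y by simp
  finally show ?thesis using add_idem_zero[of "\<zero> Y Z \<cdot> f"] assms Y by simp
qed

lemma eq_if_diff_zero:
  assumes "f \<in> Hom C X Y" "g \<in> Hom C X Y" "f \<oplus> \<ominus> g = \<zero> X Y"
  shows "f = g"
proof -
  have "f = f \<oplus> \<ominus> g \<oplus> g" using assms by (subst add_neg_cancel) simp_all
  also have "\<dots> = g" unfolding assms(3) using assms by simp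
  finally show ?thesis .
qed

lemma neg_unique:
  assumes "f \<in> Hom C X Y" "g \<in> Hom C X Y" "f \<oplus> g = \<zero> X Y"
  shows "f = \<ominus> g"
  by (rule eq_if_diff_zero[of _ X Y]) (use assms in auto)

lemma comp_neg [simp]:
  assumes "f \<in> Mor C" "g \<in> Mor C" "Dom C g = Cod C f"
  shows "g \<cdot> (\<ominus> f) = \<ominus> (g \<cdot> f)" "(\<ominus> g) \<cdot> f = \<ominus> (g \<cdot> f)"
proof -
  have "g \<cdot> (\<ominus> f) \<oplus> g \<cdot> f = g \<cdot> (\<ominus> f \<oplus> f)" using assms by (subst comp_distrib_left) simp_all
  then show "g \<cdot> (\<ominus> f) = \<ominus> (g \<cdot> f)"
    using assms by (intro neg_unique[of _ "Dom C f" "Cod C g"]) (simp_all add: neg_add_self)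
  have "(\<ominus> g) \<cdot> f \<oplus> g \<cdot> f = (\<ominus> g \<oplus> g) \<cdot> f" using assms by (subst comp_distrib_right) simp_all
  then show "(\<ominus> g) \<cdot> f = \<ominus> (g \<cdot> f)"
    using assms by (intro neg_unique[of _ "Dom C f" "Cod C g"]) (simp_all add: neg_add_self)
qed

lemma monoI:
  assumes f: "f \<in> Hom C X Y"
    and z: "\<And>W t. t \<in> Hom C W X \<Longrightarrow> f \<cdot> t = \<zero> W Y \<Longrightarrow> t = \<zero> W X"
  shows "monomorphism C f"
proof -
  have "g = h" if g: "g \<in> Hom C W X" and h: "h \<in> Hom C W X" and e: "f \<cdot> g = f \<cdot> h" for W g h
  proof (rule eq_if_diff_zero[OF g h], rule z)
    show "f \<cdot> (g \<oplus> \<ominus> h) = \<zero> W Y" using f g h e add_neg[of "f \<cdot> h"] by simp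
  qed (use g h in simp)
  then show ?thesis using f unfolding monomorphism_def by auto
qed

lemma mono_zero:
  assumes "monomorphism C f" "t \<in> Hom C W (Dom C f)" "f \<cdot> t = \<zero> W (Cod C f)"
  shows "t = \<zero> W (Dom C f)"
  by (rule mono_cancel[OF assms(1,2)]) (use assms mono_mor[OF assms(1)] in auto)

lemma epiI:
  assumes f: "f \<in> Hom C X Y"
    and z: "\<And>W t. t \<in> Hom C Y W \<Longrightarrow> t \<cdot> f = \<zero> X W \<Longrightarrow> t = \<zero> Y W"
  shows "epimorphism C f"
proof -
  have "g = h" if g: "g \<in> Hom C Y W" and h: "h \<in> Hom C Y W" and e: "g \<cdot> f = h \<cdot> f" for W g h
  proof (rule eq_if_diff_zero[OF g h], rule z)
    show "(g \<oplus> \<ominus> h) \<cdot> f = \<zero> X W" using f g h e add_neg[of "h \<cdot> f"] by simp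
  qed (use g h in simp)
  then show ?thesis using f unfolding epimorphism_def by auto
qed

lemma kernel_hom:
  assumes "kernel C f k"
  shows "f \<in> Mor C" "k \<in> Mor C" "Cod C k = Dom C f" "f \<cdot> k = \<zero> (Dom C k) (Cod C f)"
  using assms unfolding kernel_def by auto

lemma kernel_ex:
  assumes "kernel C f k" "h \<in> Hom C W (Dom C f)" "f \<cdot> h = \<zero> W (Cod C f)"
  obtains u where "u \<in> Hom C W (Dom C k)" "k \<cdot> u = h"
  using assms unfolding kernel_def by blast

lemma kernel_mono:
  assumes k: "kernel C f k" shows "monomorphism C k"
proof -
  note t = kernel_hom[OF k]
  have "g = h" if g: "g \<in> Hom C W (Dom C k)" and h: "h \<in> Hom C W (Dom C k)" and e: "k \<cdot> g = k \<cdot> h" for W g h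
  proof -
    have "k \<cdot> g \<in> Hom C W (Dom C f)" using g t by simp
    moreover have "f \<cdot> (k \<cdot> g) = \<zero> W (Cod C f)"
      using g t comp_assoc_rewrite[OF t(4), of g] by simp
    ultimately have "\<exists>!u. u \<in> Hom C W (Dom C k) \<and> k \<cdot> u = k \<cdot> g"
      using k unfolding kernel_def by blast
    then show ?thesis using g h e by metis
  qed
  then show ?thesis using t unfolding monomorphism_def by blast
qed

lemma cokernel_hom:
  assumes "cokernel C f c"
  shows "f \<in> Mor C" "c \<in> Mor C" "Dom C c = Cod C f" "c \<cdot> f = \<zero> (Dom C f) (Cod C c)"
  using assms unfolding cokernel_def by auto

lemma cokernel_ex:
  assumes "cokernel C f c" "h \<in> Hom C (Cod C f) W" "h \<cdot> f = \<zero> (Dom C f) W"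
  obtains u where "u \<in> Hom C (Cod C c) W" "u \<cdot> c = h"
  using assms unfolding cokernel_def by blast

lemma cokernel_epi:
  assumes k: "cokernel C f c" shows "epimorphism C c"
proof -
  note t = cokernel_hom[OF k]
  have "g = h" if g: "g \<in> Hom C (Cod C c) W" and h: "h \<in> Hom C (Cod C c) W" and e: "g \<cdot> c = h \<cdot> c" for W g h
  proof -
    have "g \<cdot> c \<in> Hom C (Cod C f) W" using g t by simp
    moreover have "g \<cdot> c \<cdot> f = \<zero> (Dom C f) W" using g t by auto
    ultimately have "\<exists>!u. u \<in> Hom C (Cod C c) W \<and> u \<cdot> c = g \<cdot> c"
      using k unfolding cokernel_def by blast
    then show ?thesis using g h e by metis
  qed
  then show ?thesis using t unfolding epimorphism_def by blast
qed

lemma kernelI: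
  assumes "monomorphism C k" "f \<in> Hom C (Cod C k) Y" "f \<cdot> k = \<zero> (Dom C k) Y"
    and ex: "\<And>W h. h \<in> Hom C W (Cod C k) \<Longrightarrow> f \<cdot> h = \<zero> W Y \<Longrightarrow> \<exists>u \<in> Hom C W (Dom C k). k \<cdot> u = h"
  shows "kernel C f k"
proof -
  have t: "f \<in> Mor C" "k \<in> Mor C" "Cod C k = Dom C f" "f \<cdot> k = \<zero> (Dom C k) (Cod C f)"
    using assms(2,3) mono_mor[OF assms(1)] by auto
  have "\<exists>!u. u \<in> Hom C W (Dom C k) \<and> k \<cdot> u = h"
    if "h \<in> Hom C W (Dom C f)" "f \<cdot> h = \<zero> W (Cod C f)" for W h
  proof -
    have "\<exists>u \<in> Hom C W (Dom C k). k \<cdot> u = h" using ex[of h W] that assms(2) by auto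
    then show ?thesis using mono_cancel[OF assms(1)] by (metis (full_types))
  qed
  then show ?thesis using t unfolding kernel_def by blast
qed

lemma cokernelI:
  assumes "epimorphism C c" "f \<in> Hom C X (Dom C c)" "c \<cdot> f = \<zero> X (Cod C c)"
    and ex: "\<And>W h. h \<in> Hom C (Dom C c) W \<Longrightarrow> h \<cdot> f = \<zero> X W \<Longrightarrow> \<exists>u \<in> Hom C (Cod C c) W. u \<cdot> c = h"
  shows "cokernel C f c"
proof -
  have t: "f \<in> Mor C" "c \<in> Mor C" "Dom C c = Cod C f" "c \<cdot> f = \<zero> (Dom C f) (Cod C c)"
    using assms(2,3) epi_mor[OF assms(1)] by auto
  have "\<exists>!u. u \<in> Hom C (Cod C c) W \<and> u \<cdot> c = h"
    if "h \<in> Hom C (Cod C f) W" "h \<cdot> f = \<zero> (Dom C f) W" for W h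
  proof -
    have "\<exists>u \<in> Hom C (Cod C c) W. u \<cdot> c = h" using ex[of h W] that assms(2) by auto
    then show ?thesis using epi_cancel[OF assms(1)] by (metis (full_types))
  qed
  then show ?thesis using t unfolding cokernel_def by blast
qed

end

section \<open>Exact sequences and pushouts in abelian categories\<close>

context preadditive_category
begin

definition biproduct :: "'o \<Rightarrow> 'o \<Rightarrow> 'o \<Rightarrow> 'm \<Rightarrow> 'm \<Rightarrow> 'm \<Rightarrow> 'm \<Rightarrow> bool" where
  "biproduct X Y B i j p q \<longleftrightarrow>
    B \<in> Obj C \<and> i \<in> Hom C X B \<and> j \<in> Hom C Y B \<and> p \<in> Hom C B X \<and> q \<in> Hom C B Y \<and>
    p \<cdot> i = Ident C X \<and> q \<cdot> j = Ident C Y \<and> q \<cdot> i = \<zero> X Y \<and> p \<cdot> j = \<zero> Y X \<and>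
    i \<cdot> p \<oplus> j \<cdot> q = Ident C B"

definition short_exact :: "'m \<Rightarrow> 'm \<Rightarrow> bool" where
  "short_exact m r \<longleftrightarrow> kernel C r m \<and> cokernel C m r"

lemma biproduct_hom:
  assumes "biproduct X Y B i j p q"
  shows "X \<in> Obj C" "Y \<in> Obj C" "B \<in> Obj C" "i \<in> Mor C" "Dom C i = X" "Cod C i = B"
    "j \<in> Mor C" "Dom C j = Y" "Cod C j = B" "p \<in> Mor C" "Dom C p = B" "Cod C p = X"
    "q \<in> Mor C" "Dom C q = B" "Cod C q = Y"
  using assms unfolding biproduct_def by auto

lemma biproduct_eqs:
  assumes "biproduct X Y B i j p q"
  shows "p \<cdot> i = Ident C X" "q \<cdot> j = Ident C Y" "q \<cdot> i = \<zero> X Y" "p \<cdot> j = \<zero> Y X"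
    "i \<cdot> p \<oplus> j \<cdot> q = Ident C B"
  using assms unfolding biproduct_def by auto

lemma biproduct_reassoc:
  assumes b: "biproduct X Y B i j p q" and t: "t \<in> Mor C"
  shows "Cod C t = X \<Longrightarrow> p \<cdot> (i \<cdot> t) = t" "Cod C t = Y \<Longrightarrow> q \<cdot> (j \<cdot> t) = t"
    "Cod C t = X \<Longrightarrow> q \<cdot> (i \<cdot> t) = \<zero> (Dom C t) Y" "Cod C t = Y \<Longrightarrow> p \<cdot> (j \<cdot> t) = \<zero> (Dom C t) X"
  using comp_assoc_rewrite[OF biproduct_eqs(1)[OF b], of t] comp_assoc_rewrite[OF biproduct_eqs(2)[OF b], of t]
    comp_assoc_rewrite[OF biproduct_eqs(3)[OF b], of t] comp_assoc_rewrite[OF biproduct_eqs(4)[OF b], of t]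
    biproduct_hom[OF b] t by simp_all

lemma biproduct_eq_into:
  assumes b: "biproduct X Y B i j p q" and t: "t \<in> Hom C W B" and t': "t' \<in> Hom C W B"
    and e: "p \<cdot> t = p \<cdot> t'" "q \<cdot> t = q \<cdot> t'"
  shows "t = t'"
proof -
  note h = biproduct_hom[OF b]
  have "t = (i \<cdot> p \<oplus> j \<cdot> q) \<cdot> t" using biproduct_eqs(5)[OF b] t h by simp
  also have "\<dots> = i \<cdot> (p \<cdot> t) \<oplus> j \<cdot> (q \<cdot> t)" using t h by simp
  also have "\<dots> = (i \<cdot> p \<oplus> j \<cdot> q) \<cdot> t'" using t' h e by simp
  also have "\<dots> = t'" using biproduct_eqs(5)[OF b] t' h by simp
  finally show ?thesis .
qed

lemma biproduct_eq_from:
  assumes b: "biproduct X Y B i j p q" and t: "t \<in> Hom C B W" and t': "t' \<in> Hom C B W"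
    and e: "t \<cdot> i = t' \<cdot> i" "t \<cdot> j = t' \<cdot> j"
  shows "t = t'"
proof -
  note h = biproduct_hom[OF b]
  have "t = t \<cdot> (i \<cdot> p \<oplus> j \<cdot> q)" using biproduct_eqs(5)[OF b] t h by simp
  also have "\<dots> = (t \<cdot> i) \<cdot> p \<oplus> (t \<cdot> j) \<cdot> q" using t h by simp
  also have "\<dots> = t' \<cdot> (i \<cdot> p \<oplus> j \<cdot> q)" unfolding e using t' h by simp
  also have "\<dots> = t'" using biproduct_eqs(5)[OF b] t' h by simp
  finally show ?thesis .
qed

end

context abelian_category
begin

lemma obtain_biproduct:
  assumes "X \<in> Obj C" "Y \<in> Obj C"
  obtains B i j p q where "biproduct X Y B i j p q"
  using ex_biproduct[OF assms] unfolding biproduct_def by blast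

text \<open>
  If \<open>m\<close> is a kernel of \<open>g\<close>, then \<open>g\<close> factors through the cokernel \<open>c\<close> of \<open>m\<close>. So \<open>c\<close> kills no more than
  \<open>g\<close> does.
\<close>
lemma mono_kernel_of_cokernel:
  assumes m: "monomorphism C m" and c: "cokernel C m c"
  shows "kernel C c m"
proof -
  obtain g where g: "kernel C g m" using mono_is_kernel[OF m] by blast
  note gt = kernel_hom[OF g] and ct = cokernel_hom[OF c]
  obtain u where u: "u \<in> Hom C (Cod C c) (Cod C g)" "u \<cdot> c = g"
    using cokernel_ex[OF c, of g "Cod C g"] gt by auto
  show ?thesis
  proof (rule kernelI[OF m, of _ "Cod C c"])
    fix W h assume h: "h \<in> Hom C W (Cod C m)" and e: "c \<cdot> h = \<zero> W (Cod C c)"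
    have "g \<cdot> h = u \<cdot> (c \<cdot> h)" using u h gt ct by (metis comp_assoc' in_Hom_iff)
    also have "\<dots> = \<zero> W (Cod C g)" unfolding e using u h by auto
    finally obtain v where "v \<in> Hom C W (Dom C m)" "m \<cdot> v = h"
      using kernel_ex[OF g, of h W] h gt by auto
    then show "\<exists>u \<in> Hom C W (Dom C m). m \<cdot> u = h" by blast
  qed (use ct in auto)
qed

lemma mono_cokernel_short_exact:
  "\<lbrakk>monomorphism C m; cokernel C m c\<rbrakk> \<Longrightarrow> short_exact m c"
  by (simp add: short_exact_def mono_kernel_of_cokernel)

text \<open>
  The universal property of a pushout says that its legs form a cokernel of the map \<open>(f, - g)\<close> into the
  direct sum, and this map is a monomorphism because \<open>f\<close> is one.
\<close>
lemma pushout_short_exact: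
  assumes po: "pushout C f g i j" and f: "monomorphism C f"
    and b: "biproduct (Cod C f) (Cod C g) B i1 i2 p1 p2"
  shows "short_exact (i1 \<cdot> f \<oplus> \<ominus> (i2 \<cdot> g)) (i \<cdot> p1 \<oplus> j \<cdot> p2)" (is "short_exact ?m ?r")
proof -
  note t = pushout_hom[OF po] and h = biproduct_hom[OF b] and e = biproduct_eqs[OF b]
    and reassoc = biproduct_reassoc[OF b]
  define m r where m_def: "m = ?m" and r_def: "r = ?r"
  have m: "m \<in> Mor C" "Dom C m = Dom C f" "Cod C m = B" using t h by (simp_all add: m_def)
  have r: "r \<in> Mor C" "Dom C r = B" "Cod C r = Cod C i" using t h by (simp_all add: r_def)
  have r1: "r \<cdot> i1 = i" "r \<cdot> i2 = j" using t h e by (simp_all add: r_def)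
  have p1m: "p1 \<cdot> m = f" using t h reassoc by (simp add: m_def)
  have rm: "r \<cdot> m = \<zero> (Dom C f) (Cod C i)"
    using t h reassoc add_neg[of "i \<cdot> f"] by (simp add: r_def m_def)
  have mono: "monomorphism C m"
  proof (rule monoI[of _ "Dom C f" B])
    fix W s assume s: "s \<in> Hom C W (Dom C f)" and z: "m \<cdot> s = \<zero> W B"
    have "f \<cdot> s = p1 \<cdot> (m \<cdot> s)" using comp_assoc_rewrite[OF p1m, of s] m s h by simp
    also have "\<dots> = \<zero> W (Cod C f)" unfolding z using h s by auto
    finally show "s = \<zero> W (Dom C f)" using mono_zero[OF f s] by simp
  qed (use m in simp)
  have "cokernel C m r"
  proof (rule cokernelI)
    show "epimorphism C r"
    proof (rule epiI[of _ B "Cod C i"])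
      fix W s assume s: "s \<in> Hom C (Cod C i) W" and z: "s \<cdot> r = \<zero> B W"
      have W: "W \<in> Obj C" using s by auto
      have "s \<cdot> i = \<zero> (Cod C f) W" "s \<cdot> j = \<zero> (Cod C g) W"
        using comp_assoc_rewrite[OF z, of i1] comp_assoc_rewrite[OF z, of i2] r1 r s h W by simp_all
      then show "s = \<zero> (Cod C i) W"
        using s t W by - (rule pushout_eq[OF po, of _ W], simp_all)
    qed (use r in simp)
    show "m \<in> Hom C (Dom C f) (Dom C r)" "r \<cdot> m = \<zero> (Dom C f) (Cod C r)"
      using m r rm by simp_all
    fix W h' assume h': "h' \<in> Hom C (Dom C r) W" and z: "h' \<cdot> m = \<zero> (Dom C f) W"
    have h'': "h' \<in> Hom C B W" using h' r by simp
    have "h' \<cdot> i1 \<cdot> f = h' \<cdot> i2 \<cdot> g"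
    proof (rule eq_if_diff_zero[of _ "Dom C f" W])
      show "h' \<cdot> i1 \<cdot> f \<oplus> \<ominus> (h' \<cdot> i2 \<cdot> g) = \<zero> (Dom C f) W"
        using z h'' t h by (simp add: m_def)
    qed (use h'' t h in simp_all)
    then obtain u where u: "u \<in> Hom C (Cod C i) W" "u \<cdot> i = h' \<cdot> i1" "u \<cdot> j = h' \<cdot> i2"
      using pushout_ex[OF po, of "h' \<cdot> i1" W "h' \<cdot> i2"] h'' t h by auto
    have "u \<cdot> r = h'"
      using u r1 r h h'' by - (rule biproduct_eq_from[OF b, of _ W], simp_all)
    then show "\<exists>u \<in> Hom C (Cod C r) W. u \<cdot> r = h'" using u(1) r by auto
  qed
  with mono show ?thesis unfolding m_def r_def by (rule mono_cokernel_short_exact)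
qed

text \<open>
  If \<open>j\<close> kills \<open>s\<close>, then \<open>(0, s)\<close> lies in the kernel of \<open>(i, j)\<close> and so equals \<open>(f \<cdot> v, - g \<cdot> v)\<close> for
  some \<open>v\<close>. Here \<open>f \<cdot> v = 0\<close> gives \<open>v = 0\<close>, hence \<open>s = 0\<close>.
\<close>
lemma pushout_mono:
  assumes po: "pushout C f g i j" and f: "monomorphism C f"
  shows "monomorphism C j"
proof -
  note t = pushout_hom[OF po]
  obtain B i1 i2 p1 p2 where b: "biproduct (Cod C f) (Cod C g) B i1 i2 p1 p2"
    by (rule obtain_biproduct[of "Cod C f" "Cod C g"]) (use t in simp_all)
  note h = biproduct_hom[OF b] and e = biproduct_eqs[OF b] and r = biproduct_reassoc[OF b]
  let ?m = "i1 \<cdot> f \<oplus> \<ominus> (i2 \<cdot> g)" and ?r = "i \<cdot> p1 \<oplus> j \<cdot> p2"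
  have k: "kernel C ?r ?m" using pushout_short_exact[OF po f b] by (simp add: short_exact_def)
  show ?thesis
  proof (rule monoI[of _ "Cod C g" "Cod C i"])
    fix W s assume s: "s \<in> Hom C W (Cod C g)" and z: "j \<cdot> s = \<zero> W (Cod C i)"
    have W: "W \<in> Obj C" using s by auto
    have "?r \<cdot> (i2 \<cdot> s) = \<zero> W (Cod C ?r)" using s t h r z W by simp
    then obtain v where v: "v \<in> Hom C W (Dom C f)" "?m \<cdot> v = i2 \<cdot> s"
      using kernel_ex[OF k, of "i2 \<cdot> s" W] s t h by auto
    have "f \<cdot> v = p1 \<cdot> (?m \<cdot> v)" using v(1) t h r W by simp
    also have "\<dots> = \<zero> W (Cod C f)" unfolding v(2) using s h r W by simp
    finally have v0: "v = \<zero> W (Dom C f)" using mono_zero[OF f v(1)] by simp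
    have "s = p2 \<cdot> (i2 \<cdot> s)" using s h r by simp
    also have "\<dots> = p2 \<cdot> (?m \<cdot> v)" using v by simp
    also have "\<dots> = \<zero> W (Cod C g)" unfolding v0 using t h W by simp
    finally show "s = \<zero> W (Cod C g)" .
  qed (use t in simp)
qed

lemma obtain_pushout:
  assumes f: "f \<in> Hom C X Y" and g: "g \<in> Hom C X Z"
  obtains i j where "pushout C f g i j"
proof -
  obtain B i1 i2 p1 p2 where b: "biproduct Y Z B i1 i2 p1 p2"
    by (rule obtain_biproduct[of Y Z]) (use f g in auto)
  note h = biproduct_hom[OF b] and r = biproduct_reassoc[OF b] and e = biproduct_eqs[OF b]
  let ?m = "i1 \<cdot> f \<oplus> \<ominus> (i2 \<cdot> g)"
  have X: "X \<in> Obj C" using f by auto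
  have m: "?m \<in> Hom C X B" using f g h by simp
  obtain c where c: "cokernel C ?m c" using ex_cokernel[of ?m] m by auto
  note ct = cokernel_hom[OF c]
  have cm: "c \<cdot> i1 \<cdot> f = c \<cdot> i2 \<cdot> g"
  proof (rule eq_if_diff_zero[of _ X "Cod C c"])
    show "c \<cdot> i1 \<cdot> f \<oplus> \<ominus> (c \<cdot> i2 \<cdot> g) = \<zero> X (Cod C c)" using ct(2-4) f g h by simp
  qed (use ct(2-3) f g h in simp_all)
  have cB: "Dom C c = B" using ct m by simp
  have "pushout C f g (c \<cdot> i1) (c \<cdot> i2)"
  proof (rule pushoutI[OF f g])
    show "c \<cdot> i1 \<in> Hom C Y (Cod C c)" "c \<cdot> i2 \<in> Hom C Z (Cod C c)" "c \<cdot> i1 \<cdot> f = c \<cdot> i2 \<cdot> g"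
      using ct(2) cB h cm by simp_all
  next
    fix W a b'
    assume a: "a \<in> Hom C Y W" and b': "b' \<in> Hom C Z W" and ab: "a \<cdot> f = b' \<cdot> g"
    let ?h = "a \<cdot> p1 \<oplus> b' \<cdot> p2"
    have hh: "?h \<in> Hom C B W" using a b' h by simp
    have "?h \<cdot> ?m = \<zero> X W" using X a b' f g h r ab add_neg[of "b' \<cdot> g"] by simp
    then obtain w where w: "w \<in> Hom C (Cod C c) W" "w \<cdot> c = ?h"
      using cokernel_ex[OF c, of ?h W] m hh by auto
    have "w \<cdot> (c \<cdot> i1) = a" "w \<cdot> (c \<cdot> i2) = b'"
      using comp_assoc_rewrite[OF w(2), of i1] comp_assoc_rewrite[OF w(2), of i2] w(1) ct(2) cB a b' h e
      by simp_all
    with w show "\<exists>w \<in> Hom C (Cod C c) W. w \<cdot> (c \<cdot> i1) = a \<and> w \<cdot> (c \<cdot> i2) = b'" by blast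
  next
    fix W w w'
    assume w: "w \<in> Hom C (Cod C c) W" and w': "w' \<in> Hom C (Cod C c) W"
      and eq: "w \<cdot> (c \<cdot> i1) = w' \<cdot> (c \<cdot> i1)" "w \<cdot> (c \<cdot> i2) = w' \<cdot> (c \<cdot> i2)"
    show "w = w'"
    proof (rule epi_cancel[OF cokernel_epi[OF c] w w'])
      show "w \<cdot> c = w' \<cdot> c"
        using w w' eq ct(2) cB h by - (rule biproduct_eq_from[OF b, of _ W], simp_all)
    qed
  qed
  then show thesis by (rule that)
qed

end

section \<open>Stable equality and stable equivalences\<close>

context abelian_category
begin

text \<open>
  The maps that become zero in the stable category.
\<close>
definition null :: "'m \<Rightarrow> bool" where
  "null n \<longleftrightarrow> n \<in> Mor C \<and>
    (\<exists>P. projective C P \<and> (\<exists>a \<in> Hom C (Dom C n) P. \<exists>b \<in> Hom C P (Cod C n). n = b \<cdot> a))"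

abbreviation stable_eq :: "'m \<Rightarrow> 'm \<Rightarrow> bool" (infix "\<simeq>" 50) where
  "f \<simeq> g \<equiv> stably_equal C f g"

lemma null_mor: "null n \<Longrightarrow> n \<in> Mor C"
  by (simp add: null_def)

lemma nullI: "\<lbrakk>projective C P; a \<in> Hom C X P; b \<in> Hom C P Y\<rbrakk> \<Longrightarrow> null (b \<cdot> a)"
proof -
  assume P: "projective C P" and a: "a \<in> Hom C X P" and b: "b \<in> Hom C P Y"
  then have "a \<in> Hom C (Dom C (b \<cdot> a)) P" "b \<in> Hom C P (Cod C (b \<cdot> a))" "b \<cdot> a \<in> Mor C" by simp_all
  with P show ?thesis unfolding null_def by blast
qed

lemma nullE:
  assumes "null n"
  obtains X Y P a b where "n \<in> Hom C X Y" "projective C P" "a \<in> Hom C X P" "b \<in> Hom C P Y" "n = b \<cdot> a"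
  using assms unfolding null_def Hom_def by blast

lemma null_comp_left:
  assumes "null n" "f \<in> Mor C" "Dom C f = Cod C n"
  shows "null (f \<cdot> n)"
proof -
  obtain X Y P a b where nt: "n \<in> Hom C X Y" and P: "projective C P" and a: "a \<in> Hom C X P"
    and b: "b \<in> Hom C P Y" and n: "n = b \<cdot> a"
    by (rule nullE[OF assms(1)])
  have "null ((f \<cdot> b) \<cdot> a)" by (rule nullI[OF P a]) (use b assms nt in auto)
  then show ?thesis using a b assms(2,3) nt n by simp
qed

lemma null_comp_right:
  assumes "null n" "f \<in> Mor C" "Cod C f = Dom C n"
  shows "null (n \<cdot> f)"
proof -
  obtain X Y P a b where nt: "n \<in> Hom C X Y" and P: "projective C P" and a: "a \<in> Hom C X P"
    and b: "b \<in> Hom C P Y" and n: "n = b \<cdot> a"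
    by (rule nullE[OF assms(1)])
  have "null (b \<cdot> (a \<cdot> f))" by (rule nullI[OF P _ b]) (use a assms nt in auto)
  then show ?thesis using a b assms(2,3) nt n by simp
qed

lemma projective_biproduct:
  assumes b: "biproduct X Y B i j p q" and X: "projective C X" and Y: "projective C Y"
  shows "projective C B"
proof -
  note h = biproduct_hom[OF b] and e = biproduct_eqs[OF b]
  have "\<exists>g \<in> Hom C B (Dom C r). r \<cdot> g = f" if r: "epimorphism C r" and f: "f \<in> Hom C B (Cod C r)" for r f
  proof -
    have rt: "r \<in> Mor C" using r by (rule epi_mor)
    have "f \<cdot> i \<in> Hom C X (Cod C r)" "f \<cdot> j \<in> Hom C Y (Cod C r)" using f h by simp_all
    then obtain g1 g2 where g: "g1 \<in> Hom C X (Dom C r)" "r \<cdot> g1 = f \<cdot> i" "g2 \<in> Hom C Y (Dom C r)" "r \<cdot> g2 = f \<cdot> j"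
      using X Y r unfolding projective_def by meson
    have "r \<cdot> (g1 \<cdot> p \<oplus> g2 \<cdot> q) = (r \<cdot> g1) \<cdot> p \<oplus> (r \<cdot> g2) \<cdot> q" using g(1,3) rt h by simp
    also have "\<dots> = f \<cdot> (i \<cdot> p \<oplus> j \<cdot> q)" unfolding g using f h by simp
    also have "\<dots> = f" unfolding e using f by auto
    finally show ?thesis using g(1,3) rt h by (intro bexI[of _ "g1 \<cdot> p \<oplus> g2 \<cdot> q"]) simp_all
  qed
  then show ?thesis using h(3) unfolding projective_def by blast
qed

text \<open>
  A map through \<open>Q\<close> plus a map through \<open>P\<close> is a map through \<open>Q \<oplus> P\<close>.
\<close>
lemma null_add:
  assumes "null m" "null n" "Dom C m = Dom C n" "Cod C m = Cod C n"
  shows "null (m \<oplus> n)"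
proof -
  obtain X Y P a b where nt: "n \<in> Hom C X Y" and P: "projective C P" and a: "a \<in> Hom C X P"
    and b: "b \<in> Hom C P Y" and n: "n = b \<cdot> a"
    by (rule nullE[OF assms(2)])
  obtain X' Y' Q c d where mt: "m \<in> Hom C X' Y'" and Q: "projective C Q" and c: "c \<in> Hom C X' Q"
    and d: "d \<in> Hom C Q Y'" and m: "m = d \<cdot> c"
    by (rule nullE[OF assms(1)])
  have "Q \<in> Obj C" "P \<in> Obj C" using P Q by (simp_all add: projective_def)
  then obtain B i j p q where bi: "biproduct Q P B i j p q" by (rule obtain_biproduct)
  note h = biproduct_hom[OF bi] and e = biproduct_reassoc[OF bi]
  have X: "X' = X" "Y' = Y" using assms(3,4) nt mt by auto
  have D: "X \<in> Obj C" using a by auto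
  have "null ((d \<cdot> p \<oplus> b \<cdot> q) \<cdot> (i \<cdot> c \<oplus> j \<cdot> a))"
    by (rule nullI[OF projective_biproduct[OF bi Q P], of _ X _ Y]) (use a b c d h X in simp_all)
  moreover have "(d \<cdot> p \<oplus> b \<cdot> q) \<cdot> (i \<cdot> c \<oplus> j \<cdot> a) = d \<cdot> c \<oplus> b \<cdot> a"
    using a b c d h e D X by simp
  ultimately show ?thesis unfolding n[symmetric] m[symmetric] by simp
qed

lemma null_neg: "null n \<Longrightarrow> null (\<ominus> n)"
proof -
  assume n: "null n"
  have t: "n \<in> Mor C" using n by (rule null_mor)
  have "null ((\<ominus> (Ident C (Cod C n))) \<cdot> n)" by (rule null_comp_left[OF n]) (use t in auto)
  then show ?thesis using t by simp
qed

lemma zero_object_projective: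
  assumes "zero_object C Z" shows "projective C Z"
proof -
  have "\<exists>g \<in> Hom C Z (Dom C r). r \<cdot> g = f" if r: "epimorphism C r" and f: "f \<in> Hom C Z (Cod C r)" for r f
  proof -
    have "Z \<in> Obj C" using assms by (simp add: zero_object_def)
    then have "r \<cdot> \<zero> Z (Dom C r) \<in> Hom C Z (Cod C r)" "\<zero> Z (Dom C r) \<in> Hom C Z (Dom C r)"
      using epi_mor[OF r] by simp_all
    then show ?thesis using zero_object_from[OF assms f] by metis
  qed
  then show ?thesis using assms unfolding projective_def zero_object_def by blast
qed

lemma null_zero:
  assumes "X \<in> Obj C" "Y \<in> Obj C" shows "null (\<zero> X Y)"
proof -
  obtain Z where Z: "zero_object C Z" using ex_zero_object by blast
  then have "Z \<in> Obj C" by (simp add: zero_object_def)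
  then have "null (\<zero> Z Y \<cdot> \<zero> X Z)" "\<zero> Z Y \<cdot> \<zero> X Z = \<zero> X Y"
    using assms by (intro nullI[OF zero_object_projective[OF Z]], simp_all)
  then show ?thesis by simp
qed

lemma stable_eq_iff:
  assumes "f \<in> Hom C X Y" "g \<in> Hom C X Y"
  shows "f \<simeq> g \<longleftrightarrow> null (f \<oplus> \<ominus> g)"
proof -
  have neg: "inv\<^bsub>hom_group C X Y\<^esub> g = \<ominus> g" using assms(2) by (simp add: neg_def)
  have d: "f \<oplus> \<ominus> g \<in> Hom C X Y" using assms by simp
  have "f \<simeq> g \<longleftrightarrow> (\<exists>P. projective C P \<and> (\<exists>a \<in> Hom C X P. \<exists>b \<in> Hom C P Y. f \<oplus> \<ominus> g = b \<cdot> a))"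
    using assms neg unfolding stably_equal_def Hom_def by auto
  also have "\<dots> \<longleftrightarrow> null (f \<oplus> \<ominus> g)"
    using d unfolding null_def Hom_def by auto
  finally show ?thesis .
qed

lemma stable_eq_hom: "f \<simeq> g \<Longrightarrow> f \<in> Mor C \<and> g \<in> Mor C \<and> Dom C f = Dom C g \<and> Cod C f = Cod C g"
  unfolding stably_equal_def by auto

lemma stable_eqD:
  assumes "f \<simeq> g" shows "null (f \<oplus> \<ominus> g)"
proof -
  note t = stable_eq_hom[OF assms]
  have "f \<simeq> g \<longleftrightarrow> null (f \<oplus> \<ominus> g)"
    by (rule stable_eq_iff[of _ "Dom C g" "Cod C g"]) (use t in simp_all)
  with assms show ?thesis by blast
qed

lemma stable_eq_add_null:
  assumes "null n" "f \<in> Mor C" "Dom C f = Dom C n" "Cod C f = Cod C n"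
  shows "f \<oplus> n \<simeq> f"
proof -
  have n: "n \<in> Mor C" using assms(1) by (rule null_mor)
  have "f \<oplus> n \<oplus> \<ominus> f = n" using assms n add_comm[of f n] by simp
  then show ?thesis using assms n stable_eq_iff[of "f \<oplus> n" "Dom C n" "Cod C n" f] by simp
qed

lemma stable_eqE:
  assumes "f \<simeq> g"
  obtains n where "null n" "f = g \<oplus> n" "Dom C n = Dom C g" "Cod C n = Cod C g" "n \<in> Mor C" "g \<in> Mor C"
proof
  note t = stable_eq_hom[OF assms]
  show "null (f \<oplus> \<ominus> g)" using assms by (rule stable_eqD)
  show "f = g \<oplus> (f \<oplus> \<ominus> g)" using t add_left_comm[of g f "\<ominus> g"] add_neg[of g] by simp
qed (use stable_eq_hom[OF assms] in simp_all)

lemma stable_eq_refl [simp]: "f \<in> Mor C \<Longrightarrow> f \<simeq> f"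
proof -
  assume f: "f \<in> Mor C"
  then have "f \<oplus> \<zero> (Dom C f) (Cod C f) \<simeq> f" by (intro stable_eq_add_null null_zero) simp_all
  then show ?thesis using f by simp
qed

lemma stable_eq_sym: assumes "f \<simeq> g" shows "g \<simeq> f"
proof -
  obtain n where n: "null n" "f = g \<oplus> n" "Dom C n = Dom C g" "Cod C n = Cod C g" "n \<in> Mor C" "g \<in> Mor C"
    using assms by (rule stable_eqE)
  have "f \<oplus> \<ominus> n \<simeq> f" using n by (intro stable_eq_add_null null_neg) simp_all
  moreover have "f \<oplus> \<ominus> n = g" using n by simp
  ultimately show ?thesis by simp
qed

lemma stable_eq_trans [trans]: assumes "f \<simeq> g" "g \<simeq> h" shows "f \<simeq> h"
proof -
  obtain n where n: "null n" "f = g \<oplus> n" "Dom C n = Dom C g" "Cod C n = Cod C g" "n \<in> Mor C" "g \<in> Mor C"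
    using assms(1) by (rule stable_eqE)
  obtain m where m: "null m" "g = h \<oplus> m" "Dom C m = Dom C h" "Cod C m = Cod C h" "m \<in> Mor C" "h \<in> Mor C"
    using assms(2) by (rule stable_eqE)
  have t: "Dom C n = Dom C h" "Cod C n = Cod C h" "n \<in> Mor C" "h \<in> Mor C" using n(3-6) m(6) stable_eq_hom[OF assms(2)] by auto
  have "f = h \<oplus> (m \<oplus> n)" using n(2,5,6) m(2-6) t by (simp add: add_assoc)
  moreover have "h \<oplus> (m \<oplus> n) \<simeq> h"
    using n(1,5) m(1,3-6) t by (intro stable_eq_add_null null_add) simp_all
  ultimately show ?thesis by simp
qed

lemma stable_eq_comp_left:
  assumes "f \<simeq> g" "h \<in> Mor C" "Dom C h = Cod C g" shows "h \<cdot> f \<simeq> h \<cdot> g"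
proof -
  obtain n where n: "null n" "f = g \<oplus> n" "Dom C n = Dom C g" "Cod C n = Cod C g" "n \<in> Mor C" "g \<in> Mor C"
    using assms(1) by (rule stable_eqE)
  have "h \<cdot> g \<oplus> h \<cdot> n \<simeq> h \<cdot> g"
    using n(1,3-6) assms(2,3) by (intro stable_eq_add_null null_comp_left) simp_all
  then show ?thesis using n assms(2,3) by simp
qed

lemma stable_eq_comp_right:
  assumes "f \<simeq> g" "h \<in> Mor C" "Cod C h = Dom C g" shows "f \<cdot> h \<simeq> g \<cdot> h"
proof -
  obtain n where n: "null n" "f = g \<oplus> n" "Dom C n = Dom C g" "Cod C n = Cod C g" "n \<in> Mor C" "g \<in> Mor C"
    using assms(1) by (rule stable_eqE)
  have "g \<cdot> h \<oplus> n \<cdot> h \<simeq> g \<cdot> h"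
    using n(1,3-6) assms(2,3) by (intro stable_eq_add_null null_comp_right) simp_all
  then show ?thesis using n assms(2,3) by simp
qed

lemma null_stable_eq: assumes "f \<simeq> g" "null g" shows "null f"
proof -
  obtain n where n: "null n" "f = g \<oplus> n" "Dom C n = Dom C g" "Cod C n = Cod C g" using assms(1) by (rule stable_eqE)
  then show ?thesis using assms null_add by simp
qed

definition stable_inverse :: "'m \<Rightarrow> 'm \<Rightarrow> bool" where
  "stable_inverse f h \<longleftrightarrow> f \<in> Mor C \<and> h \<in> Hom C (Cod C f) (Dom C f) \<and>
    f \<cdot> h \<simeq> Ident C (Cod C f) \<and> h \<cdot> f \<simeq> Ident C (Dom C f)"

abbreviation weq :: "'m \<Rightarrow> bool" where
  "weq f \<equiv> stable_equivalence C f"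

lemma weq_iff: "weq f \<longleftrightarrow> (\<exists>h. stable_inverse f h)"
  unfolding stable_equivalence_def stable_inverse_def by blast

lemma stable_inverse_sym: "stable_inverse f h \<Longrightarrow> stable_inverse h f"
  unfolding stable_inverse_def by auto

lemma weq_mor: "weq f \<Longrightarrow> f \<in> Mor C"
  unfolding stable_equivalence_def by blast

text \<open>
  The two one-sided stable inverses are stably equal by the usual computation \<open>h = g f h = g\<close>.
\<close>
lemma weq_one_sided:
  assumes f: "f \<in> Hom C X Y" and g: "g \<in> Hom C Y X" and h: "h \<in> Hom C Y X"
    and gf: "g \<cdot> f \<simeq> Ident C X" and fh: "f \<cdot> h \<simeq> Ident C Y"
  shows "weq f"
proof -
  have "Ident C X \<cdot> h \<simeq> (g \<cdot> f) \<cdot> h"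
    by (rule stable_eq_comp_right[OF stable_eq_sym[OF gf]]) (use f g h in auto)
  also have "(g \<cdot> f) \<cdot> h = g \<cdot> (f \<cdot> h)" using f g h by simp
  also have "g \<cdot> (f \<cdot> h) \<simeq> g \<cdot> Ident C Y"
    by (rule stable_eq_comp_left[OF fh]) (use f g h in auto)
  finally have "h \<simeq> g" using g h by simp
  then have "h \<cdot> f \<simeq> g \<cdot> f" by (rule stable_eq_comp_right) (use f g in auto)
  from stable_eq_trans[OF this gf] show ?thesis
    using f h fh unfolding stable_equivalence_def by auto
qed

lemma weq_stable_inverse:
  assumes "weq f" "f \<in> Hom C X Y"
  obtains h where "weq h" "h \<in> Hom C Y X" "f \<cdot> h \<simeq> Ident C Y" "h \<cdot> f \<simeq> Ident C X"
proof -
  have t: "Dom C f = X" "Cod C f = Y" using assms(2) by simp_all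
  obtain h where h: "stable_inverse f h" using assms(1) by (auto simp: weq_iff)
  then have "weq h" using stable_inverse_sym by (auto simp: weq_iff)
  with h that[of h] show thesis unfolding stable_inverse_def t by blast
qed

lemma weq_compose:
  assumes "weq f" "weq g" "Cod C f = Dom C g"
  shows "weq (g \<cdot> f)"
proof -
  have "f \<in> Hom C (Dom C f) (Dom C g)" "g \<in> Hom C (Dom C g) (Cod C g)"
    using assms weq_mor by simp_all
  then obtain X Y Z where f: "f \<in> Hom C X Y" and g: "g \<in> Hom C Y Z" by blast
  obtain f' where f': "f' \<in> Hom C Y X" "f \<cdot> f' \<simeq> Ident C Y" "f' \<cdot> f \<simeq> Ident C X"
    using assms(1) f by (rule weq_stable_inverse)
  obtain g' where g': "g' \<in> Hom C Z Y" "g \<cdot> g' \<simeq> Ident C Z" "g' \<cdot> g \<simeq> Ident C Y"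
    using assms(2) g by (rule weq_stable_inverse)
  have Y: "Y \<in> Obj C" using f by auto
  have "f' \<cdot> ((g' \<cdot> g) \<cdot> f) \<simeq> f' \<cdot> (Ident C Y \<cdot> f)"
    by (intro stable_eq_comp_left stable_eq_comp_right g') (use f g f'(1) Y in simp_all)
  also have "f' \<cdot> (Ident C Y \<cdot> f) \<simeq> Ident C X" using f f' by simp
  finally have 1: "(f' \<cdot> g') \<cdot> (g \<cdot> f) \<simeq> Ident C X" using f g f'(1) g'(1) by simp
  have "g \<cdot> ((f \<cdot> f') \<cdot> g') \<simeq> g \<cdot> (Ident C Y \<cdot> g')"
    by (intro stable_eq_comp_left stable_eq_comp_right f') (use f g g'(1) Y in simp_all)
  also have "g \<cdot> (Ident C Y \<cdot> g') \<simeq> Ident C Z" using g g' by simp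
  finally have 2: "(g \<cdot> f) \<cdot> (f' \<cdot> g') \<simeq> Ident C Z" using f g f'(1) g'(1) by simp
  show ?thesis
    by (rule weq_one_sided[OF _ _ _ 1 2]) (use f g f'(1) g'(1) in simp_all)
qed

lemma weq_cancel_both:
  assumes f: "f \<in> Hom C X Y" and g: "g \<in> Hom C Y Z" and h: "h \<in> Hom C Z W"
    and gf: "weq (g \<cdot> f)" and hg: "weq (h \<cdot> g)"
  shows "weq g"
proof -
  obtain a where a: "a \<in> Hom C Z X" "(g \<cdot> f) \<cdot> a \<simeq> Ident C Z"
    by (rule weq_stable_inverse[OF gf, of X Z]) (use f g in auto)
  obtain b where b: "b \<in> Hom C W Y" "b \<cdot> (h \<cdot> g) \<simeq> Ident C Y"
    by (rule weq_stable_inverse[OF hg, of Y W]) (use g h in auto)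
  show ?thesis
    by (rule weq_one_sided[of _ Y Z "b \<cdot> h" "f \<cdot> a"]) (use a b f g h in simp_all)
qed

lemma weq_identity: "X \<in> Obj C \<Longrightarrow> weq (Ident C X)"
  unfolding stable_equivalence_def by (auto intro!: bexI[of _ "Ident C X"])

lemma iso_weq: "isomorphism C f \<Longrightarrow> weq f"
  unfolding isomorphism_def stable_equivalence_def by force

lemma weq_stable_eq:
  assumes fg: "f \<simeq> g" and g: "weq g"
  shows "weq f"
proof -
  have "g \<in> Hom C (Dom C g) (Cod C g)" using weq_mor[OF g] by simp
  with g obtain h where h: "h \<in> Hom C (Cod C g) (Dom C g)" "g \<cdot> h \<simeq> Ident C (Cod C g)" "h \<cdot> g \<simeq> Ident C (Dom C g)"
    by (rule weq_stable_inverse)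
  note t = stable_eq_hom[OF fg]
  have "f \<cdot> h \<simeq> g \<cdot> h" "h \<cdot> f \<simeq> h \<cdot> g"
    using stable_eq_comp_right[OF fg, of h] stable_eq_comp_left[OF fg, of h] h(1) by simp_all
  then have "f \<cdot> h \<simeq> Ident C (Cod C g)" "h \<cdot> f \<simeq> Ident C (Dom C g)"
    using h(2,3) stable_eq_trans by blast+
  then show ?thesis
    by - (rule weq_one_sided[of _ "Dom C g" "Cod C g" h h], use t h(1) in simp_all)
qed

lemma weq_cancel_right:
  assumes f: "f \<in> Hom C X Y" and g: "g \<in> Hom C Y Z" and wf: "weq f" and gf: "weq (g \<cdot> f)"
  shows "weq g"
proof -
  obtain h where h: "weq h" "h \<in> Hom C Y X" "f \<cdot> h \<simeq> Ident C Y"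
    using wf f by (rule weq_stable_inverse)
  have "weq ((g \<cdot> f) \<cdot> h)" by (rule weq_compose[OF h(1) gf]) (use f g h(2) in simp)
  moreover have "(g \<cdot> f) \<cdot> h \<simeq> g"
    using stable_eq_comp_left[OF h(3), of g] f g h(2) by auto
  ultimately show ?thesis using weq_stable_eq stable_eq_sym by blast
qed

lemma weq_cancel_left:
  assumes f: "f \<in> Hom C X Y" and g: "g \<in> Hom C Y Z" and wg: "weq g" and gf: "weq (g \<cdot> f)"
  shows "weq f"
proof -
  obtain h where h: "weq h" "h \<in> Hom C Z Y" "h \<cdot> g \<simeq> Ident C Y"
    using wg g by (rule weq_stable_inverse)
  have "weq (h \<cdot> (g \<cdot> f))" by (rule weq_compose[OF gf h(1)]) (use f g h(2) in simp)
  moreover have "h \<cdot> (g \<cdot> f) \<simeq> f"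
    using stable_eq_comp_right[OF h(3), of f] f g h(2) by auto
  ultimately show ?thesis using weq_stable_eq stable_eq_sym by blast
qed

text \<open>
  The stable inverse is \<open>1 - n\<close>, because \<open>(1 + n) (1 - n) = 1 - n n\<close>.
\<close>
lemma weq_unipotent:
  assumes f: "f \<in> Hom C X X" and n: "f = Ident C X \<oplus> n" "n \<in> Hom C X X" "null (n \<cdot> n)"
  shows "weq f"
proof -
  have X: "X \<in> Obj C" using f by auto
  let ?g = "Ident C X \<oplus> \<ominus> n"
  have "f \<cdot> ?g = Ident C X \<oplus> \<ominus> (n \<cdot> n)" "?g \<cdot> f = Ident C X \<oplus> \<ominus> (n \<cdot> n)"
    using n(1,2) X add_assoc[of "Ident C X" "\<ominus> n" "n \<oplus> \<ominus> (n \<cdot> n)"]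
      add_assoc[of "Ident C X" n "\<ominus> n \<oplus> \<ominus> (n \<cdot> n)"] by (simp_all add: neg_add)
  moreover have "Ident C X \<oplus> \<ominus> (n \<cdot> n) \<simeq> Ident C X"
    using n(2,3) X by (intro stable_eq_add_null null_neg) simp_all
  ultimately show ?thesis
    by - (rule weq_one_sided[of _ X X ?g ?g], use f n(2) X in simp_all)
qed

end

section \<open>Stable equivalences of exact sequences\<close>

context abelian_category
begin

lemma diff_add:
  assumes "f \<in> Hom C X Y" "g \<in> Hom C X Y"
  shows "f = g \<oplus> (f \<oplus> \<ominus> g)"
  using assms add_left_comm[of g f "\<ominus> g"] add_neg[of g] by simp

lemma short_exact_hom:
  assumes "short_exact m r" "m \<in> Hom C X Y" "r \<in> Hom C Y Z"
  shows "monomorphism C m" "epimorphism C r" "r \<cdot> m = \<zero> X Z"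
  using assms kernel_mono cokernel_epi kernel_hom(4)[of r m] unfolding short_exact_def by auto

lemma short_exact_lift:
  assumes "short_exact m r" "m \<in> Hom C X Y" "r \<in> Hom C Y Z" "t \<in> Hom C W Y" "r \<cdot> t = \<zero> W Z"
  obtains u where "u \<in> Hom C W X" "m \<cdot> u = t"
  using assms kernel_ex[of r m t W] unfolding short_exact_def by auto

lemma short_exact_extend:
  assumes "short_exact m r" "m \<in> Hom C X Y" "r \<in> Hom C Y Z" "t \<in> Hom C Y W" "t \<cdot> m = \<zero> X W"
  obtains u where "u \<in> Hom C Z W" "u \<cdot> r = t"
  using assms cokernel_ex[of m r t W] unfolding short_exact_def by auto

lemma injective_extend:
  assumes "injective C J" "monomorphism C m" "m \<in> Hom C X Y" "a \<in> Hom C X J"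
  obtains b where "b \<in> Hom C Y J" "b \<cdot> m = a"
proof -
  have t: "Dom C m = X" "Cod C m = Y" using assms(3) by simp_all
  have "\<forall>f \<in> Hom C (Dom C m) J. \<exists>g \<in> Hom C (Cod C m) J. g \<cdot> m = f"
    using assms(1,2) unfolding injective_def by blast
  then show thesis using assms(4) that unfolding t by blast
qed

lemma projective_lift:
  assumes "projective C P" "epimorphism C r" "r \<in> Hom C Y Z" "a \<in> Hom C P Z"
  obtains b where "b \<in> Hom C P Y" "r \<cdot> b = a"
proof -
  have t: "Dom C r = Y" "Cod C r = Z" using assms(3) by simp_all
  have "\<forall>f \<in> Hom C P (Cod C r). \<exists>g \<in> Hom C P (Dom C r). r \<cdot> g = f"
    using assms(1,2) unfolding projective_def by blast
  then show thesis using assms(4) that unfolding t by blast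
qed

lemma null_typedE:
  assumes "null n" "n \<in> Hom C X Y"
  obtains P a b where "projective C P" "a \<in> Hom C X P" "b \<in> Hom C P Y" "n = b \<cdot> a"
proof -
  have t: "Dom C n = X" "Cod C n = Y" using assms(2) by simp_all
  show thesis using assms(1) that unfolding null_def t by blast
qed

lemma null_diff_id:
  assumes "f \<simeq> Ident C X" "f \<in> Hom C X X"
  obtains n where "null n" "n \<in> Hom C X X" "f = Ident C X \<oplus> n"
  using assms(1) by (rule stable_eqE) (use assms(2) stable_eq_hom[OF assms(1)] in auto)

end

context quasi_frobenius_category
begin

lemma projective_injective: "projective C P \<Longrightarrow> injective C P"
  using projective_iff_injective[of P] by (simp add: projective_def)

text \<open>
  Write \<open>x = 1 + a\<close>, \<open>y = 1 + b\<close>, \<open>z = 1 + n\<close> with \<open>a\<close> and \<open>b\<close> null. A factorization of \<open>a\<close> through an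
  injective object extends from \<open>X\<close> to \<open>Y\<close>, and with its help \<open>b\<close> can be changed, without changing
  \<open>r \<cdot> b\<close>, into a map \<open>b'\<close> that kills \<open>m\<close>. Then \<open>b' = e \<cdot> r\<close> for some \<open>e\<close>, and \<open>n \<cdot> r = r \<cdot> b' = r \<cdot> e \<cdot> r\<close>
  gives \<open>n = r \<cdot> e\<close>. Consequently \<open>n \<cdot> n = n \<cdot> r \<cdot> e = r \<cdot> b \<cdot> e\<close> is null.
\<close>
lemma weq_exact_endo_right:
  assumes ex: "short_exact m r" and m: "m \<in> Hom C X Y" and r: "r \<in> Hom C Y Z"
    and x: "x \<in> Hom C X X" and y: "y \<in> Hom C Y Y" and z: "z \<in> Hom C Z Z"
    and ym: "y \<cdot> m = m \<cdot> x" and zr: "z \<cdot> r = r \<cdot> y"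
    and x1: "x \<simeq> Ident C X" and y1: "y \<simeq> Ident C Y"
  shows "weq z"
proof -
  have ob: "X \<in> Obj C" "Y \<in> Obj C" "Z \<in> Obj C" using m r by auto
  obtain a where a: "null a" "a \<in> Hom C X X" "x = Ident C X \<oplus> a" using x1 x by (rule null_diff_id)
  obtain b where b: "null b" "b \<in> Hom C Y Y" "y = Ident C Y \<oplus> b" using y1 y by (rule null_diff_id)
  define n where "n = z \<oplus> \<ominus> (Ident C Z)"
  have n: "n \<in> Hom C Z Z" using z ob by (simp add: n_def)
  have zn: "z = Ident C Z \<oplus> n"
    unfolding n_def by (rule diff_add) (use z ob in simp_all)
  have bm: "b \<cdot> m = m \<cdot> a"
  proof -
    have "m \<oplus> b \<cdot> m = m \<oplus> m \<cdot> a" using ym a(2,3) b(2,3) m ob by simp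
    then have "\<ominus> m \<oplus> (m \<oplus> b \<cdot> m) = \<ominus> m \<oplus> (m \<oplus> m \<cdot> a)" by simp
    then show ?thesis using a(2) b(2) m by simp
  qed
  have nr: "n \<cdot> r = r \<cdot> b"
  proof -
    have "r \<oplus> n \<cdot> r = r \<oplus> r \<cdot> b" using zr zn n b(2,3) r ob by simp
    then have "\<ominus> r \<oplus> (r \<oplus> n \<cdot> r) = \<ominus> r \<oplus> (r \<oplus> r \<cdot> b)" by simp
    then show ?thesis using n b(2) r by simp
  qed
  obtain P u v where P: "projective C P" and u: "u \<in> Hom C X P" and v: "v \<in> Hom C P X" and a': "a = v \<cdot> u"
    using a(1,2) by (rule null_typedE)
  obtain w where w: "w \<in> Hom C Y P" "w \<cdot> m = u"
    using projective_injective[OF P] short_exact_hom(1)[OF ex m r] m u by (rule injective_extend)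
  define b' where "b' = b \<oplus> \<ominus> (m \<cdot> (v \<cdot> w))"
  have b't: "b' \<in> Hom C Y Y" using b(2) m v w by (simp add: b'_def)
  have "b' \<cdot> m = \<zero> X Y"
    using b(2) m v w u bm a' add_neg[of "m \<cdot> a"] by (simp add: b'_def)
  with ex m r b't obtain e where e: "e \<in> Hom C Z Y" "e \<cdot> r = b'" by (rule short_exact_extend)
  have rb': "r \<cdot> b' = n \<cdot> r"
  proof -
    have "r \<cdot> (m \<cdot> (v \<cdot> w)) = \<zero> Y Z"
      using comp_assoc_rewrite[OF short_exact_hom(3)[OF ex m r], of "v \<cdot> w"] m r v w ob by simp
    then show ?thesis using ob b(2) m v w r nr by (simp add: b'_def)
  qed
  have "n = r \<cdot> e"
    by (rule epi_cancel[OF short_exact_hom(2)[OF ex m r], of _ Z]) (use n e r rb' in simp_all)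
  then have "n \<cdot> n = (r \<cdot> b) \<cdot> e"
    using nr comp_assoc_rewrite[OF nr, of e] n r e b by simp
  moreover have "null ((r \<cdot> b) \<cdot> e)"
    by (intro null_comp_right null_comp_left b(1)) (use r b(2) e in simp_all)
  ultimately show ?thesis using weq_unipotent[OF z zn n] by simp
qed

text \<open>
  Dual to \<open>weq_exact_endo_right\<close>: a factorization of \<open>z - 1\<close> through a projective object is lifted along
  \<open>r\<close>, the modified \<open>b\<close> factors through the kernel \<open>m\<close> as \<open>m \<cdot> e\<close>, and \<open>a = e \<cdot> m\<close> has
  \<open>a \<cdot> a = e \<cdot> m \<cdot> a = e \<cdot> b \<cdot> m\<close>.
\<close>
lemma weq_exact_endo_left:
  assumes ex: "short_exact m r" and m: "m \<in> Hom C X Y" and r: "r \<in> Hom C Y Z"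
    and x: "x \<in> Hom C X X" and y: "y \<in> Hom C Y Y" and z: "z \<in> Hom C Z Z"
    and ym: "y \<cdot> m = m \<cdot> x" and zr: "z \<cdot> r = r \<cdot> y"
    and y1: "y \<simeq> Ident C Y" and z1: "z \<simeq> Ident C Z"
  shows "weq x"
proof -
  have ob: "X \<in> Obj C" "Y \<in> Obj C" "Z \<in> Obj C" using m r by auto
  obtain b where b: "null b" "b \<in> Hom C Y Y" "y = Ident C Y \<oplus> b" using y1 y by (rule null_diff_id)
  obtain n where n: "null n" "n \<in> Hom C Z Z" "z = Ident C Z \<oplus> n" using z1 z by (rule null_diff_id)
  define a where "a = x \<oplus> \<ominus> (Ident C X)"
  have a: "a \<in> Hom C X X" using x ob by (simp add: a_def)
  have xa: "x = Ident C X \<oplus> a"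
    unfolding a_def by (rule diff_add) (use x ob in simp_all)
  have bm: "b \<cdot> m = m \<cdot> a"
  proof -
    have "m \<oplus> b \<cdot> m = m \<oplus> m \<cdot> a" using ym a xa b(2,3) m ob by simp
    then have "\<ominus> m \<oplus> (m \<oplus> b \<cdot> m) = \<ominus> m \<oplus> (m \<oplus> m \<cdot> a)" by simp
    then show ?thesis using a b(2) m by simp
  qed
  have nr: "n \<cdot> r = r \<cdot> b"
  proof -
    have "r \<oplus> n \<cdot> r = r \<oplus> r \<cdot> b" using zr n(2,3) b(2,3) r ob by simp
    then have "\<ominus> r \<oplus> (r \<oplus> n \<cdot> r) = \<ominus> r \<oplus> (r \<oplus> r \<cdot> b)" by simp
    then show ?thesis using n(2) b(2) r by simp
  qed
  obtain P u v where P: "projective C P" and u: "u \<in> Hom C Z P" and v: "v \<in> Hom C P Z" and n': "n = v \<cdot> u"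
    using n(1,2) by (rule null_typedE)
  obtain w where w: "w \<in> Hom C P Y" "r \<cdot> w = v"
    using P short_exact_hom(2)[OF ex m r] r v by (rule projective_lift)
  define b' where "b' = b \<oplus> \<ominus> (w \<cdot> (u \<cdot> r))"
  have b't: "b' \<in> Hom C Y Y" using b(2) r u w by (simp add: b'_def)
  have "r \<cdot> (w \<cdot> (u \<cdot> r)) = n \<cdot> r"
    using comp_assoc_rewrite[OF w(2), of "u \<cdot> r"] w(1) u v r n' by simp
  then have "r \<cdot> b' = \<zero> Y Z"
    using b(2) r u w(1) nr add_neg[of "r \<cdot> b"] by (simp add: b'_def)
  with ex m r b't obtain e where e: "e \<in> Hom C Y X" "m \<cdot> e = b'" by (rule short_exact_lift)
  have b'm: "b' \<cdot> m = m \<cdot> a"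
  proof -
    have "(w \<cdot> (u \<cdot> r)) \<cdot> m = \<zero> X Y"
      using short_exact_hom(3)[OF ex m r] m r u w(1) ob by simp
    then show ?thesis using ob a b(2) m r u w(1) bm by (simp add: b'_def)
  qed
  have a': "a = e \<cdot> m"
    by (rule mono_cancel[OF short_exact_hom(1)[OF ex m r], of _ X])
      (use a e(1) m b'm comp_assoc_rewrite[OF e(2), of m] in simp_all)
  have "a \<cdot> a = e \<cdot> (m \<cdot> a)" using a' a e(1) m by simp
  then have "a \<cdot> a = e \<cdot> (b \<cdot> m)" using bm by simp
  moreover have "null (e \<cdot> (b \<cdot> m))"
    by (intro null_comp_right null_comp_left b(1)) (use m b(2) e in simp_all)
  ultimately show ?thesis using weq_unipotent[OF x xa a] by simp
qed

lemma null_cancel_right: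
  assumes "null (d \<cdot> x)" "x \<in> Hom C X Y" "d \<in> Hom C Y Z" "weq x"
  shows "null d"
proof -
  obtain h where h: "h \<in> Hom C Y X" "x \<cdot> h \<simeq> Ident C Y"
    using assms(4,2) by (rule weq_stable_inverse)
  have "d \<cdot> Ident C Y \<simeq> d \<cdot> (x \<cdot> h)"
    by (rule stable_eq_comp_left[OF stable_eq_sym[OF h(2)]]) (use assms h in auto)
  moreover have "d \<cdot> (x \<cdot> h) = (d \<cdot> x) \<cdot> h" using assms h by simp
  moreover have "null ((d \<cdot> x) \<cdot> h)" by (rule null_comp_right) (use assms h in auto)
  ultimately show ?thesis using null_stable_eq assms(3) by simp
qed

text \<open>
  The stable inverses \<open>h\<close> of \<open>x\<close> and \<open>k0\<close> of \<open>y\<close> satisfy \<open>k0 \<cdot> m' \<simeq> m \<cdot> h\<close>, since this holds after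
  composition with \<open>x\<close>. Once \<open>k0\<close> is corrected to give an equality, there is an induced map
  \<open>l: Z' \<rightarrow> Z\<close>, and \<open>weq_exact_endo_right\<close> applies to both composites of \<open>(x, y, z)\<close> and \<open>(h, k, l)\<close>.
\<close>
lemma weq_exact_right:
  assumes ex: "short_exact m r" and m: "m \<in> Hom C X Y" and r: "r \<in> Hom C Y Z"
    and ex': "short_exact m' r'" and m': "m' \<in> Hom C X' Y'" and r': "r' \<in> Hom C Y' Z'"
    and x: "x \<in> Hom C X X'" and y: "y \<in> Hom C Y Y'" and z: "z \<in> Hom C Z Z'"
    and ym: "y \<cdot> m = m' \<cdot> x" and zr: "z \<cdot> r = r' \<cdot> y"
    and wx: "weq x" and wy: "weq y"
  shows "weq z"
proof -
  have ob: "X \<in> Obj C" "Y \<in> Obj C" "Z \<in> Obj C" "X' \<in> Obj C" "Y' \<in> Obj C" "Z' \<in> Obj C"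
    using m r m' r' by auto
  obtain h where h: "h \<in> Hom C X' X" "x \<cdot> h \<simeq> Ident C X'" "h \<cdot> x \<simeq> Ident C X"
    using wx x by (rule weq_stable_inverse)
  obtain k0 where k0: "k0 \<in> Hom C Y' Y" "y \<cdot> k0 \<simeq> Ident C Y'" "k0 \<cdot> y \<simeq> Ident C Y"
    using wy y by (rule weq_stable_inverse)
  \<comment> \<open>the error by which \<open>(h, k0)\<close> fails to be compatible with the sequences\<close>
  define d where "d = k0 \<cdot> m' \<oplus> \<ominus> (m \<cdot> h)"
  have d: "d \<in> Hom C X' Y" using k0(1) m' m h(1) by (simp add: d_def)
  have "null d"
  proof (rule null_cancel_right[OF _ x d wx])
    have "(k0 \<cdot> y) \<cdot> m \<simeq> Ident C Y \<cdot> m" by (rule stable_eq_comp_right[OF k0(3)]) (use m ob in simp_all)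
    also have "Ident C Y \<cdot> m = m \<cdot> Ident C X" using m by simp
    also have "m \<cdot> Ident C X \<simeq> m \<cdot> (h \<cdot> x)"
      by (rule stable_eq_comp_left[OF stable_eq_sym[OF h(3)]]) (use m h(1) x in simp_all)
    finally have "k0 \<cdot> m' \<cdot> x \<simeq> m \<cdot> h \<cdot> x" using k0(1) y m m' x h(1) ym by simp
    then show "null (d \<cdot> x)" using stable_eqD k0(1) m m' x h(1) by (fastforce simp: d_def)
  qed
  then obtain P u v where P: "projective C P" and u: "u \<in> Hom C X' P" and v: "v \<in> Hom C P Y" and d': "d = v \<cdot> u"
    using d by (rule null_typedE)
  obtain w where w: "w \<in> Hom C Y' P" "w \<cdot> m' = u"
    using projective_injective[OF P] short_exact_hom(1)[OF ex' m' r'] m' u by (rule injective_extend)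
  \<comment> \<open>subtracting an extension of \<open>d\<close> to \<open>Y'\<close> removes the error\<close>
  define k where "k = k0 \<oplus> \<ominus> (v \<cdot> w)"
  have k: "k \<in> Hom C Y' Y" using k0(1) v w by (simp add: k_def)
  have kk0: "k \<simeq> k0" unfolding k_def
    by (intro stable_eq_add_null null_neg nullI[OF P w(1) v]) (use k0(1) v w in simp_all)
  have km: "k \<cdot> m' = m \<cdot> h"
  proof (rule eq_if_diff_zero[of _ X' Y])
    have "k \<cdot> m' = k0 \<cdot> m' \<oplus> \<ominus> d" using k0(1) v w m' u d' by (simp add: k_def)
    then show "k \<cdot> m' \<oplus> \<ominus> (m \<cdot> h) = \<zero> X' Y"
      using k0(1) m m' h(1) d ob by (simp add: d_def neg_add add_neg)
  qed (use k m m' h(1) in simp_all)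
  have yk: "y \<cdot> k \<simeq> Ident C Y'" "k \<cdot> y \<simeq> Ident C Y"
    using stable_eq_trans[OF stable_eq_comp_left[OF kk0, of y] k0(2)]
      stable_eq_trans[OF stable_eq_comp_right[OF kk0, of y] k0(3)] y k0(1) by simp_all
  have rk: "r \<cdot> k \<in> Hom C Y' Z" using r k by simp
  have "(r \<cdot> k) \<cdot> m' = \<zero> X' Z"
    using comp_assoc_rewrite[OF short_exact_hom(3)[OF ex m r], of h] km r k m m' h(1) ob by simp
  with ex' m' r' rk obtain l where l: "l \<in> Hom C Z' Z" "l \<cdot> r' = r \<cdot> k" by (rule short_exact_extend)
  have "weq (l \<cdot> z)"
  proof (rule weq_exact_endo_right[OF ex m r, of "h \<cdot> x" "k \<cdot> y"])
    show "k \<cdot> y \<cdot> m = m \<cdot> (h \<cdot> x)"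
      using comp_assoc_rewrite[OF km, of x] ym k y m m' x h(1) by simp
    show "l \<cdot> z \<cdot> r = r \<cdot> (k \<cdot> y)"
      using comp_assoc_rewrite[OF l(2), of y] zr l(1) z r r' y k by simp
  qed (use x y z h k yk l(1) in simp_all)
  moreover have "weq (z \<cdot> l)"
  proof (rule weq_exact_endo_right[OF ex' m' r', of "x \<cdot> h" "y \<cdot> k"])
    show "y \<cdot> k \<cdot> m' = m' \<cdot> (x \<cdot> h)"
      using comp_assoc_rewrite[OF ym, of h] km k y m m' x h(1) by simp
    show "z \<cdot> l \<cdot> r' = r' \<cdot> (y \<cdot> k)"
      using comp_assoc_rewrite[OF zr, of k] l z r r' y k by simp
  qed (use x y z h k yk l(1) in simp_all)
  ultimately show ?thesis using weq_cancel_both[OF l(1) z l(1)] by simp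
qed

text \<open>
  Dual to \<open>weq_exact_right\<close>: here the stable inverse of \<open>y\<close> is corrected to be strictly compatible with
  that of \<open>z\<close>, and it then restricts to the kernels.
\<close>
lemma weq_exact_left:
  assumes ex: "short_exact m r" and m: "m \<in> Hom C X Y" and r: "r \<in> Hom C Y Z"
    and ex': "short_exact m' r'" and m': "m' \<in> Hom C X' Y'" and r': "r' \<in> Hom C Y' Z'"
    and x: "x \<in> Hom C X X'" and y: "y \<in> Hom C Y Y'" and z: "z \<in> Hom C Z Z'"
    and ym: "y \<cdot> m = m' \<cdot> x" and zr: "z \<cdot> r = r' \<cdot> y"
    and wy: "weq y" and wz: "weq z"
  shows "weq x"
proof -
  have ob: "X \<in> Obj C" "Y \<in> Obj C" "Z \<in> Obj C" "X' \<in> Obj C" "Y' \<in> Obj C" "Z' \<in> Obj C"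
    using m r m' r' by auto
  obtain k0 where k0: "k0 \<in> Hom C Y' Y" "y \<cdot> k0 \<simeq> Ident C Y'" "k0 \<cdot> y \<simeq> Ident C Y"
    using wy y by (rule weq_stable_inverse)
  obtain l where l: "l \<in> Hom C Z' Z" "z \<cdot> l \<simeq> Ident C Z'" "l \<cdot> z \<simeq> Ident C Z"
    using wz z by (rule weq_stable_inverse)
  define d where "d = r \<cdot> k0 \<oplus> \<ominus> (l \<cdot> r')"
  have d: "d \<in> Hom C Y' Z" using k0(1) r' r l(1) by (simp add: d_def)
  have "null d"
  proof (rule null_cancel_right[OF _ y d wy])
    have "r \<cdot> (k0 \<cdot> y) \<simeq> r \<cdot> Ident C Y" by (rule stable_eq_comp_left[OF k0(3)]) (use r ob in simp_all)
    also have "r \<cdot> Ident C Y = Ident C Z \<cdot> r" using r by simp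
    also have "Ident C Z \<cdot> r \<simeq> (l \<cdot> z) \<cdot> r"
      by (rule stable_eq_comp_right[OF stable_eq_sym[OF l(3)]]) (use r l(1) z in simp_all)
    finally have "r \<cdot> k0 \<cdot> y \<simeq> l \<cdot> r' \<cdot> y" using k0(1) y r r' z l(1) zr by simp
    then show "null (d \<cdot> y)" using stable_eqD k0(1) r r' y l(1) by (fastforce simp: d_def)
  qed
  then obtain P u v where P: "projective C P" and u: "u \<in> Hom C Y' P" and v: "v \<in> Hom C P Z" and d': "d = v \<cdot> u"
    using d by (rule null_typedE)
  obtain w where w: "w \<in> Hom C P Y" "r \<cdot> w = v"
    using P short_exact_hom(2)[OF ex m r] r v by (rule projective_lift)
  \<comment> \<open>subtracting a lift of \<open>d\<close> along \<open>r\<close> removes the error\<close>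
  define k where "k = k0 \<oplus> \<ominus> (w \<cdot> u)"
  have k: "k \<in> Hom C Y' Y" using k0(1) u w by (simp add: k_def)
  have kk0: "k \<simeq> k0" unfolding k_def
    by (intro stable_eq_add_null null_neg nullI[OF P u w(1)]) (use k0(1) u w in simp_all)
  have rk: "r \<cdot> k = l \<cdot> r'"
  proof (rule eq_if_diff_zero[of _ Y' Z])
    have "r \<cdot> k = r \<cdot> k0 \<oplus> \<ominus> d"
      using k0(1) u v w(1) r d' comp_assoc_rewrite[OF w(2), of u] by (simp add: k_def)
    then show "r \<cdot> k \<oplus> \<ominus> (l \<cdot> r') = \<zero> Y' Z"
      using k0(1) r r' l(1) d ob by (simp add: d_def neg_add add_neg)
  qed (use k r r' l(1) in simp_all)
  have yk: "y \<cdot> k \<simeq> Ident C Y'" "k \<cdot> y \<simeq> Ident C Y"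
    using stable_eq_trans[OF stable_eq_comp_left[OF kk0, of y] k0(2)]
      stable_eq_trans[OF stable_eq_comp_right[OF kk0, of y] k0(3)] y k0(1) by simp_all
  have km: "k \<cdot> m' \<in> Hom C X' Y" using m' k by simp
  have "r \<cdot> (k \<cdot> m') = \<zero> X' Z"
    using comp_assoc_rewrite[OF rk, of m'] short_exact_hom(3)[OF ex' m' r'] r r' k m' l(1) ob by simp
  with ex m r km obtain h where h: "h \<in> Hom C X' X" "m \<cdot> h = k \<cdot> m'" by (rule short_exact_lift)
  have "weq (h \<cdot> x)"
  proof (rule weq_exact_endo_left[OF ex m r, of _ "k \<cdot> y" "l \<cdot> z"])
    show "k \<cdot> y \<cdot> m = m \<cdot> (h \<cdot> x)"
      using comp_assoc_rewrite[OF h(2), of x] ym k y m m' x h(1) by simp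
    show "l \<cdot> z \<cdot> r = r \<cdot> (k \<cdot> y)"
      using comp_assoc_rewrite[OF rk, of y] zr l(1) z r r' y k by simp
  qed (use x y z h k yk l in simp_all)
  moreover have "weq (x \<cdot> h)"
  proof (rule weq_exact_endo_left[OF ex' m' r', of _ "y \<cdot> k" "z \<cdot> l"])
    show "y \<cdot> k \<cdot> m' = m' \<cdot> (x \<cdot> h)"
      using comp_assoc_rewrite[OF ym, of h] h k y m m' x by simp
    show "z \<cdot> l \<cdot> r' = r' \<cdot> (y \<cdot> k)"
      using comp_assoc_rewrite[OF zr, of k] rk l(1) z r r' y k by simp
  qed (use x y z h k yk l in simp_all)
  ultimately show ?thesis using weq_cancel_both[OF h(1) x h(1)] by simp
qed

end

section \<open>The Waldhausen structure\<close>

context abelian_category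
begin

lemma stable_eq_add:
  assumes "f \<simeq> g" "f' \<simeq> g'" "Dom C g' = Dom C g" "Cod C g' = Cod C g"
  shows "f \<oplus> f' \<simeq> g \<oplus> g'"
proof -
  obtain n where n: "null n" "f = g \<oplus> n" "Dom C n = Dom C g" "Cod C n = Cod C g" "n \<in> Mor C" "g \<in> Mor C"
    using assms(1) by (rule stable_eqE)
  obtain n' where n': "null n'" "f' = g' \<oplus> n'" "Dom C n' = Dom C g'" "Cod C n' = Cod C g'"
    "n' \<in> Mor C" "g' \<in> Mor C"
    using assms(2) by (rule stable_eqE)
  have "f \<oplus> f' = (g \<oplus> g') \<oplus> (n \<oplus> n')"
    using n(2-6) n'(2-6) assms(3,4) by (simp add: add_assoc add_left_comm)
  moreover have "(g \<oplus> g') \<oplus> (n \<oplus> n') \<simeq> g \<oplus> g'"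
    using n(1,3-6) n'(1,3-6) assms(3,4) by (intro stable_eq_add_null null_add) simp_all
  ultimately show ?thesis by simp
qed

lemma weq_biproduct:
  assumes b: "biproduct Y Z B i j p q" and b': "biproduct Y' Z' B' i' j' p' q'"
    and y: "y \<in> Hom C Y Y'" "weq y" and z: "z \<in> Hom C Z Z'" "weq z"
  shows "weq (i' \<cdot> y \<cdot> p \<oplus> j' \<cdot> z \<cdot> q)"
proof -
  note h = biproduct_hom[OF b] and h' = biproduct_hom[OF b']
  note e = biproduct_reassoc[OF b] and e' = biproduct_reassoc[OF b']
  obtain k where k: "k \<in> Hom C Y' Y" "y \<cdot> k \<simeq> Ident C Y'" "k \<cdot> y \<simeq> Ident C Y"
    using y(2,1) by (rule weq_stable_inverse)
  obtain l where l: "l \<in> Hom C Z' Z" "z \<cdot> l \<simeq> Ident C Z'" "l \<cdot> z \<simeq> Ident C Z"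
    using z(2,1) by (rule weq_stable_inverse)
  define s t where "s = i' \<cdot> y \<cdot> p \<oplus> j' \<cdot> z \<cdot> q" and "t = i \<cdot> k \<cdot> p' \<oplus> j \<cdot> l \<cdot> q'"
  have st: "s \<in> Hom C B B'" "t \<in> Hom C B' B"
    using y(1) z(1) k(1) l(1) h h' by (simp_all add: s_def t_def)
  have "t \<cdot> s = i \<cdot> ((k \<cdot> y) \<cdot> p) \<oplus> j \<cdot> ((l \<cdot> z) \<cdot> q)"
    using y(1) z(1) k(1) l(1) h h' e' by (simp add: s_def t_def)
  also have "\<dots> \<simeq> i \<cdot> (Ident C Y \<cdot> p) \<oplus> j \<cdot> (Ident C Z \<cdot> q)"
    by (intro stable_eq_add stable_eq_comp_left stable_eq_comp_right k(3) l(3))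
      (use y(1) z(1) k(1) l(1) h h' in simp_all)
  also have "\<dots> = Ident C B" using h biproduct_eqs(5)[OF b] by simp
  finally have ts: "t \<cdot> s \<simeq> Ident C B" .
  have "s \<cdot> t = i' \<cdot> ((y \<cdot> k) \<cdot> p') \<oplus> j' \<cdot> ((z \<cdot> l) \<cdot> q')"
    using y(1) z(1) k(1) l(1) h h' e by (simp add: s_def t_def)
  also have "\<dots> \<simeq> i' \<cdot> (Ident C Y' \<cdot> p') \<oplus> j' \<cdot> (Ident C Z' \<cdot> q')"
    by (intro stable_eq_add stable_eq_comp_left stable_eq_comp_right k(2) l(2))
      (use y(1) z(1) k(1) l(1) h h' in simp_all)
  also have "\<dots> = Ident C B'" using h' biproduct_eqs(5)[OF b'] by simp
  finally have "s \<cdot> t \<simeq> Ident C B'" .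
  with ts have "weq s" using weq_one_sided[OF st(1) st(2) st(2)] by blast
  then show ?thesis unfolding s_def .
qed

end

context quasi_frobenius_category
begin

text \<open>
  The map of pushout squares is a map of the short exact sequences of \<open>pushout_short_exact\<close>, with
  \<open>y \<oplus> z\<close> in the middle.
\<close>
lemma pushout_weq:
  assumes po: "pushout C f g i j" and po': "pushout C f' g' i' j'"
    and f: "monomorphism C f" and f': "monomorphism C f'"
    and x: "x \<in> Hom C (Dom C f) (Dom C f')" and y: "y \<in> Hom C (Cod C f) (Cod C f')"
    and z: "z \<in> Hom C (Cod C g) (Cod C g')" and w: "w \<in> Hom C (Cod C i) (Cod C i')"
    and yf: "y \<cdot> f = f' \<cdot> x" and zg: "z \<cdot> g = g' \<cdot> x" and wi: "w \<cdot> i = i' \<cdot> y" and wj: "w \<cdot> j = j' \<cdot> z"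
    and wy: "weq y" and wz: "weq z"
  shows "weq x \<longleftrightarrow> weq w"
proof -
  note t = pushout_hom[OF po] and t' = pushout_hom[OF po']
  have "Cod C f \<in> Obj C" "Cod C g \<in> Obj C" "Cod C f' \<in> Obj C" "Cod C g' \<in> Obj C"
    using t t' by simp_all
  then obtain B i1 i2 p1 p2 B' i1' i2' p1' p2'
    where b: "biproduct (Cod C f) (Cod C g) B i1 i2 p1 p2"
      and b': "biproduct (Cod C f') (Cod C g') B' i1' i2' p1' p2'"
    using obtain_biproduct by metis
  note h = biproduct_hom[OF b] and h' = biproduct_hom[OF b']
  note e = biproduct_reassoc[OF b] and e' = biproduct_reassoc[OF b']
  define m r where "m = i1 \<cdot> f \<oplus> \<ominus> (i2 \<cdot> g)" and "r = i \<cdot> p1 \<oplus> j \<cdot> p2"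
  define m' r' where "m' = i1' \<cdot> f' \<oplus> \<ominus> (i2' \<cdot> g')" and "r' = i' \<cdot> p1' \<oplus> j' \<cdot> p2'"
  define s where "s = i1' \<cdot> y \<cdot> p1 \<oplus> i2' \<cdot> z \<cdot> p2"
  have ex: "short_exact m r" "short_exact m' r'"
    unfolding m_def r_def m'_def r'_def
    by (rule pushout_short_exact[OF po f b], rule pushout_short_exact[OF po' f' b'])
  have mr: "m \<in> Hom C (Dom C f) B" "r \<in> Hom C B (Cod C i)"
    using t h by (simp_all add: m_def r_def)
  have mr': "m' \<in> Hom C (Dom C f') B'" "r' \<in> Hom C B' (Cod C i')"
    using t' h' by (simp_all add: m'_def r'_def)
  have s: "s \<in> Hom C B B'" using y z h h' by (simp add: s_def)
  have ws: "weq s" unfolding s_def by (rule weq_biproduct[OF b b' y wy z wz])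
  have "Dom C f \<in> Obj C" using t by simp
  then have sm: "s \<cdot> m = m' \<cdot> x"
    using t t' h h' x y z e yf zg by (simp add: s_def m_def m'_def)
  have wr: "w \<cdot> r = r' \<cdot> s"
    using t t' h h' w y z e' comp_assoc_rewrite[OF wi, of p1] comp_assoc_rewrite[OF wj, of p2]
    by (simp add: s_def r_def r'_def)
  show ?thesis
    using weq_exact_right[OF ex(1) mr ex(2) mr' x s w sm wr]
      weq_exact_left[OF ex(1) mr ex(2) mr' x s w sm wr] ws by blast
qed

text \<open>
  An injective object is projective, so its identity is null and the zero map backwards is a stable
  inverse.
\<close>
lemma weq_between_injectives:
  assumes "injective C J" "injective C K" "v \<in> Hom C J K"
  shows "weq v"
proof -
  have ob: "J \<in> Obj C" "K \<in> Obj C" using assms(1,2) by (simp_all add: injective_def)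
  have null_id: "\<zero> X X \<simeq> Ident C X" if "injective C X" for X
  proof -
    have X: "X \<in> Obj C" "projective C X"
      using that projective_iff_injective[of X] by (simp_all add: injective_def)
    have "null (Ident C X \<cdot> Ident C X)" by (rule nullI[OF X(2)]) (use X in simp_all)
    then have "\<zero> X X \<oplus> Ident C X \<simeq> \<zero> X X" using X(1) by (intro stable_eq_add_null) simp_all
    then show ?thesis using X(1) stable_eq_sym by simp
  qed
  show ?thesis
    by (rule weq_one_sided[of v J K "\<zero> K J" "\<zero> K J"]) (use assms null_id ob in simp_all)
qed

lemma frobenius_waldhausen:
  assumes pt: "zero_object C pt"
  shows "waldhausen_category C pt {f. monomorphism C f} {f. weq f}"
proof (intro waldhausen_category.intro waldhausen_category_axioms.intro, goal_cases)
  case 1 show ?case by (rule category_axioms)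
next
  case 2 show ?case by (rule pt)
next
  case (3 f X Y g Z) then show ?case by (metis obtain_pushout)
next
  case (9 X f)
  then show ?case using zero_object_to[OF pt] unfolding monomorphism_def by (auto simp del: in_Hom_iff simp: Hom_def[of C pt])
next
  case (10 f g i j) then show ?case using pushout_mono[OF pushout_sym] by simp
next
  case (12 f g i j f' g' i' j' x y z w)
  then show ?case using pushout_weq[of f g i j f' g' i' j' x y z w] by simp
qed (auto simp: mono_mor weq_mor mono_comp weq_compose iso_mono iso_weq)

lemma frobenius_saturation: "saturation_axiom C {f. weq f}"
  unfolding saturation_axiom_def
proof (intro ballI impI, goal_cases)
  case (1 f g)
  then have "f \<in> Hom C (Dom C f) (Cod C f)" "g \<in> Hom C (Cod C f) (Cod C g)" by simp_all
  then show ?case using weq_compose[of f g] weq_cancel_right weq_cancel_left 1(3) by blast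
qed

text \<open>
  With \<open>Y\<close> embedded into an injective object \<open>J\<close>, the object \<open>W\<close> (the codomain of \<open>c\<close>) is the pushout of
  \<open>J \<leftarrow> Y \<rightarrow> Y/X\<close>, and by pasting also that of \<open>J \<leftarrow> X \<rightarrow> pt\<close>. The second description and
  \<open>pushout_weq\<close> make \<open>W \<rightarrow> W'\<close> a stable equivalence; from there the first one leads back to \<open>y\<close>.
\<close>
lemma frobenius_extension:
  assumes pt: "zero_object C pt"
    and inj: "\<And>X. X \<in> Obj C \<Longrightarrow> \<exists>J h. injective C J \<and> h \<in> Hom C X J \<and> monomorphism C h"
  shows "extension_axiom C pt {f. monomorphism C f} {f. weq f}"
  unfolding extension_axiom_def
proof (intro allI impI, elim conjE, simp only: mem_Collect_eq)
  fix i q i' q' x y z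
  assume s: "cofiber_sequence C pt {f. monomorphism C f} i q"
    and s': "cofiber_sequence C pt {f. monomorphism C f} i' q'"
    and x: "x \<in> Hom C (Dom C i) (Dom C i')" and y: "y \<in> Hom C (Cod C i) (Cod C i')"
    and z: "z \<in> Hom C (Cod C q) (Cod C q')"
    and yi: "y \<cdot> i = i' \<cdot> x" and zq: "z \<cdot> q = q' \<cdot> y" and wx: "weq x" and wz: "weq z"
  obtain t e where i: "monomorphism C i" and t: "t \<in> Hom C (Dom C i) pt" and po: "pushout C i t q e"
    using s unfolding cofiber_sequence_def by blast
  obtain t' e' where i': "monomorphism C i'" and t': "t' \<in> Hom C (Dom C i') pt" and po': "pushout C i' t' q' e'"
    using s' unfolding cofiber_sequence_def by blast
  note p = pushout_hom[OF po] and p' = pushout_hom[OF po']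
  obtain J h where J: "injective C J" and h: "h \<in> Hom C (Cod C i) J" "monomorphism C h"
    using inj[of "Cod C i"] p by auto
  obtain J' h' where J': "injective C J'" and h': "h' \<in> Hom C (Cod C i') J'" "monomorphism C h'"
    using inj[of "Cod C i'"] p' by auto
  obtain v where v: "v \<in> Hom C J J'" "v \<cdot> h = h' \<cdot> y"
    by (rule injective_extend[OF J' h(2,1), of "h' \<cdot> y"]) (use h' y in auto)
  have "q \<in> Hom C (Cod C i) (Cod C q)" "q' \<in> Hom C (Cod C i') (Cod C q')" using p p' by simp_all
  then obtain c d c' d' where cd: "pushout C h q c d" and cd': "pushout C h' q' c' d'"
    using obtain_pushout h(1) h'(1) by metis
  note r = pushout_hom[OF cd] and r' = pushout_hom[OF cd']
  obtain w where w: "w \<in> Hom C (Cod C c) (Cod C c')" "w \<cdot> c = c' \<cdot> v" "w \<cdot> d = d' \<cdot> z"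
  proof (rule pushout_ex[OF cd, of "c' \<cdot> v" "Cod C c'" "d' \<cdot> z"])
    have "c' \<cdot> v \<cdot> h = c' \<cdot> h' \<cdot> y" using v h h' r' y by simp
    also have "\<dots> = (d' \<cdot> q') \<cdot> y" using r' by simp
    also have "\<dots> = d' \<cdot> z \<cdot> q" using zq h h' r r' y z comp_assoc_rewrite[OF r'(9), of y] by simp
    finally show "c' \<cdot> v \<cdot> h = d' \<cdot> z \<cdot> q" .
  qed (use v r r' h h' z in simp_all)
  have wv: "weq v" by (rule weq_between_injectives[OF J J' v(1)])
  have "weq w"
  proof (rule iffD1[OF pushout_weq[OF pushout_paste[OF po cd] pushout_paste[OF po' cd'],
        of x v "Ident C pt" w] wx])
    have ptO: "pt \<in> Obj C" using pt by (simp add: zero_object_def)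
    have pte: "a = b" if "a \<in> Hom C pt W" "b \<in> Hom C pt W" for a b W
      using zero_object_from[OF pt that] .
    show "monomorphism C (h \<cdot> i)" "monomorphism C (h' \<cdot> i')"
      using mono_comp i i' h h' by simp_all
    show "v \<cdot> (h \<cdot> i) = h' \<cdot> i' \<cdot> x"
      using comp_assoc_rewrite[OF v(2), of i] v(1) h h' yi p p' x y by simp
    show "Ident C pt \<cdot> t = t' \<cdot> x"
      by (rule zero_object_to[OF pt, of _ "Dom C i"]) (use t t' x ptO in simp_all)
    show "w \<cdot> (d \<cdot> e) = d' \<cdot> e' \<cdot> Ident C pt"
      by (rule pte[of _ "Cod C c'"]) (use w r r' p p' t t' ptO in simp_all)
    show "weq (Ident C pt)" by (rule weq_identity[OF ptO])
  qed (use x v w wv p p' r r' h h' t t' pt in \<open>simp_all add: zero_object_def\<close>)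
  then show "weq y"
    using pushout_weq[OF cd cd' h(2) h'(2), of y v z w] wv wz v w z zq y h h' r r' by auto
qed

end

section \<open>Reduced functorial injective embeddings\<close>

text \<open>
  The last condition, \<open>I_zero\<close>, excludes constant summands of \<open>I\<close> and amounts to \<open>I(pt) = 0\<close>.
\<close>
locale reduced_injective_functor = quasi_frobenius_category C
  for C :: "('o, 'm, 'x) preadditive_scheme" (structure) +
  fixes I :: "('o, 'm, 'o, 'm) functor_data" and \<eta> :: "'o \<Rightarrow> 'm"
  assumes natural_unit: "natural_transformation C C id_functor I \<eta>"
    and injective_I: "X \<in> Obj C \<Longrightarrow> injective C (OMap I X)"
    and mono_unit: "X \<in> Obj C \<Longrightarrow> monomorphism C (\<eta> X)"
    and mono_I: "monomorphism C f \<Longrightarrow> monomorphism C (MMap I f)"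
    and I_zero: "\<lbrakk>X \<in> Obj C; Y \<in> Obj C\<rbrakk> \<Longrightarrow> MMap I (Zero C X Y) = Zero C (OMap I X) (OMap I Y)"

text \<open>
  The functor laws and the naturality of a transformation \<open>id \<rightarrow> I\<close>, in a form suited for rewriting.
\<close>
lemma natural_transformation_id:
  fixes C :: "('o, 'm, 'x) category_scheme" (structure)
  assumes "natural_transformation C C id_functor I \<eta>"
  shows "X \<in> Obj C \<Longrightarrow> OMap I X \<in> Obj C"
    and "f \<in> Mor C \<Longrightarrow> MMap I f \<in> Mor C"
    and "f \<in> Mor C \<Longrightarrow> Dom C (MMap I f) = OMap I (Dom C f)"
    and "f \<in> Mor C \<Longrightarrow> Cod C (MMap I f) = OMap I (Cod C f)"
    and "X \<in> Obj C \<Longrightarrow> MMap I (Ident C X) = Ident C (OMap I X)"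
    and "\<lbrakk>f \<in> Mor C; g \<in> Mor C; Dom C g = Cod C f\<rbrakk> \<Longrightarrow> MMap I (g \<cdot> f) = MMap I g \<cdot> MMap I f"
    and "X \<in> Obj C \<Longrightarrow> \<eta> X \<in> Mor C"
    and "X \<in> Obj C \<Longrightarrow> Dom C (\<eta> X) = X"
    and "X \<in> Obj C \<Longrightarrow> Cod C (\<eta> X) = OMap I X"
    and "f \<in> Hom C X Y \<Longrightarrow> \<eta> Y \<cdot> f = MMap I f \<cdot> \<eta> X"
proof -
  interpret N: natural_transformation C C id_functor I \<eta> by (rule assms)
  show "X \<in> Obj C \<Longrightarrow> OMap I X \<in> Obj C" by (rule N.target.map_obj)
  show "f \<in> Mor C \<Longrightarrow> MMap I f \<in> Mor C" "f \<in> Mor C \<Longrightarrow> Dom C (MMap I f) = OMap I (Dom C f)"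
    "f \<in> Mor C \<Longrightarrow> Cod C (MMap I f) = OMap I (Cod C f)"
    using N.target.map_hom[of f "Dom C f" "Cod C f"] by simp_all
  show "X \<in> Obj C \<Longrightarrow> MMap I (Ident C X) = Ident C (OMap I X)" by (rule N.target.map_id)
  show "\<lbrakk>f \<in> Mor C; g \<in> Mor C; Dom C g = Cod C f\<rbrakk> \<Longrightarrow> MMap I (g \<cdot> f) = MMap I g \<cdot> MMap I f"
    by (rule N.target.map_comp[of f "Dom C f" "Cod C f" g "Cod C g"]) simp_all
  show "X \<in> Obj C \<Longrightarrow> \<eta> X \<in> Mor C" "X \<in> Obj C \<Longrightarrow> Dom C (\<eta> X) = X"
    "X \<in> Obj C \<Longrightarrow> Cod C (\<eta> X) = OMap I X"
    using N.component[of X] by (simp_all add: id_functor_def)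
  show "f \<in> Hom C X Y \<Longrightarrow> \<eta> Y \<cdot> f = MMap I f \<cdot> \<eta> X"
    using N.naturality[of f X Y] by (simp add: id_functor_def)
qed

lemma (in category) id_cat_functor: "cat_functor C C id_functor"
  by (intro cat_functor.intro cat_functor_axioms.intro category_axioms) (simp_all add: id_functor_def)

lemma (in abelian_category) injective_retract:
  assumes J: "injective C J" and k: "k \<in> Hom C K J" and r: "r \<in> Hom C J K" and rk: "r \<cdot> k = Ident C K"
  shows "injective C K"
proof -
  have "\<exists>g \<in> Hom C (Cod C m) K. g \<cdot> m = f" if m: "monomorphism C m" and f: "f \<in> Hom C (Dom C m) K" for m f
  proof -
    have mt: "m \<in> Hom C (Dom C m) (Cod C m)" using mono_mor[OF m] by simp
    have "k \<cdot> f \<in> Hom C (Dom C m) J" using k f by simp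
    with J m mt obtain g where g: "g \<in> Hom C (Cod C m) J" "g \<cdot> m = k \<cdot> f" by (rule injective_extend)
    have "r \<cdot> g \<cdot> m = r \<cdot> (k \<cdot> f)" using g r mt by simp
    also have "\<dots> = f" using comp_assoc_rewrite[OF rk, of f] k r f by simp
    finally show ?thesis using g(1) r by (intro bexI[of _ "r \<cdot> g"]) simp_all
  qed
  then show ?thesis using k unfolding injective_def by auto
qed

text \<open>
  Take \<open>I'(X)\<close> to be the kernel of \<open>I(X) \<rightarrow> I(pt)\<close>. The zero map of \<open>X\<close> factors through \<open>pt\<close>, so
  \<open>1 - I(0)\<close> projects \<open>I(X)\<close> onto this kernel, which is therefore injective as a retract. By naturality
  \<open>\<eta>\<close> has values in the kernel, because \<open>\<eta> pt \<cdot> 0 = 0\<close>.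
\<close>
lemma (in quasi_frobenius_category) obtain_reduced_injective_functor:
  assumes nt: "natural_transformation C C id_functor I \<eta>"
    and inj: "\<And>X. X \<in> Obj C \<Longrightarrow> injective C (OMap I X)"
    and mono_unit: "\<And>X. X \<in> Obj C \<Longrightarrow> monomorphism C (\<eta> X)"
    and mono_I: "\<And>f. monomorphism C f \<Longrightarrow> monomorphism C (MMap I f)"
  obtains I' \<eta>' where "reduced_injective_functor C I' \<eta>'"
proof -
  obtain pt where pt: "zero_object C pt" using ex_zero_object by blast
  then have ptO: "pt \<in> Obj C" by (simp add: zero_object_def)
  note N = natural_transformation_id[OF nt]
  have "\<exists>k. \<forall>X \<in> Obj C. kernel C (MMap I (\<zero> X pt)) (k X)"
    using ex_kernel N(2) ptO by (intro bchoice) simp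
  then obtain k where k: "\<And>X. X \<in> Obj C \<Longrightarrow> kernel C (MMap I (\<zero> X pt)) (k X)" by blast
  define K where "K X = Dom C (k X)" for X
  have kt: "k X \<in> Mor C" "Dom C (k X) = K X" "Cod C (k X) = OMap I X" "K X \<in> Obj C" "monomorphism C (k X)"
    "MMap I (\<zero> X pt) \<cdot> k X = \<zero> (K X) (OMap I pt)" if "X \<in> Obj C" for X
    using kernel_hom[OF k[OF that]] N(3,4)[of "\<zero> X pt"] that ptO kernel_mono[OF k[OF that]]
    by (simp_all add: K_def)
  have lift: "\<exists>u \<in> Hom C W (K X). k X \<cdot> u = h"
    if X: "X \<in> Obj C" and h: "h \<in> Hom C W (OMap I X)" "MMap I (\<zero> X pt) \<cdot> h = \<zero> W (OMap I pt)" for W X h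
  proof -
    have t: "Dom C (MMap I (\<zero> X pt)) = OMap I X" "Cod C (MMap I (\<zero> X pt)) = OMap I pt"
      using N(3,4)[of "\<zero> X pt"] X ptO by simp_all
    obtain u where "u \<in> Hom C W (Dom C (k X))" "k X \<cdot> u = h"
      by (rule kernel_ex[OF k[OF X], unfolded t, OF h])
    then show ?thesis unfolding K_def by blast
  qed
  have factor: "\<exists>u \<in> Hom C (K (Dom C f)) (K (Cod C f)). k (Cod C f) \<cdot> u = MMap I f \<cdot> k (Dom C f)"
    if f: "f \<in> Mor C" for f
  proof (rule lift)
    have "MMap I (\<zero> (Cod C f) pt) \<cdot> MMap I f = MMap I (\<zero> (Dom C f) pt)"
      using N(6)[of f "\<zero> (Cod C f) pt"] f ptO by simp
    from comp_assoc_rewrite[OF this, of "k (Dom C f)"]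
    show "MMap I (\<zero> (Cod C f) pt) \<cdot> (MMap I f \<cdot> k (Dom C f)) = \<zero> (K (Dom C f)) (OMap I pt)"
      using f ptO N kt by simp
  qed (use f N kt in simp_all)
  define M where "M f = (SOME u. u \<in> Hom C (K (Dom C f)) (K (Cod C f)) \<and> k (Cod C f) \<cdot> u = MMap I f \<cdot> k (Dom C f))" for f
  have Mh: "M f \<in> Hom C (K (Dom C f)) (K (Cod C f))" and kM: "k (Cod C f) \<cdot> M f = MMap I f \<cdot> k (Dom C f)"
    if "f \<in> Mor C" for f
    using someI_ex[OF factor[OF that, unfolded Bex_def]] unfolding M_def by blast+
  have Mt: "M f \<in> Mor C" "Dom C (M f) = K (Dom C f)" "Cod C (M f) = K (Cod C f)" if "f \<in> Mor C" for f
    using Mh[OF that] by simp_all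
  have "\<exists>u. u \<in> Hom C X (K X) \<and> k X \<cdot> u = \<eta> X" if X: "X \<in> Obj C" for X
  proof -
    have "MMap I (\<zero> X pt) \<cdot> \<eta> X = \<eta> pt \<cdot> \<zero> X pt" using N(10)[of "\<zero> X pt" X pt] X ptO by simp
    also have "\<dots> = \<zero> X (OMap I pt)" using N X ptO by simp
    finally show ?thesis using lift[OF X, of "\<eta> X" X] N X by auto
  qed
  then obtain e where e: "\<And>X. X \<in> Obj C \<Longrightarrow> e X \<in> Hom C X (K X)" "\<And>X. X \<in> Obj C \<Longrightarrow> k X \<cdot> e X = \<eta> X"
    by metis
  have et: "e X \<in> Mor C" "Dom C (e X) = X" "Cod C (e X) = K X" if "X \<in> Obj C" for X
    using e(1)[OF that] by simp_all
  define I' where "I' = \<lparr>OMap = K, MMap = M\<rparr>"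
  have I's: "OMap I' = K" "MMap I' = M" by (simp_all add: I'_def)
  have cancel: "a = b" if "X \<in> Obj C" "a \<in> Hom C W (K X)" "b \<in> Hom C W (K X)" "k X \<cdot> a = k X \<cdot> b" for X W a b
    using mono_cancel[OF kt(5)] that kt(2) by metis
  have F: "cat_functor C C I'"
  proof (intro cat_functor.intro cat_functor_axioms.intro category_axioms, unfold I's)
    show "K X \<in> Obj C" if "X \<in> Obj C" for X using kt that by simp
    show "M f \<in> Hom C (K X) (K Y)" if "f \<in> Hom C X Y" for f X Y using Mt that by auto
    show "M (Ident C X) = Ident C (K X)" if X: "X \<in> Obj C" for X
    proof (rule cancel[OF X])
      show "k X \<cdot> M (Ident C X) = k X \<cdot> Ident C (K X)" using kM[of "Ident C X"] X kt N by simp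
    qed (use X Mt kt in simp_all)
    show "M (g \<cdot> f) = M g \<cdot> M f" if f: "f \<in> Hom C X Y" and g: "g \<in> Hom C Y Z" for f g X Y Z
    proof (rule cancel[of Z _ "K X"])
      have ob: "X \<in> Obj C" "Y \<in> Obj C" "Z \<in> Obj C" using f g by auto
      have "k Z \<cdot> M (g \<cdot> f) = MMap I g \<cdot> (MMap I f \<cdot> k X)"
        using kM[of "g \<cdot> f"] f g N ob kt by simp
      also have "\<dots> = MMap I g \<cdot> (k Y \<cdot> M f)" using kM[of f] f by simp
      also have "\<dots> = k Z \<cdot> (M g \<cdot> M f)"
      proof -
        have "k Z \<cdot> M g = MMap I g \<cdot> k Y" using kM[of g] g by simp
        from comp_assoc_rewrite[OF this, of "M f"] show ?thesis using f g N ob kt Mt by simp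
      qed
      finally show "k Z \<cdot> M (g \<cdot> f) = k Z \<cdot> (M g \<cdot> M f)" .
    qed (use f g Mt in auto)
  qed
  have "natural_transformation C C id_functor I' e"
  proof (intro natural_transformation.intro natural_transformation_axioms.intro id_cat_functor F, unfold I's)
    show "e X \<in> Hom C (OMap id_functor X) (K X)" if "X \<in> Obj C" for X
      using e that by (simp add: id_functor_def)
    show "e Y \<cdot> MMap id_functor f = M f \<cdot> e X" if f: "f \<in> Hom C X Y" for f X Y
    proof -
      have ob: "X \<in> Obj C" "Y \<in> Obj C" using f by auto
      have "e Y \<cdot> f = M f \<cdot> e X"
      proof (rule cancel[of Y _ X])
        have "k Y \<cdot> (e Y \<cdot> f) = \<eta> Y \<cdot> f"
          using comp_assoc_rewrite[OF e(2)[OF ob(2)], of f] f ob kt et by simp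
        also have "\<dots> = MMap I f \<cdot> (k X \<cdot> e X)" using N(10)[OF f] e(2) ob by simp
        also have "\<dots> = k Y \<cdot> (M f \<cdot> e X)"
        proof -
          have "k Y \<cdot> M f = MMap I f \<cdot> k X" using kM[of f] f by simp
          from comp_assoc_rewrite[OF this, of "e X"] show ?thesis using f N ob kt et Mt by simp
        qed
        finally show "k Y \<cdot> (e Y \<cdot> f) = k Y \<cdot> (M f \<cdot> e X)" .
      qed (use f ob et Mt in simp_all)
      then show ?thesis by (simp add: id_functor_def)
    qed
  qed
  moreover have "injective C (K X)" if X: "X \<in> Obj C" for X
  proof -
    let ?z = "MMap I (\<zero> X X)"
    have zt: "?z \<in> Hom C (OMap I X) (OMap I X)" using N X by simp
    have zz: "?z = MMap I (\<zero> pt X) \<cdot> MMap I (\<zero> X pt)" using N(6)[of "\<zero> X pt" "\<zero> pt X"] X ptO by simp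
    have tz: "MMap I (\<zero> X pt) \<cdot> ?z = MMap I (\<zero> X pt)" using N(6)[of "\<zero> X X" "\<zero> X pt"] X ptO by simp
    \<comment> \<open>the projection of \<open>I(X)\<close> onto \<open>I'(X)\<close> along \<open>I(pt)\<close>\<close>
    let ?h = "Ident C (OMap I X) \<oplus> \<ominus> ?z"
    have ht: "?h \<in> Hom C (OMap I X) (OMap I X)" using zt N X by simp
    have "MMap I (\<zero> X pt) \<cdot> ?h = \<zero> (OMap I X) (OMap I pt)"
      using zt N X ptO tz add_neg[of "MMap I (\<zero> X pt)"] by simp
    then obtain r where r: "r \<in> Hom C (OMap I X) (K X)" "k X \<cdot> r = ?h"
      using lift[OF X ht] by blast
    have zk: "?z \<cdot> k X = \<zero> (K X) (OMap I X)"
      unfolding zz using kt[OF X] N X ptO by simp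
    have "r \<cdot> k X = Ident C (K X)"
    proof (rule cancel[OF X])
      show "k X \<cdot> (r \<cdot> k X) = k X \<cdot> Ident C (K X)"
        using comp_assoc_rewrite[OF r(2), of "k X"] r(1) zt zk kt[OF X] N X by simp
    qed (use r kt X in simp_all)
    then show ?thesis using injective_retract[OF inj[OF X], of "k X" "K X" r] r(1) kt X by simp
  qed
  moreover have "monomorphism C (e X)" if X: "X \<in> Obj C" for X
  proof (rule monoI[of _ X "K X"])
    fix W t assume t: "t \<in> Hom C W X" and z: "e X \<cdot> t = \<zero> W (K X)"
    have W: "W \<in> Obj C" using t by auto
    have "\<eta> X \<cdot> t = k X \<cdot> (e X \<cdot> t)" using comp_assoc_rewrite[OF e(2)[OF X], of t] t X kt et by simp
    also have "\<dots> = \<zero> W (OMap I X)" unfolding z using X W kt by simp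
    finally show "t = \<zero> W X" using mono_zero[OF mono_unit[OF X], of t W] t N X by simp
  qed (use X e in simp)
  moreover have "monomorphism C (M f)" if f: "monomorphism C f" for f
  proof (rule monoI[of _ "K (Dom C f)" "K (Cod C f)"])
    have ft: "f \<in> Mor C" using f by (rule mono_mor)
    then show "M f \<in> Hom C (K (Dom C f)) (K (Cod C f))" by (rule Mh)
    fix W t assume t: "t \<in> Hom C W (K (Dom C f))" and z: "M f \<cdot> t = \<zero> W (K (Cod C f))"
    have W: "W \<in> Obj C" using t by auto
    have "monomorphism C (MMap I f \<cdot> k (Dom C f))"
      by (rule mono_comp[OF kt(5) mono_I[OF f]]) (use ft N kt in simp_all)
    moreover have "MMap I f \<cdot> k (Dom C f) \<cdot> t = \<zero> W (OMap I (Cod C f))"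
    proof -
      have "k (Cod C f) \<cdot> M f \<cdot> t = k (Cod C f) \<cdot> (M f \<cdot> t)" using t ft kt Mt by simp
      also have "\<dots> = \<zero> W (OMap I (Cod C f))" unfolding z using ft W kt by simp
      finally show ?thesis using kM[OF ft] by simp
    qed
    ultimately show "t = \<zero> W (K (Dom C f))"
      using mono_zero[of "MMap I f \<cdot> k (Dom C f)" t W] t ft N kt by simp
  qed
  moreover have "M (\<zero> X Y) = \<zero> (K X) (K Y)" if X: "X \<in> Obj C" and Y: "Y \<in> Obj C" for X Y
  proof (rule cancel[OF Y])
    have "MMap I (\<zero> X Y) = MMap I (\<zero> pt Y) \<cdot> MMap I (\<zero> X pt)" using N(6)[of "\<zero> X pt" "\<zero> pt Y"] X Y ptO by simp
    then have "MMap I (\<zero> X Y) \<cdot> k X = \<zero> (K X) (OMap I Y)" using kt[OF X] N X Y ptO by simp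
    then show "k Y \<cdot> M (\<zero> X Y) = k Y \<cdot> \<zero> (K X) (K Y)" using kM[of "\<zero> X Y"] X Y kt by simp
  qed (use X Y Mt kt in simp_all)
  ultimately have "reduced_injective_functor C I' e"
    by (intro reduced_injective_functor.intro reduced_injective_functor_axioms.intro
        quasi_frobenius_category_axioms) (simp_all add: I's)
  then show thesis by (rule that)
qed

section \<open>The cylinder functor\<close>

context reduced_injective_functor
begin

lemmas I_simps [simp] = natural_transformation_id(1-9)[OF natural_unit]

lemma unit_natural: "f \<in> Hom C X Y \<Longrightarrow> \<eta> Y \<cdot> f = MMap I f \<cdot> \<eta> X"
  by (rule natural_transformation_id(10)[OF natural_unit])

text \<open>
  This says \<open>X \<inter> I(X') = X'\<close> inside \<open>I(X)\<close>. Let \<open>\<kappa>: X \<rightarrow> L\<close> be the cokernel of \<open>u\<close> and \<open>\<psi>: V \<rightarrow> L\<close> the map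
  that is \<open>\<kappa>\<close> on \<open>X\<close> and zero on \<open>I(X')\<close>. Then \<open>\<eta> L \<cdot> \<psi> = I(\<kappa>) \<cdot> \<phi>\<close>; on \<open>I(X')\<close> this is the equation
  \<open>I(\<kappa>) \<cdot> I(u) = I(0) = 0\<close>. If \<open>\<phi>\<close> kills \<open>t\<close>, then so does \<open>\<psi>\<close>, hence \<open>t\<close> comes from \<open>I(X')\<close>, where \<open>\<phi>\<close>
  is the monomorphism \<open>I(u)\<close>.
\<close>
lemma mono_pushout_unit:
  assumes u: "monomorphism C u" "u \<in> Hom C X' X" and po: "pushout C u (\<eta> X') \<alpha> \<beta>"
    and \<phi>: "\<phi> \<in> Hom C (Cod C \<alpha>) (OMap I X)" "\<phi> \<cdot> \<alpha> = \<eta> X" "\<phi> \<cdot> \<beta> = MMap I u"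
  shows "monomorphism C \<phi>"
proof -
  define V where "V = Cod C \<alpha>"
  have ob: "X' \<in> Obj C" "X \<in> Obj C" using u(2) by auto
  have ut: "u \<in> Mor C" "Dom C u = X'" "Cod C u = X" using u(2) by simp_all
  have ab: "\<alpha> \<in> Hom C X V" "\<beta> \<in> Hom C (OMap I X') V" "\<beta> \<cdot> \<eta> X' = \<alpha> \<cdot> u"
    using pushout_hom[OF po] ut ob by (simp_all add: V_def)
  have V: "V \<in> Obj C" using ab by auto
  have \<phi>t: "\<phi> \<in> Hom C V (OMap I X)" using \<phi>(1) by (simp add: V_def)
  have mono_\<beta>: "monomorphism C \<beta>" by (rule pushout_mono[OF po u(1)])
  obtain \<kappa> where \<kappa>: "cokernel C u \<kappa>" using ex_cokernel ut by blast
  define L where "L = Cod C \<kappa>"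
  have \<kappa>t: "\<kappa> \<in> Hom C X L" "\<kappa> \<cdot> u = \<zero> X' L" and L: "L \<in> Obj C"
    using cokernel_hom[OF \<kappa>] ut by (simp_all add: L_def)
  obtain \<psi> where \<psi>: "\<psi> \<in> Hom C V L" "\<psi> \<cdot> \<alpha> = \<kappa>" "\<psi> \<cdot> \<beta> = \<zero> (OMap I X') L"
    unfolding V_def
    by (rule pushout_ex[OF po, of \<kappa> L "\<zero> (OMap I X') L"]) (use ut ob L \<kappa>t in simp_all)
  have "cokernel C \<beta> \<psi>"
  proof (rule cokernelI[of _ _ "OMap I X'"])
    show "epimorphism C \<psi>"
    proof (rule epiI[OF \<psi>(1)])
      fix W s assume s: "s \<in> Hom C L W" and z: "s \<cdot> \<psi> = \<zero> V W"
      have W: "W \<in> Obj C" using s by auto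
      have "s \<cdot> \<kappa> = \<zero> X W"
        using comp_assoc_rewrite[OF z, of \<alpha>] s \<psi> ab W by simp
      then show "s = \<zero> L W"
        using \<kappa>t(1) s L W by - (rule epi_cancel[OF cokernel_epi[OF \<kappa>], of _ W], simp_all)
    qed
    show "\<beta> \<in> Hom C (OMap I X') (Dom C \<psi>)" "\<psi> \<cdot> \<beta> = \<zero> (OMap I X') (Cod C \<psi>)"
      using ab \<psi> by simp_all
    fix W g assume "g \<in> Hom C (Dom C \<psi>) W" and z: "g \<cdot> \<beta> = \<zero> (OMap I X') W"
    then have g: "g \<in> Hom C V W" and W: "W \<in> Obj C" using \<psi>(1) by auto
    have "g \<cdot> \<alpha> \<cdot> u = g \<cdot> \<beta> \<cdot> \<eta> X'" using g ab ut ob by simp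
    also have "\<dots> = \<zero> X' W" unfolding z using ob W by simp
    finally obtain s where s: "s \<in> Hom C L W" "s \<cdot> \<kappa> = g \<cdot> \<alpha>"
      using cokernel_ex[OF \<kappa>, of "g \<cdot> \<alpha>" W] g ab ut by (auto simp: L_def)
    have "s \<cdot> \<psi> = g"
      using s(1) \<psi>(1) g unfolding V_def
      by - (rule pushout_eq[OF po, of _ W], use s \<psi> g ab W z ob in \<open>simp_all add: V_def\<close>)
    then show "\<exists>s \<in> Hom C (Cod C \<psi>) W. s \<cdot> \<psi> = g" using s(1) \<psi>(1) by auto
  qed
  then have ker: "kernel C \<psi> \<beta>" by (rule mono_kernel_of_cokernel[OF mono_\<beta>])
  have sq: "\<eta> L \<cdot> \<psi> = MMap I \<kappa> \<cdot> \<phi>"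
  proof -
    have "MMap I \<kappa> \<cdot> MMap I u = MMap I (\<kappa> \<cdot> u)" using \<kappa>t(1) ut ob by simp
    also have "\<dots> = \<zero> (OMap I X') (OMap I L)" unfolding \<kappa>t(2) using ob L by (simp add: I_zero)
    finally have 1: "MMap I \<kappa> \<cdot> \<phi> \<cdot> \<beta> = \<eta> L \<cdot> \<psi> \<cdot> \<beta>"
      using \<phi>(3) \<phi>t \<psi> \<kappa>t(1) ab L ob by simp
    have 2: "MMap I \<kappa> \<cdot> \<phi> \<cdot> \<alpha> = \<eta> L \<cdot> \<psi> \<cdot> \<alpha>"
      using \<phi>(2) \<phi>t \<psi> \<kappa>t(1) ab L ob unit_natural[OF \<kappa>t(1)] by simp
    show ?thesis
      by (rule pushout_eq[OF po, of _ "OMap I L"])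
        (use 1 2 \<phi>t \<psi>(1) \<kappa>t(1) L in \<open>simp_all add: V_def\<close>)
  qed
  show ?thesis
  proof (rule monoI[OF \<phi>t])
    fix W t assume t: "t \<in> Hom C W V" and z: "\<phi> \<cdot> t = \<zero> W (OMap I X)"
    have W: "W \<in> Obj C" using t by auto
    have "\<eta> L \<cdot> (\<psi> \<cdot> t) = MMap I \<kappa> \<cdot> (\<phi> \<cdot> t)"
      using comp_assoc_rewrite[OF sq, of t] t \<phi>t \<psi>(1) \<kappa>t(1) L by simp
    also have "\<dots> = \<zero> W (OMap I L)" unfolding z using \<kappa>t(1) ob W by simp
    finally have "\<psi> \<cdot> t = \<zero> W L"
      using mono_zero[OF mono_unit[OF L], of "\<psi> \<cdot> t" W] t \<psi>(1) L by simp
    then obtain s where s: "s \<in> Hom C W (OMap I X')" "\<beta> \<cdot> s = t"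
      using kernel_ex[OF ker, of t W] t \<psi>(1) ab by auto
    have "MMap I u \<cdot> s = \<phi> \<cdot> (\<beta> \<cdot> s)" using comp_assoc_rewrite[OF \<phi>(3), of s] s(1) \<phi>t ab by simp
    then have "MMap I u \<cdot> s = \<zero> W (OMap I X)" using s z by simp
    then have "s = \<zero> W (OMap I X')"
      using mono_zero[OF mono_I[OF u(1)], of s W] s(1) ut by simp
    then show "t = \<zero> W V" using s(2) ab W by auto
  qed
qed

end

lemma square_mor [simp]: "Square f' f u v \<in> Mor (arrow_category C) \<longleftrightarrow>
    f' \<in> Mor C \<and> f \<in> Mor C \<and> u \<in> Hom C (Dom C f') (Dom C f) \<and>
    v \<in> Hom C (Cod C f') (Cod C f) \<and> v \<cdot>\<^bsub>C\<^esub> f' = f \<cdot>\<^bsub>C\<^esub> u"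
  by (auto simp: arrow_category_def)

lemma square_homE:
  assumes "s \<in> Hom (arrow_category C) f' f"
  obtains u v where "s = Square f' f u v" "f' \<in> Mor C" "f \<in> Mor C" "u \<in> Hom C (Dom C f') (Dom C f)"
    "v \<in> Hom C (Cod C f') (Cod C f)" "v \<cdot>\<^bsub>C\<^esub> f' = f \<cdot>\<^bsub>C\<^esub> u"
proof (cases s)
  case (Square g' g u v)
  with assms have "g' = f'" "g = f" "Square f' f u v \<in> Mor (arrow_category C)"
    by (auto simp: arrow_category_def)
  with Square show thesis using that by simp
qed

lemma arrow_category_simps [simp]:
  "Obj (arrow_category C) = Mor C"
  "Ident (arrow_category C) f = Square f f (Ident C (Dom C f)) (Ident C (Cod C f))"
  "Comp (arrow_category C) (Square g h u' v') (Square f g' u v) = Square f h (u' \<cdot>\<^bsub>C\<^esub> u) (v' \<cdot>\<^bsub>C\<^esub> v)"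
  by (simp_all add: arrow_category_def)

text \<open>
  A choice of direct sums \<open>B f\<close> of \<open>Y\<close> and \<open>I(X)\<close> for all \<open>f: X \<rightarrow> Y\<close>; \<open>i\<close>, \<open>k\<close> are the inclusions and \<open>p\<close>,
  \<open>q\<close> the projections. Because (Cyl 2) is an equality of objects, the sum must be \<open>Y\<close> itself when
  \<open>X = pt\<close>.
\<close>
locale injective_cylinder = reduced_injective_functor C I \<eta>
  for C :: "('o, 'm, 'x) preadditive_scheme" (structure)
    and I :: "('o, 'm, 'o, 'm) functor_data" and \<eta> :: "'o \<Rightarrow> 'm" +
  fixes pt :: 'o and B :: "'m \<Rightarrow> 'o" and i k p q :: "'m \<Rightarrow> 'm"
  assumes pt: "zero_object C pt"
    and sum: "f \<in> Mor C \<Longrightarrow> biproduct (Cod C f) (OMap I (Dom C f)) (B f) (i f) (k f) (p f) (q f)"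
    and sum_pt: "\<lbrakk>f \<in> Mor C; Dom C f = pt\<rbrakk>
      \<Longrightarrow> B f = Cod C f \<and> i f = Ident C (Cod C f) \<and> p f = Ident C (Cod C f)"
begin

lemmas sum_hom [simp] = biproduct_hom[OF sum]
lemmas sum_reassoc [simp] = biproduct_eqs(1-4)[OF sum] biproduct_reassoc[OF sum]

fun cyl_map :: "'m square \<Rightarrow> 'm" where
  "cyl_map (Square f' f u v) = i f \<cdot> (v \<cdot> p f') \<oplus> k f \<cdot> (MMap I u \<cdot> q f')"

definition cyl :: "('m, 'm square, 'o, 'm) functor_data" where
  "cyl = \<lparr>OMap = B, MMap = cyl_map\<rparr>"

text \<open>
  The map \<open>j\<^sub>1\<close> of the cylinder; \<open>j\<^sub>2\<close> is \<open>i\<close>.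
\<close>
definition front :: "'m \<Rightarrow> 'm" where
  "front f = i f \<cdot> f \<oplus> k f \<cdot> \<eta> (Dom C f)"

lemma cyl_simps [simp]: "OMap cyl = B" "MMap cyl = cyl_map"
  by (simp_all add: cyl_def)

lemma front_hom [simp]:
  assumes "f \<in> Mor C"
  shows "front f \<in> Mor C" "Dom C (front f) = Dom C f" "Cod C (front f) = B f"
    "p f \<cdot> front f = f" "q f \<cdot> front f = \<eta> (Dom C f)"
  using assms by (simp_all add: front_def)

context
  fixes f' f u v
  assumes sq: "Square f' f u v \<in> Mor (arrow_category C)"
begin

lemma square_typed:
  shows "f' \<in> Mor C" "f \<in> Mor C" "u \<in> Mor C" "v \<in> Mor C" "Dom C u = Dom C f'" "Cod C u = Dom C f"
    "Dom C v = Cod C f'" "Cod C v = Cod C f" "v \<cdot> f' = f \<cdot> u"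
  using sq by auto

lemma cyl_map_hom:
  "cyl_map (Square f' f u v) \<in> Mor C" "Dom C (cyl_map (Square f' f u v)) = B f'"
  "Cod C (cyl_map (Square f' f u v)) = B f"
  using square_typed by simp_all

lemma cyl_map_proj:
  "p f \<cdot> cyl_map (Square f' f u v) = v \<cdot> p f'"
  "q f \<cdot> cyl_map (Square f' f u v) = MMap I u \<cdot> q f'"
  "cyl_map (Square f' f u v) \<cdot> i f' = i f \<cdot> v"
  using square_typed by simp_all

lemma cyl_map_front: "cyl_map (Square f' f u v) \<cdot> front f' = front f \<cdot> u"
proof (rule biproduct_eq_into[OF sum])
  show "f \<in> Mor C" by (rule square_typed)
  note t = square_typed cyl_map_hom
  show "p f \<cdot> (cyl_map (Square f' f u v) \<cdot> front f') = p f \<cdot> (front f \<cdot> u)"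
    using comp_assoc_rewrite[OF cyl_map_proj(1), of "front f'"] comp_assoc_rewrite[OF front_hom(4), of f u] t
    by (simp del: cyl_map.simps)
  show "q f \<cdot> (cyl_map (Square f' f u v) \<cdot> front f') = q f \<cdot> (front f \<cdot> u)"
    using comp_assoc_rewrite[OF cyl_map_proj(2), of "front f'"] comp_assoc_rewrite[OF front_hom(5), of f u] t
      unit_natural[of u "Dom C f'" "Dom C f"]
    by (simp del: cyl_map.simps)
qed (use square_typed cyl_map_hom in \<open>simp_all del: cyl_map.simps\<close>)

lemma mono_cyl_map:
  assumes u: "monomorphism C u" and v: "monomorphism C v"
  shows "monomorphism C (cyl_map (Square f' f u v))" (is "monomorphism C ?T")
proof (rule monoI)
  note t = square_typed cyl_map_hom
  show "?T \<in> Hom C (B f') (B f)" using t by (simp del: cyl_map.simps)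
  fix W s assume s: "s \<in> Hom C W (B f')" and z: "?T \<cdot> s = \<zero> W (B f)"
  have W: "W \<in> Obj C" using s by auto
  have "v \<cdot> (p f' \<cdot> s) = \<zero> W (Cod C f)" "MMap I u \<cdot> (q f' \<cdot> s) = \<zero> W (OMap I (Dom C f))"
    using comp_assoc_rewrite[OF cyl_map_proj(1), of s] comp_assoc_rewrite[OF cyl_map_proj(2), of s] z t s W
    by (simp_all del: cyl_map.simps)
  then have "p f' \<cdot> s = \<zero> W (Cod C f')" "q f' \<cdot> s = \<zero> W (OMap I (Dom C f'))"
    using mono_zero[OF v, of "p f' \<cdot> s" W] mono_zero[OF mono_I[OF u], of "q f' \<cdot> s" W] s t
    by simp_all
  then show "s = \<zero> W (B f')"
    using s t W by - (rule biproduct_eq_into[OF sum[OF t(1)]], simp_all)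
qed

text \<open>
  Let \<open>V\<close> be the pushout of \<open>X \<leftarrow> X' \<rightarrow> I(X')\<close>. The object \<open>R\<close> is a direct sum of \<open>Y\<close> and \<open>V\<close>, with
  inclusions \<open>d\<close> and \<open>\<sigma>\<close> and projections \<open>p \<cdot> w\<close> and \<open>\<rho>\<close>, and \<open>w\<close> is the sum of the identity of \<open>Y\<close> and the
  map \<open>\<phi>: V \<rightarrow> I(X)\<close> of \<open>mono_pushout_unit\<close>. What the proof needs of this are the equations
  \<open>q \<cdot> w = \<phi> \<cdot> \<rho>\<close> and \<open>1 = d \<cdot> p \<cdot> w + \<sigma> \<cdot> \<rho>\<close>: if \<open>w\<close> kills \<open>s\<close>, the first shows that \<open>\<rho>\<close> kills \<open>s\<close>, and
  then the second shows \<open>s = 0\<close>.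
\<close>
lemma mono_cyl_gap:
  assumes u: "monomorphism C u"
    and po1: "pushout C u (front f') a b" and po2: "pushout C (b \<cdot> i f') v c d"
    and a: "a \<in> Hom C (Dom C f) Q" and c: "c \<in> Hom C Q R" and w: "w \<in> Hom C R (B f)"
    and wa: "w \<cdot> (c \<cdot> a) = front f" and wb: "w \<cdot> (c \<cdot> b) = cyl_map (Square f' f u v)" and wd: "w \<cdot> d = i f"
  shows "monomorphism C w"
proof -
  note t = square_typed
  have b: "b \<in> Hom C (B f') Q" "b \<cdot> front f' = a \<cdot> u" 
    using pushout_hom[OF po1] a t by simp_all
  have d: "d \<in> Hom C (Cod C f) R" "d \<cdot> v = c \<cdot> (b \<cdot> i f')" 
    using pushout_hom(4)[OF po2] pushout_hom(7)[OF po2] pushout_hom(8)[OF po2] pushout_hom(9)[OF po2]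
      c b(1) t by simp_all
  have codc: "Cod C c = R" "Cod C a = Q" using a c by simp_all
  have ob: "Dom C f' \<in> Obj C" "Dom C f \<in> Obj C" "Q \<in> Obj C" "R \<in> Obj C" using t a c by auto
  obtain \<alpha> \<beta> where po: "pushout C u (\<eta> (Dom C f')) \<alpha> \<beta>"
    using obtain_pushout[of u "Dom C f'" "Dom C f" "\<eta> (Dom C f')" "OMap I (Dom C f')"] t ob by auto
  define V where "V = Cod C \<alpha>"
  have ab: "\<alpha> \<in> Hom C (Dom C f) V" "\<beta> \<in> Hom C (OMap I (Dom C f')) V" "\<beta> \<cdot> \<eta> (Dom C f') = \<alpha> \<cdot> u"
    using pushout_hom[OF po] t ob by (simp_all add: V_def)
  have V: "V \<in> Obj C" using ab by auto
  obtain \<phi> where \<phi>: "\<phi> \<in> Hom C V (OMap I (Dom C f))" "\<phi> \<cdot> \<alpha> = \<eta> (Dom C f)" "\<phi> \<cdot> \<beta> = MMap I u"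
    unfolding V_def
    by (rule pushout_ex[OF po, of "\<eta> (Dom C f)" "OMap I (Dom C f)" "MMap I u"])
      (use t ob unit_natural[of u "Dom C f'" "Dom C f"] in simp_all)
  have mono_\<phi>: "monomorphism C \<phi>"
    by (rule mono_pushout_unit[OF u _ po _ \<phi>(2,3)]) (use t \<phi>(1) in \<open>simp_all add: V_def\<close>)
  obtain \<rho>0 where \<rho>0: "\<rho>0 \<in> Hom C Q V" "\<rho>0 \<cdot> a = \<alpha>" "\<rho>0 \<cdot> b = \<beta> \<cdot> q f'"
  proof (rule pushout_ex[OF po1, of \<alpha> V "\<beta> \<cdot> q f'"])
    show "\<alpha> \<cdot> u = \<beta> \<cdot> q f' \<cdot> front f'" using ab t by simp
  qed (use t ab codc in simp_all)
  have \<rho>0i: "\<rho>0 \<cdot> (b \<cdot> i f') = \<zero> (Cod C f') V"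
    using comp_assoc_rewrite[OF \<rho>0(3), of "i f'"] \<rho>0(1) b ab t by simp
  obtain \<rho> where \<rho>: "\<rho> \<in> Hom C R V" "\<rho> \<cdot> c = \<rho>0" "\<rho> \<cdot> d = \<zero> (Cod C f) V"
    by (rule pushout_ex[OF po2, of \<rho>0 V "\<zero> (Cod C f) V"]) (use \<rho>0 \<rho>0i b t V codc in simp_all)
  have ca: "c \<cdot> a \<in> Hom C (Dom C f) R" and cb: "c \<cdot> b \<in> Hom C (B f') R" using a b c by simp_all
  have \<rho>ca: "\<rho> \<cdot> (c \<cdot> a) = \<alpha>" and \<rho>cb: "\<rho> \<cdot> (c \<cdot> b) = \<beta> \<cdot> q f'"
    using comp_assoc_rewrite[OF \<rho>(2), of a] comp_assoc_rewrite[OF \<rho>(2), of b] \<rho>(1) \<rho>0 a b c by simp_all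
  have eq: "g = g'" if g: "g \<in> Hom C R W" "g' \<in> Hom C R W" "g \<cdot> (c \<cdot> a) = g' \<cdot> (c \<cdot> a)"
    "g \<cdot> (c \<cdot> b) = g' \<cdot> (c \<cdot> b)" "g \<cdot> d = g' \<cdot> d" for g g' W
  proof (rule pushout_eq[OF po2, unfolded codc, OF g(1,2) _ g(5)])
    show "g \<cdot> c = g' \<cdot> c"
      by (rule pushout_eq[OF po1, unfolded codc, of _ W]) (use g a b c in simp_all)
  qed
  have qw: "q f \<cdot> w = \<phi> \<cdot> \<rho>"
  proof (rule eq[of _ "OMap I (Dom C f)"])
    show "q f \<cdot> w \<cdot> (c \<cdot> a) = \<phi> \<cdot> \<rho> \<cdot> (c \<cdot> a)"
      using wa \<rho>ca w \<phi> \<rho>(1) a c t by simp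
    show "q f \<cdot> w \<cdot> (c \<cdot> b) = \<phi> \<cdot> \<rho> \<cdot> (c \<cdot> b)"
      using wb \<rho>cb w \<phi> \<rho>(1) a b c t cyl_map_proj comp_assoc_rewrite[OF \<phi>(3), of "q f'"] ab
      by (simp del: cyl_map.simps)
    show "q f \<cdot> w \<cdot> d = \<phi> \<cdot> \<rho> \<cdot> d" using wd \<rho> w \<phi>(1) d t ob by simp
  qed (use w \<phi> \<rho> t in simp_all)
  \<comment> \<open>\<open>c \<cdot> a: X \<rightarrow> R\<close> lifts \<open>j\<^sub>1 = (f, \<eta>)\<close>, so its part \<open>d \<cdot> f\<close> in \<open>Y\<close> is subtracted\<close>
  obtain \<sigma> where \<sigma>: "\<sigma> \<in> Hom C V R" "\<sigma> \<cdot> \<alpha> = c \<cdot> a \<oplus> \<ominus> (d \<cdot> f)" "\<sigma> \<cdot> \<beta> = c \<cdot> (b \<cdot> k f')"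
    unfolding V_def
  proof (rule pushout_ex[OF po, of "c \<cdot> a \<oplus> \<ominus> (d \<cdot> f)" R "c \<cdot> (b \<cdot> k f')"])
    have "c \<cdot> (a \<cdot> u) = c \<cdot> (b \<cdot> front f')" using b by simp
    also have "\<dots> = (c \<cdot> (b \<cdot> i f')) \<cdot> f' \<oplus> c \<cdot> (b \<cdot> (k f' \<cdot> \<eta> (Dom C f')))"
      using b(1) c t ob by (simp add: front_def)
    also have "(c \<cdot> (b \<cdot> i f')) \<cdot> f' = d \<cdot> (f \<cdot> u)" unfolding d(2)[symmetric] using d(1) t by simp
    finally have "c \<cdot> (a \<cdot> u) = d \<cdot> (f \<cdot> u) \<oplus> c \<cdot> (b \<cdot> (k f' \<cdot> \<eta> (Dom C f')))" .
    moreover have "d \<cdot> (f \<cdot> u) \<oplus> e \<oplus> \<ominus> (d \<cdot> (f \<cdot> u)) = e"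
      if "e \<in> Hom C (Dom C f') R" for e
      using that d(1) t add_comm[of "d \<cdot> (f \<cdot> u)" e] by simp
    ultimately show "(c \<cdot> a \<oplus> \<ominus> (d \<cdot> f)) \<cdot> u = c \<cdot> (b \<cdot> k f') \<cdot> \<eta> (Dom C f')"
      using a b(1) c d(1) t ob by simp
  qed (use a b c d t ob in simp_all)
  have split: "d \<cdot> (p f \<cdot> w) \<oplus> \<sigma> \<cdot> \<rho> = Ident C R"
  proof (rule eq[of _ R])
    have "d \<cdot> f \<oplus> (c \<cdot> a \<oplus> \<ominus> (d \<cdot> f)) = c \<cdot> a"
      by (rule diff_add[symmetric, of _ "Dom C f" R]) (use a c d t in simp_all)
    then show "(d \<cdot> (p f \<cdot> w) \<oplus> \<sigma> \<cdot> \<rho>) \<cdot> (c \<cdot> a) = Ident C R \<cdot> (c \<cdot> a)"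
      using wa \<rho>ca w \<sigma>(1,2) \<rho>(1) a c d(1) t by simp
    have "(c \<cdot> (b \<cdot> i f')) \<cdot> p f' \<oplus> c \<cdot> (b \<cdot> (k f' \<cdot> q f')) = c \<cdot> (b \<cdot> (i f' \<cdot> p f' \<oplus> k f' \<cdot> q f'))"
      using b(1) c t by simp
    also have "\<dots> = c \<cdot> b" unfolding biproduct_eqs(5)[OF sum[OF t(1)]] using b(1) c t by simp
    finally have "d \<cdot> (v \<cdot> p f') \<oplus> c \<cdot> (b \<cdot> (k f' \<cdot> q f')) = c \<cdot> b"
      unfolding d(2)[symmetric] using d(1) t by simp
    then show "(d \<cdot> (p f \<cdot> w) \<oplus> \<sigma> \<cdot> \<rho>) \<cdot> (c \<cdot> b) = Ident C R \<cdot> (c \<cdot> b)"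
      using wb \<rho>cb w \<sigma>(1) comp_assoc_rewrite[OF \<sigma>(3), of "q f'"] \<rho>(1) a b(1) c d(1) t ab cyl_map_proj
      by (simp del: cyl_map.simps)
    show "(d \<cdot> (p f \<cdot> w) \<oplus> \<sigma> \<cdot> \<rho>) \<cdot> d = Ident C R \<cdot> d"
      using wd w \<sigma>(1) \<rho> d(1) t by simp
  qed (use w \<sigma>(1) \<rho>(1) d(1) t ob in simp_all)
  show ?thesis
  proof (rule monoI[OF w])
    fix W s assume s: "s \<in> Hom C W R" and z: "w \<cdot> s = \<zero> W (B f)"
    have W: "W \<in> Obj C" using s by auto
    have "\<phi> \<cdot> (\<rho> \<cdot> s) = q f \<cdot> (w \<cdot> s)"
      using comp_assoc_rewrite[OF qw, of s] s w \<phi>(1) \<rho>(1) t by simp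
    also have "\<dots> = \<zero> W (OMap I (Dom C f))" unfolding z using W t by simp
    finally have "\<rho> \<cdot> s = \<zero> W V"
      using mono_zero[OF mono_\<phi>, of "\<rho> \<cdot> s" W] s \<rho>(1) \<phi>(1) by simp
    moreover have "s = d \<cdot> (p f \<cdot> (w \<cdot> s)) \<oplus> \<sigma> \<cdot> (\<rho> \<cdot> s)"
    proof -
      have "s = (d \<cdot> (p f \<cdot> w) \<oplus> \<sigma> \<cdot> \<rho>) \<cdot> s" unfolding split using s by simp
      also have "\<dots> = d \<cdot> (p f \<cdot> (w \<cdot> s)) \<oplus> \<sigma> \<cdot> (\<rho> \<cdot> s)"
        using s w \<sigma>(1) \<rho>(1) d(1) t by simp
      finally show ?thesis .
    qed
    ultimately show "s = \<zero> W R" unfolding z using \<sigma>(1) d(1) W t V ob by simp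
  qed
qed

end

text \<open>
  Up to stable equality \<open>i\<close> is inverse to \<open>p\<close>, because \<open>1 - i \<cdot> p = k \<cdot> q\<close> factors through the
  projective object \<open>I(X)\<close>.
\<close>
lemma weq_p: assumes f: "f \<in> Mor C" shows "weq (p f)"
proof (rule weq_one_sided[of _ "B f" "Cod C f" "i f" "i f"])
  have "projective C (OMap I (Dom C f))"
    using injective_I projective_iff_injective f by simp
  then have "null (k f \<cdot> q f)" by (rule nullI[where X = "B f" and Y = "B f"]) (use f in simp_all)
  then have "i f \<cdot> p f \<oplus> k f \<cdot> q f \<simeq> i f \<cdot> p f" by (rule stable_eq_add_null) (use f in simp_all)
  then show "i f \<cdot> p f \<simeq> Ident C (B f)"
    unfolding biproduct_eqs(5)[OF sum[OF f]] by (rule stable_eq_sym)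
qed (use f in simp_all)

lemma cyl_functor: "cat_functor (arrow_category C) C cyl"
proof (intro cat_functor.intro cat_functor_axioms.intro arrow_category_category category_axioms, unfold cyl_simps)
  show "B f \<in> Obj C" if "f \<in> Obj (arrow_category C)" for f using that by simp
  show "cyl_map s \<in> Hom C (B f') (B f)" if "s \<in> Hom (arrow_category C) f' f" for s f' f
    using that by (rule square_homE) (simp add: cyl_map_hom del: cyl_map.simps)
  show "cyl_map (Ident (arrow_category C) f) = Ident C (B f)" if "f \<in> Obj (arrow_category C)" for f
    using that biproduct_eqs(5)[OF sum, of f] by simp
  show "cyl_map (r \<cdot>\<^bsub>arrow_category C\<^esub> s) = cyl_map r \<cdot> cyl_map s"
    if s: "s \<in> Hom (arrow_category C) f g" and r: "r \<in> Hom (arrow_category C) g h" for s r f g h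
    using s r by (elim square_homE) simp
qed

lemma source_cat_functor: "cat_functor (arrow_category C) C (source_functor C)"
proof (intro cat_functor.intro cat_functor_axioms.intro arrow_category_category category_axioms)
  show "OMap (source_functor C) f \<in> Obj C" if "f \<in> Obj (arrow_category C)" for f
    using that by (simp add: source_functor_def)
  show "MMap (source_functor C) s \<in> Hom C (OMap (source_functor C) f) (OMap (source_functor C) g)"
    if "s \<in> Hom (arrow_category C) f g" for s f g
    using that by (rule square_homE) (simp add: source_functor_def)
  show "MMap (source_functor C) (Ident (arrow_category C) f) = Ident C (OMap (source_functor C) f)" for f
    by (simp add: source_functor_def)
  show "MMap (source_functor C) (r \<cdot>\<^bsub>arrow_category C\<^esub> s) = MMap (source_functor C) r \<cdot> MMap (source_functor C) s"
    if "s \<in> Hom (arrow_category C) f g" "r \<in> Hom (arrow_category C) g h" for s r f g h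
    using that by (elim square_homE) (simp add: source_functor_def)
qed

lemma target_cat_functor: "cat_functor (arrow_category C) C (target_functor C)"
proof (intro cat_functor.intro cat_functor_axioms.intro arrow_category_category category_axioms)
  show "OMap (target_functor C) f \<in> Obj C" if "f \<in> Obj (arrow_category C)" for f
    using that by (simp add: target_functor_def)
  show "MMap (target_functor C) s \<in> Hom C (OMap (target_functor C) f) (OMap (target_functor C) g)"
    if "s \<in> Hom (arrow_category C) f g" for s f g
    using that by (rule square_homE) (simp add: target_functor_def)
  show "MMap (target_functor C) (Ident (arrow_category C) f) = Ident C (OMap (target_functor C) f)" for f
    by (simp add: target_functor_def)
  show "MMap (target_functor C) (r \<cdot>\<^bsub>arrow_category C\<^esub> s) = MMap (target_functor C) r \<cdot> MMap (target_functor C) s"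
    if "s \<in> Hom (arrow_category C) f g" "r \<in> Hom (arrow_category C) g h" for s r f g h
    using that by (elim square_homE) (simp add: target_functor_def)
qed

lemma natural_front: "natural_transformation (arrow_category C) C (source_functor C) cyl front"
proof (intro natural_transformation.intro natural_transformation_axioms.intro source_cat_functor cyl_functor)
  show "front f \<in> Hom C (OMap (source_functor C) f) (OMap cyl f)" if "f \<in> Obj (arrow_category C)" for f
    using that by (simp add: source_functor_def)
  show "front f \<cdot> MMap (source_functor C) s = MMap cyl s \<cdot> front f'" if "s \<in> Hom (arrow_category C) f' f" for s f' f
    using that by (rule square_homE) (simp add: source_functor_def cyl_map_front del: cyl_map.simps)
qed

lemma natural_i: "natural_transformation (arrow_category C) C (target_functor C) cyl i"
proof (intro natural_transformation.intro natural_transformation_axioms.intro target_cat_functor cyl_functor)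
  show "i f \<in> Hom C (OMap (target_functor C) f) (OMap cyl f)" if "f \<in> Obj (arrow_category C)" for f
    using that by (simp add: target_functor_def)
  show "i f \<cdot> MMap (target_functor C) s = MMap cyl s \<cdot> i f'" if "s \<in> Hom (arrow_category C) f' f" for s f' f
    using that by (rule square_homE) (simp add: target_functor_def cyl_map_proj del: cyl_map.simps)
qed

lemma natural_p: "natural_transformation (arrow_category C) C cyl (target_functor C) p"
proof (intro natural_transformation.intro natural_transformation_axioms.intro target_cat_functor cyl_functor)
  show "p f \<in> Hom C (OMap cyl f) (OMap (target_functor C) f)" if "f \<in> Obj (arrow_category C)" for f
    using that by (simp add: target_functor_def)
  show "p f \<cdot> MMap cyl s = MMap (target_functor C) s \<cdot> p f'" if "s \<in> Hom (arrow_category C) f' f" for s f' f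
    using that by (rule square_homE) (simp add: target_functor_def cyl_map_proj del: cyl_map.simps)
qed

text \<open>
  Let \<open>g: S \<rightarrow> X\<close> be the projection of the coproduct. Then \<open>q \<cdot> w = \<eta> \<cdot> g\<close>, so whatever \<open>w\<close> kills is killed
  by \<open>g\<close>, and \<open>1 = b \<cdot> p \<cdot> w + (a - b \<cdot> f) \<cdot> g\<close>.
\<close>
lemma mono_front_i:
  assumes f: "f \<in> Hom C X Y" and ab: "a \<in> Hom C X S" "b \<in> Hom C Y S" "coproduct C a b"
    and w: "w \<in> Hom C S (B f)" "w \<cdot> a = front f" "w \<cdot> b = i f"
  shows "monomorphism C w"
proof -
  have ft: "f \<in> Mor C" "Dom C f = X" "Cod C f = Y" using f by simp_all
  have ob: "X \<in> Obj C" "Y \<in> Obj C" "S \<in> Obj C" using f ab by auto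
  have ex1: "\<exists>!g. g \<in> Hom C S W \<and> g \<cdot> a = s \<and> g \<cdot> b = t" if "s \<in> Hom C X W" "t \<in> Hom C Y W" for s t W
  proof -
    have "Dom C a = X" "Dom C b = Y" "Cod C a = S" using ab by simp_all
    then show ?thesis using ab(3) that unfolding coproduct_def by blast
  qed
  have "\<exists>g. g \<in> Hom C S X \<and> g \<cdot> a = Ident C X \<and> g \<cdot> b = \<zero> Y X"
    using ex1[of "Ident C X" X "\<zero> Y X"] ob by auto
  then obtain g where g: "g \<in> Hom C S X" "g \<cdot> a = Ident C X" "g \<cdot> b = \<zero> Y X" by blast
  have eq: "s = s'" if "s \<in> Hom C S W" "s' \<in> Hom C S W" "s \<cdot> a = s' \<cdot> a" "s \<cdot> b = s' \<cdot> b" for s s' W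
  proof -
    have "s' \<cdot> a \<in> Hom C X W" "s' \<cdot> b \<in> Hom C Y W" using that ab by simp_all
    from ex1[OF this] show ?thesis using that by blast
  qed
  have qw: "q f \<cdot> w = \<eta> X \<cdot> g"
    by (rule eq[of _ "OMap I X"]) (use w g ab ft ob in simp_all)
  have af: "d \<oplus> (e \<oplus> \<ominus> d) = e" if "d \<in> Hom C X S" "e \<in> Hom C X S" for d e
    using diff_add[of e X S d] that by simp
  have split: "b \<cdot> (p f \<cdot> w) \<oplus> (a \<oplus> \<ominus> (b \<cdot> f)) \<cdot> g = Ident C S"
    by (rule eq[of _ S]) (use w g ab ft ob af in simp_all)
  show ?thesis
  proof (rule monoI[OF w(1)])
    fix W s assume s: "s \<in> Hom C W S" and z: "w \<cdot> s = \<zero> W (B f)"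
    have W: "W \<in> Obj C" using s by auto
    have "\<eta> X \<cdot> (g \<cdot> s) = q f \<cdot> (w \<cdot> s)"
      using comp_assoc_rewrite[OF qw, of s] s w(1) g(1) ft ob by simp
    also have "\<dots> = \<zero> W (OMap I X)" unfolding z using W ft by simp
    finally have gs: "g \<cdot> s = \<zero> W X"
      using mono_zero[OF mono_unit[OF ob(1)], of "g \<cdot> s" W] s g(1) ob by simp
    have "s = (b \<cdot> (p f \<cdot> w) \<oplus> (a \<oplus> \<ominus> (b \<cdot> f)) \<cdot> g) \<cdot> s" unfolding split using s by simp
    also have "\<dots> = b \<cdot> (p f \<cdot> (w \<cdot> s)) \<oplus> (a \<oplus> \<ominus> (b \<cdot> f)) \<cdot> (g \<cdot> s)"
      using s w(1) g(1) ab ft by simp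
    also have "\<dots> = \<zero> W S" unfolding z gs using ab ft W ob by simp
    finally show "s = \<zero> W S" .
  qed
qed

lemma cylinder: "cylinder_functor C pt {f. monomorphism C f} {f. weq f} cyl front i p"
proof (intro cylinder_functor.intro frobenius_waldhausen[OF pt] cylinder_functor_axioms.intro
    cyl_functor natural_front natural_i natural_p)
  show "p f \<cdot> front f = f" "p f \<cdot> i f = Ident C (Cod C f)" if "f \<in> Mor C" for f
    using that by simp_all
next
  fix f' f u v
  assume sq: "Square f' f u v \<in> Mor (arrow_category C)" and u: "u \<in> {f. weq f}" and v: "v \<in> {f. weq f}"
  note t = square_typed[OF sq] cyl_map_hom[OF sq]
  have "weq (v \<cdot> p f')" by (rule weq_compose) (use weq_p t v in simp_all)
  then have "weq (p f \<cdot> cyl_map (Square f' f u v))" using cyl_map_proj(1)[OF sq] by simp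
  then show "MMap cyl (Square f' f u v) \<in> {f. weq f}"
    using weq_cancel_left[of "cyl_map (Square f' f u v)" "B f'" "B f" "p f" "Cod C f"] weq_p t
    by (simp del: cyl_map.simps)
next
  fix f' f u v
  assume "Square f' f u v \<in> Mor (arrow_category C)" "u \<in> {f. monomorphism C f}" "v \<in> {f. monomorphism C f}"
  then show "MMap cyl (Square f' f u v) \<in> {f. monomorphism C f}"
    using mono_cyl_map[of f' f u v] by (simp del: cyl_map.simps square_mor)
next
  fix f' f u v a b c d Q R w
  assume "Square f' f u v \<in> Mor (arrow_category C)" "u \<in> {f. monomorphism C f}" "v \<in> {f. monomorphism C f}"
    "pushout C u (front f') a b" "pushout C (b \<cdot> i f') v c d" "a \<in> Hom C (Dom C f) Q"
    "c \<in> Hom C Q R" "w \<in> Hom C R (OMap cyl f)" "w \<cdot> (c \<cdot> a) = front f"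
    "w \<cdot> (c \<cdot> b) = MMap cyl (Square f' f u v)" "w \<cdot> d = i f"
  then show "w \<in> {f. monomorphism C f}"
    unfolding mem_Collect_eq cyl_simps by (intro mono_cyl_gap[of f' f u v a b c d Q R w])
next
  fix Y f assume "Y \<in> Obj C" "f \<in> Hom C pt Y"
  then show "OMap cyl f = Y \<and> p f = Ident C Y \<and> i f = Ident C Y" using sum_pt[of f] by simp
next
  fix f X Y a S b w
  assume "f \<in> Hom C X Y" "a \<in> Hom C X S" "b \<in> Hom C Y S" "coproduct C a b"
    "w \<in> Hom C S (OMap cyl f)" "w \<cdot> a = front f" "w \<cdot> b = i f"
  then show "w \<in> {f. monomorphism C f}"
    unfolding mem_Collect_eq cyl_simps by (rule mono_front_i)
qed

end

text \<open>
  The choice required when \<open>X = pt\<close> is possible because \<open>I(pt)\<close> is a zero object.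
\<close>
lemma (in reduced_injective_functor) obtain_injective_cylinder:
  assumes pt: "zero_object C pt"
  obtains B i k p q where "injective_cylinder C I \<eta> pt B i k p q"
proof -
  have ptO: "pt \<in> Obj C" using pt by (simp add: zero_object_def)
  define summand where "summand f = (\<lambda>(B, i, k, p, q).
      biproduct (Cod C f) (OMap I (Dom C f)) B i k p q \<and>
      (Dom C f = pt \<longrightarrow> B = Cod C f \<and> i = Ident C (Cod C f) \<and> p = Ident C (Cod C f)))" for f
  have ex: "\<exists>D. summand f D"
    if f: "f \<in> Mor C" for f
  proof (cases "Dom C f = pt")
    case True
    let ?Y = "Cod C f" and ?J = "OMap I pt"
    have "\<zero> pt pt = Ident C pt"
      using zero_object_to[OF pt, of "\<zero> pt pt" pt "Ident C pt"] ptO by simp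
    then have J: "Ident C ?J = \<zero> ?J ?J" using I_zero[OF ptO ptO] ptO by simp
    have "biproduct ?Y ?J ?Y (Ident C ?Y) (\<zero> ?J ?Y) (Ident C ?Y) (\<zero> ?Y ?J)"
      using f ptO J unfolding biproduct_def by simp
    then show ?thesis using True
      by (intro exI[of _ "(?Y, Ident C ?Y, \<zero> ?J ?Y, Ident C ?Y, \<zero> ?Y ?J)"]) (simp add: summand_def)
  next
    case False
    obtain B i k p q where "biproduct (Cod C f) (OMap I (Dom C f)) B i k p q"
      by (rule obtain_biproduct[of "Cod C f" "OMap I (Dom C f)"]) (use f in simp_all)
    then show ?thesis using False by (intro exI[of _ "(B, i, k, p, q)"]) (simp add: summand_def)
  qed
  have "\<exists>D. \<forall>f \<in> Mor C. summand f (D f)" by (rule bchoice) (use ex in blast)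
  then obtain D where D: "\<And>f. f \<in> Mor C \<Longrightarrow> summand f (D f)" by blast
  define B i k p q where "B = (\<lambda>f. fst (D f))" and "i = (\<lambda>f. fst (snd (D f)))"
    and "k = (\<lambda>f. fst (snd (snd (D f))))" and "p = (\<lambda>f. fst (snd (snd (snd (D f)))))"
    and "q = (\<lambda>f. snd (snd (snd (snd (D f)))))"
  have "summand f (B f, i f, k f, p f, q f)" if "f \<in> Mor C" for f
    using D[OF that] by (simp add: B_def i_def k_def p_def q_def)
  then have "injective_cylinder C I \<eta> pt B i k p q"
    by unfold_locales (simp_all add: pt summand_def)
  then show thesis by (rule that)
qed

theorem corollary3p12:
  fixes C :: "('o, 'm) preadditive"
  assumes "quasi_frobenius_category C"
    and "enough_projectives C"
    and "functorially_enough_injectives C"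
  shows "\<exists>pt.
    waldhausen_category C pt {f. monomorphism C f} {f. stable_equivalence C f} \<and>
    saturation_axiom C {f. stable_equivalence C f} \<and>
    extension_axiom C pt {f. monomorphism C f} {f. stable_equivalence C f} \<and>
    (\<exists>T j1 j2 p.
      cylinder_functor C pt {f. monomorphism C f} {f. stable_equivalence C f} T j1 j2 p \<and>
      cylinder_axiom C {f. stable_equivalence C f} p)"
proof -
  interpret quasi_frobenius_category C by (rule assms(1))
  obtain I0 \<eta>0 where 0: "natural_transformation C C id_functor I0 \<eta>0"
    "\<And>X. X \<in> Obj C \<Longrightarrow> injective C (OMap I0 X)" "\<And>X. X \<in> Obj C \<Longrightarrow> monomorphism C (\<eta>0 X)"
    "\<And>f. monomorphism C f \<Longrightarrow> monomorphism C (MMap I0 f)"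
    using assms(3) unfolding functorially_enough_injectives_def by blast
  then obtain I \<eta> where "reduced_injective_functor C I \<eta>"
    by (rule obtain_reduced_injective_functor)
  then interpret reduced_injective_functor C I \<eta> .
  obtain pt where pt: "zero_object C pt" using ex_zero_object by blast
  then obtain B i k p q where "injective_cylinder C I \<eta> pt B i k p q"
    by (rule obtain_injective_cylinder)
  then interpret injective_cylinder C I \<eta> pt B i k p q .
  have hull: "\<exists>J h. injective C J \<and> h \<in> Hom C X J \<and> monomorphism C h" if "X \<in> Obj C" for X
    using injective_I mono_unit that by (intro exI[of _ "OMap I X"] exI[of _ "\<eta> X"]) simp
  have "cylinder_axiom C {f. stable_equivalence C f} p"
    unfolding cylinder_axiom_def using weq_p by simp
  then show ?thesis
    using frobenius_waldhausen[OF pt] frobenius_saturation frobenius_extension[OF pt hull] cylinder by blast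
qed

end
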